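(* Let $(M,\omega)$, $J$, $H$, $X$ and the points $A,B,C,D\in M$ be as defined in the context, let $0<\gamma<\frac1{48}$, and let $F_t=(J,(1-2t)H+t\gamma X)$. At $t=\frac12$, the focus-focus points $A$ and $B$ both lie in $F_{\frac12}^{-1}(1,0)$ and the focus-focus points $C$ and $D$ both lie in $F_{\frac12}^{-1}(2,0)$, and both fibres have the form of a double pinched torus. Moreover, the fibre $F_{\frac12}^{-1}(1,0)$ equals $$\left\{\left[\sqrt2,\sqrt{6-|z_8|^2},\sqrt{6-|z_8|^2},\sqrt{8-|z_8|^2},2,\sqrt{2+|z_8|^2},\pm i\overline{z_8},z_8\right]\in M\ \middle|\ |z_8|\in[0,\sqrt6]\right\}$$ (both signs included). Using polar coordinates, this yields for $F_{\frac12}^{-1}(1,0)$ the parametrisation $$\left\{\left[\sqrt2,\sqrt{6-r^2},\sqrt{6-r^2},\sqrt{8-r^2},2,\sqrt{2+r^2},\pm rie^{-i\theta},re^{i\theta}\right]\in M\ \middle|\ \theta\in[0,2\pi[,\ r\in[0,\sqrt6]\right\}.$$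
   Context: Construction of $(M,\omega)$. On $\mathbb{C}^8$ with coordinates $z_k=x_k+iy_k$ take the symplectic form $\omega_{st}=-\frac{i}{2}\sum_{k=1}^8 dz_k\wedge d\bar z_k$. Let $W\subset\mathbb{C}^8$ be the set of points satisfying (A) $|z_1|^2+|z_5|^2=6$, (B) $|z_2|^2+|z_5|^2+|z_7|^2=10$, (C) $|z_3|^2+|z_7|^2=6$, (D) $|z_4|^2-|z_5|^2+|z_7|^2=4$, (E) $|z_5|^2-|z_6|^2+|z_7|^2=2$, (F) $|z_5|^2-|z_7|^2+|z_8|^2=4$. The torus $N\simeq\mathbb{T}^6=(\mathbb{R}/2\pi\mathbb{Z})^6$ acts on $\mathbb{C}^8$ by $$(t,z)\mapsto(e^{it_1}z_1,e^{it_2}z_2,e^{it_3}z_3,e^{it_4}z_4,e^{i(t_1+t_2-t_4-t_5+t_6)}z_5,e^{it_5}z_6,e^{i(t_2+t_3+t_4-t_5-t_6)}z_7,e^{it_6}z_8).$$ $W$ is a regular level set of a momentum map of this action, $N$ acts freely on $W$, and $M:=W/N$ with quotient map $\tau:W\to M$ is a $4$-dimensional compact connected manifold carrying the unique symplectic form $\omega$ with $\tau^*\omega=\kappa^*\omega_{st}$, where $\kappa:W\hookrightarrow\mathbb{C}^8$ is the inclusion. Points of $M$ are written $[z]=[z_1,\dots,z_8]$. Functions on $M$ (well defined since $N$-invariant): $J([z])=\frac12|z_1|^2$, $H([z])=\frac12|z_3|^2$, $X([z])=\mathrm{Re}(\overline{z_2}\,\overline{z_3}\,\overline{z_4}\,z_6z_7z_8)$.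 Points: $A=[\sqrt2,\sqrt6,\sqrt6,2\sqrt2,2,\sqrt2,0,0]$, $B=[\sqrt2,0,0,\sqrt2,2,2\sqrt2,\sqrt6,\sqrt6]$, $C=[2,2\sqrt2,\sqrt6,\sqrt6,\sqrt2,0,0,\sqrt2]$, $D=[2,\sqrt2,0,0,\sqrt2,\sqrt6,\sqrt6,2\sqrt2]$. A fixed point $p$ of $f=(f_1,f_2)$ (i.e. $df(p)=0$) is nondegenerate iff $d^2f_1(p),d^2f_2(p)$ are linearly independent and some linear combination of $\omega_p^{-1}d^2f_1(p),\omega_p^{-1}d^2f_2(p)$ has four distinct eigenvalues; it is focus-focus if these are $\pm\alpha\pm i\beta$ with $\alpha,\beta\in\mathbb{R}\setminus\{0\}$. A double pinched torus (at two given points) is a chain of two spheres intersecting each other transversally exactly in the two given points (here the two focus-focus points). *)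

theory Defs
  imports "HOL-Analysis.Analysis"
begin

section \<open>Smooth maps between Euclidean spaces\<close>

definition dir_deriv ::
    "'a::euclidean_space \<Rightarrow> ('a \<Rightarrow> 'b::real_normed_vector) \<Rightarrow> 'a \<Rightarrow> 'b" where
  "dir_deriv v f = (\<lambda>x. frechet_derivative f (at x) v)"

text \<open>\<open>Ck_on k f U\<close>: all iterated directional derivatives of order \<open>\<le> k\<close> exist and are
  continuous; for open \<open>U\<close> this is the usual class \<open>C\<^sup>k\<close>.\<close>

primrec Ck_on ::
    "nat \<Rightarrow> ('a::euclidean_space \<Rightarrow> 'b::real_normed_vector) \<Rightarrow> 'a set \<Rightarrow> bool" where
  "Ck_on 0 f U \<longleftrightarrow> continuous_on U f"
| "Ck_on (Suc k) f U \<longleftrightarrow>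
     (\<forall>x\<in>U. f differentiable (at x)) \<and> (\<forall>v. Ck_on k (dir_deriv v f) U)"

definition smooth_on ::
    "('a::euclidean_space \<Rightarrow> 'b::real_normed_vector) \<Rightarrow> 'a set \<Rightarrow> bool" where
  "smooth_on f U \<longleftrightarrow> open U \<and> (\<forall>k. Ck_on k f U)"


section \<open>The quotient \<open>M = W / N\<close>\<close>

text \<open>In the index type \<open>8\<close> the numeral \<open>8\<close> denotes the same element as \<open>0\<close>; the indices
  \<open>1, \<dots>, 8\<close> are the eight distinct ones (and likewise for the index type \<open>6\<close>).\<close>

definition omega_st :: "complex ^ 8 \<Rightarrow> complex ^ 8 \<Rightarrow> real" where
  "omega_st u v = Re (- (\<i> / 2) * (\<Sum>k\<in>UNIV. u $ k * cnj (v $ k) - v $ k * cnj (u $ k)))"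

definition constraint :: "complex ^ 8 \<Rightarrow> real ^ 6" where
  "constraint z = vector
     [ (cmod (z $ 1))\<^sup>2 + (cmod (z $ 5))\<^sup>2,
       (cmod (z $ 2))\<^sup>2 + (cmod (z $ 5))\<^sup>2 + (cmod (z $ 7))\<^sup>2,
       (cmod (z $ 3))\<^sup>2 + (cmod (z $ 7))\<^sup>2,
       (cmod (z $ 4))\<^sup>2 - (cmod (z $ 5))\<^sup>2 + (cmod (z $ 7))\<^sup>2,
       (cmod (z $ 5))\<^sup>2 - (cmod (z $ 6))\<^sup>2 + (cmod (z $ 7))\<^sup>2,
       (cmod (z $ 5))\<^sup>2 - (cmod (z $ 7))\<^sup>2 + (cmod (z $ 8))\<^sup>2 ]"

definition level_W :: "(complex ^ 8) set" where
  "level_W = {z. constraint z = vector [6, 10, 6, 4, 2, 4]}"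

text \<open>An element of \<open>N = (\<real> / 2\<pi>\<int>)\<^sup>6\<close> is given by a representative in \<open>\<real>\<^sup>6\<close>.\<close>

definition act :: "real ^ 6 \<Rightarrow> complex ^ 8 \<Rightarrow> complex ^ 8" where
  "act t z = vector
     [ cis (t $ 1) * z $ 1,
       cis (t $ 2) * z $ 2,
       cis (t $ 3) * z $ 3,
       cis (t $ 4) * z $ 4,
       cis (t $ 1 + t $ 2 - t $ 4 - t $ 5 + t $ 6) * z $ 5,
       cis (t $ 5) * z $ 6,
       cis (t $ 2 + t $ 3 + t $ 4 - t $ 5 - t $ 6) * z $ 7,
       cis (t $ 6) * z $ 8 ]"

text \<open>\<open>orbit\<close> is the quotient map \<open>\<tau>\<close>, and \<open>pt [z\<^sub>1, \<dots>, z\<^sub>8]\<close> is the point written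
  \<open>[z\<^sub>1, \<dots>, z\<^sub>8]\<close> in homogeneous notation (it lies in \<open>M\<close> if \<open>z \<in> W\<close>).\<close>

definition orbit :: "complex ^ 8 \<Rightarrow> (complex ^ 8) set" where
  "orbit z = range (\<lambda>t. act t z)"

definition quot_M :: "(complex ^ 8) set set" where
  "quot_M = orbit ` level_W"

definition pt :: "complex list \<Rightarrow> (complex ^ 8) set" where
  "pt zs = orbit (vector zs)"

text \<open>The function on the quotient induced by an \<open>N\<close>-invariant function; see
  \<open>fn_J_orbit\<close>, \<open>fn_H_orbit\<close> and \<open>fn_X_orbit\<close> below for the independence of the representative.\<close>

definition descend :: "(complex ^ 8 \<Rightarrow> 'b) \<Rightarrow> (complex ^ 8) set \<Rightarrow> 'b" where
  "descend g p = g (SOME z. z \<in> p)"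

definition fn_J :: "(complex ^ 8) set \<Rightarrow> real" where
  "fn_J = descend (\<lambda>z. 1 / 2 * (cmod (z $ 1))\<^sup>2)"

definition fn_H :: "(complex ^ 8) set \<Rightarrow> real" where
  "fn_H = descend (\<lambda>z. 1 / 2 * (cmod (z $ 3))\<^sup>2)"

definition fn_X :: "(complex ^ 8) set \<Rightarrow> real" where
  "fn_X = descend (\<lambda>z. Re (cnj (z $ 2) * cnj (z $ 3) * cnj (z $ 4) * z $ 6 * z $ 7 * z $ 8))"

definition fn_F :: "real \<Rightarrow> real \<Rightarrow> (complex ^ 8) set \<Rightarrow> real \<times> real" where
  "fn_F \<gamma> t p = (fn_J p, (1 - 2 * t) * fn_H p + t * \<gamma> * fn_X p)"

definition fibre :: "((complex ^ 8) set \<Rightarrow> real \<times> real) \<Rightarrow> real \<times> real \<Rightarrow> (complex ^ 8) set set" where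
  "fibre f c = {p \<in> quot_M. f p = c}"

definition point_A :: "(complex ^ 8) set" where
  "point_A = pt [sqrt 2, sqrt 6, sqrt 6, 2 * sqrt 2, 2, sqrt 2, 0, 0]"

definition point_B :: "(complex ^ 8) set" where
  "point_B = pt [sqrt 2, 0, 0, sqrt 2, 2, 2 * sqrt 2, sqrt 6, sqrt 6]"

definition point_C :: "(complex ^ 8) set" where
  "point_C = pt [2, 2 * sqrt 2, sqrt 6, sqrt 6, sqrt 2, 0, 0, sqrt 2]"

definition point_D :: "(complex ^ 8) set" where
  "point_D = pt [2, sqrt 2, 0, 0, sqrt 2, sqrt 6, sqrt 6, 2 * sqrt 2]"


section \<open>Tangent spaces and charts of \<open>M\<close>\<close>

text \<open>\<open>T\<^bsub>[z]\<^esub>M\<close> is \<open>tangent_W z\<close> modulo \<open>tangent_orbit z\<close>; tangent vectors and subspaces of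
  \<open>M\<close> are represented by their preimages in \<open>tangent_W z\<close>.  As \<open>W\<close> is a regular level set,
  its tangent space is the kernel of the derivative of the defining map.\<close>

definition tangent_W :: "complex ^ 8 \<Rightarrow> (complex ^ 8) set" where
  "tangent_W z = {v. frechet_derivative constraint (at z) v = 0}"

definition tangent_orbit :: "complex ^ 8 \<Rightarrow> (complex ^ 8) set" where
  "tangent_orbit z = range (frechet_derivative (\<lambda>t. act t z) (at 0))"

text \<open>A local parametrisation \<open>\<tau> \<circ> \<sigma>\<close> of the \<open>4\<close>-manifold \<open>M\<close> with \<open>0 \<mapsto> p\<close>, given through a
  smooth lift \<open>\<sigma>\<close> to \<open>W\<close>: it is injective, and immersive because no non-zero vector is mapped
  by \<open>d\<sigma>\<close> into the tangent space of the orbit.\<close>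

definition chart_at :: "(complex ^ 8) set \<Rightarrow> (real ^ 4) set \<Rightarrow> (real ^ 4 \<Rightarrow> complex ^ 8) \<Rightarrow> bool" where
  "chart_at p U \<sigma> \<longleftrightarrow>
     open U \<and> 0 \<in> U \<and> smooth_on \<sigma> U \<and> \<sigma> ` U \<subseteq> level_W \<and> orbit (\<sigma> 0) = p \<and>
     inj_on (\<lambda>x. orbit (\<sigma> x)) U \<and>
     (\<forall>x\<in>U. \<forall>v. frechet_derivative \<sigma> (at x) v \<in> tangent_orbit (\<sigma> x) \<longrightarrow> v = 0)"

text \<open>The matrix of \<open>\<omega>\<^sub>p\<close> in the chart: since \<open>\<tau>\<^sup>* \<omega> = \<kappa>\<^sup>* \<omega>\<^sub>s\<^sub>t\<close>, the pullback of \<open>\<omega>\<close>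
  under \<open>\<tau> \<circ> \<sigma>\<close> is the pullback of \<open>\<omega>\<^sub>s\<^sub>t\<close> under \<open>\<sigma>\<close>.\<close>

definition omega_matrix :: "(real ^ 4 \<Rightarrow> complex ^ 8) \<Rightarrow> real ^ 4 ^ 4" where
  "omega_matrix \<sigma> = (\<chi> i j. omega_st (frechet_derivative \<sigma> (at 0) (axis i 1))
                                     (frechet_derivative \<sigma> (at 0) (axis j 1)))"

definition hessian_matrix :: "(real ^ 4 \<Rightarrow> real) \<Rightarrow> real ^ 4 ^ 4" where
  "hessian_matrix g = (\<chi> i j. dir_deriv (axis i 1) (dir_deriv (axis j 1) g) 0)"

definition eigenvalues_of :: "real ^ 'n ^ 'n \<Rightarrow> complex set" where
  "eigenvalues_of A = {\<mu>. \<exists>v. v \<noteq> 0 \<and> map_matrix complex_of_real A *v v = \<mu> *s v}"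


section \<open>Nondegenerate and focus-focus fixed points\<close>

definition fixed_in_chart :: "((complex ^ 8) set \<Rightarrow> real \<times> real) \<Rightarrow> (real ^ 4 \<Rightarrow> complex ^ 8) \<Rightarrow> bool" where
  "fixed_in_chart f \<sigma> \<longleftrightarrow> ((\<lambda>x. f (orbit (\<sigma> x))) has_derivative (\<lambda>_. 0)) (at 0)"

text \<open>The matrix of \<open>\<omega>\<^sub>p\<^sup>-\<^sup>1 (a d\<^sup>2f\<^sub>1(p) + b d\<^sup>2f\<^sub>2(p))\<close>.  The sign convention for the
  isomorphism \<open>\<omega>\<^sub>p : T\<^sub>pM \<rightarrow> T\<^sub>p\<^sup>*M\<close> is immaterial, as only arbitrary linear combinations are used.\<close>

definition linearisation ::
    "((complex ^ 8) set \<Rightarrow> real \<times> real) \<Rightarrow> (real ^ 4 \<Rightarrow> complex ^ 8) \<Rightarrow> real \<Rightarrow> real \<Rightarrow> real ^ 4 ^ 4" where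
  "linearisation f \<sigma> a b =
     a *\<^sub>R (matrix_inv (omega_matrix \<sigma>) ** hessian_matrix (\<lambda>x. fst (f (orbit (\<sigma> x))))) +
     b *\<^sub>R (matrix_inv (omega_matrix \<sigma>) ** hessian_matrix (\<lambda>x. snd (f (orbit (\<sigma> x)))))"

definition hessians_independent ::
    "((complex ^ 8) set \<Rightarrow> real \<times> real) \<Rightarrow> (real ^ 4 \<Rightarrow> complex ^ 8) \<Rightarrow> bool" where
  "hessians_independent f \<sigma> \<longleftrightarrow>
     (\<forall>a b. a *\<^sub>R hessian_matrix (\<lambda>x. fst (f (orbit (\<sigma> x)))) +
            b *\<^sub>R hessian_matrix (\<lambda>x. snd (f (orbit (\<sigma> x)))) = 0 \<longrightarrow> a = 0 \<and> b = 0)"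

text \<open>All ingredients are independent of the chart, the Hessian because \<open>p\<close> is a fixed point.
  The last clause contains nondegeneracy, since the four numbers are distinct.\<close>

definition focus_focus_point :: "((complex ^ 8) set \<Rightarrow> real \<times> real) \<Rightarrow> (complex ^ 8) set \<Rightarrow> bool" where
  "focus_focus_point f p \<longleftrightarrow>
     (\<exists>U \<sigma>. chart_at p U \<sigma> \<and> fixed_in_chart f \<sigma> \<and> hessians_independent f \<sigma> \<and>
        (\<exists>a b \<alpha> \<beta>. \<alpha> \<noteq> 0 \<and> \<beta> \<noteq> 0 \<and>
           eigenvalues_of (linearisation f \<sigma> a b) =
             {Complex \<alpha> \<beta>, Complex \<alpha> (- \<beta>), Complex (- \<alpha>) \<beta>, Complex (- \<alpha>) (- \<beta>)}))"


section \<open>Spheres in \<open>M\<close> and double pinched tori\<close>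

abbreviation S2 :: "(real ^ 3) set" where
  "S2 \<equiv> sphere 0 1"

text \<open>A map \<open>e\<close> from the unit sphere to \<open>M\<close> is smooth near \<open>x\<close> iff it lifts to \<open>W\<close> there by the
  restriction of a smooth map \<open>\<sigma>\<close> on a neighbourhood of \<open>x\<close> in \<open>\<real>\<^sup>3\<close>.  (The map \<open>\<tau>\<close> is a
  principal bundle, so smooth maps into \<open>M\<close> have smooth local lifts.)\<close>

definition local_lift ::
    "(real ^ 3 \<Rightarrow> (complex ^ 8) set) \<Rightarrow> real ^ 3 \<Rightarrow> (real ^ 3) set \<Rightarrow> (real ^ 3 \<Rightarrow> complex ^ 8) \<Rightarrow> bool" where
  "local_lift e x U \<sigma> \<longleftrightarrow>
     open U \<and> x \<in> U \<and> smooth_on \<sigma> U \<and> (\<forall>y\<in>U \<inter> S2. \<sigma> y \<in> level_W \<and> orbit (\<sigma> y) = e y)"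

text \<open>Smooth injective immersion of the sphere, hence by compactness an embedding;
  \<open>T\<^sub>xS\<^sup>2\<close> is the orthogonal complement of \<open>x\<close>.\<close>

definition embedded_sphere :: "(real ^ 3 \<Rightarrow> (complex ^ 8) set) \<Rightarrow> bool" where
  "embedded_sphere e \<longleftrightarrow>
     inj_on e S2 \<and>
     (\<forall>x\<in>S2. \<exists>U \<sigma>. local_lift e x U \<sigma> \<and>
        (\<forall>v. x \<bullet> v = 0 \<and> frechet_derivative \<sigma> (at x) v \<in> tangent_orbit (\<sigma> x) \<longrightarrow> v = 0))"

text \<open>The preimage in \<open>tangent_W z\<close> of the tangent space of the embedded sphere at \<open>[z]\<close>.\<close>

definition sphere_tangent :: "(real ^ 3 \<Rightarrow> (complex ^ 8) set) \<Rightarrow> complex ^ 8 \<Rightarrow> (complex ^ 8) set" where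
  "sphere_tangent e z =
     {frechet_derivative \<sigma> (at x) v + n | U \<sigma> x v n.
        x \<in> S2 \<and> local_lift e x U \<sigma> \<and> \<sigma> x = z \<and> x \<bullet> v = 0 \<and> n \<in> tangent_orbit z}"

definition transverse_at ::
    "(complex ^ 8) set \<Rightarrow> (real ^ 3 \<Rightarrow> (complex ^ 8) set) \<Rightarrow> (real ^ 3 \<Rightarrow> (complex ^ 8) set) \<Rightarrow> bool" where
  "transverse_at p e1 e2 \<longleftrightarrow>
     (\<forall>z\<in>p. {u + v | u v. u \<in> sphere_tangent e1 z \<and> v \<in> sphere_tangent e2 z} = tangent_W z)"

definition double_pinched_torus ::
    "(complex ^ 8) set set \<Rightarrow> (complex ^ 8) set \<Rightarrow> (complex ^ 8) set \<Rightarrow> bool" where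
  "double_pinched_torus K p q \<longleftrightarrow>
     p \<noteq> q \<and>
     (\<exists>e1 e2. embedded_sphere e1 \<and> embedded_sphere e2 \<and>
        K = e1 ` S2 \<union> e2 ` S2 \<and> e1 ` S2 \<inter> e2 ` S2 = {p, q} \<and>
        transverse_at p e1 e2 \<and> transverse_at q e1 e2)"


section \<open>Well-definedness of the functions on the quotient\<close>

lemma vector_8:
  "(vector [a, b, c, d, e, f, g, h] :: ('a::zero) ^ 8) $ 1 = a"
  "(vector [a, b, c, d, e, f, g, h] :: ('a::zero) ^ 8) $ 2 = b"
  "(vector [a, b, c, d, e, f, g, h] :: ('a::zero) ^ 8) $ 3 = c"
  "(vector [a, b, c, d, e, f, g, h] :: ('a::zero) ^ 8) $ 4 = d"
  "(vector [a, b, c, d, e, f, g, h] :: ('a::zero) ^ 8) $ 5 = e"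
  "(vector [a, b, c, d, e, f, g, h] :: ('a::zero) ^ 8) $ 6 = f"
  "(vector [a, b, c, d, e, f, g, h] :: ('a::zero) ^ 8) $ 7 = g"
  "(vector [a, b, c, d, e, f, g, h] :: ('a::zero) ^ 8) $ 8 = h"
  unfolding vector_def by simp_all

lemma act_zero: "act 0 z = z"
proof -
  have all8: "i = 1 \<or> i = 2 \<or> i = 3 \<or> i = 4 \<or> i = 5 \<or> i = 6 \<or> i = 7 \<or> i = 8" for i :: 8
  proof (induct i)
    case (of_int z)
    then have "z \<in> {0, 1, 2, 3, 4, 5, 6, 7}" by auto
    then show ?case by auto
  qed
  show ?thesis
    unfolding vec_eq_iff
  proof
    fix i :: 8
    show "act 0 z $ i = z $ i"
      using all8[of i] by (elim disjE; simp add: act_def vector_8)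
  qed
qed

lemma act_level_W: "z \<in> level_W \<Longrightarrow> act t z \<in> level_W"
  by (simp add: level_W_def constraint_def act_def vector_8 norm_mult)

lemma orbit_rep: "\<exists>t. (SOME w. w \<in> orbit z) = act t z"
proof -
  have "act 0 z \<in> orbit z" unfolding orbit_def by blast
  then have "(SOME w. w \<in> orbit z) \<in> orbit z" by (rule someI)
  then show ?thesis unfolding orbit_def by blast
qed

lemma descend_orbit:
  assumes "\<And>t. g (act t z) = g z"
  shows "descend g (orbit z) = g z"
  using orbit_rep[of z] assms unfolding descend_def by metis

lemma fn_J_orbit: "fn_J (orbit z) = 1 / 2 * (cmod (z $ 1))\<^sup>2"
  unfolding fn_J_def by (rule descend_orbit) (simp add: act_def vector_8 norm_mult)

lemma fn_H_orbit: "fn_H (orbit z) = 1 / 2 * (cmod (z $ 3))\<^sup>2"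
  unfolding fn_H_def by (rule descend_orbit) (simp add: act_def vector_8 norm_mult)

lemma fn_X_orbit:
  "fn_X (orbit z) = Re (cnj (z $ 2) * cnj (z $ 3) * cnj (z $ 4) * z $ 6 * z $ 7 * z $ 8)"
  unfolding fn_X_def
proof (rule descend_orbit)
  fix t :: "real ^ 6"
  let ?P = "cnj (z $ 2) * cnj (z $ 3) * cnj (z $ 4) * z $ 6 * z $ 7 * z $ 8"
  have "cnj (act t z $ 2) * cnj (act t z $ 3) * cnj (act t z $ 4) * act t z $ 6 * act t z $ 7 * act t z $ 8
      = (cis (- t $ 2) * cis (- t $ 3) * cis (- t $ 4) * cis (t $ 5) *
         cis (t $ 2 + t $ 3 + t $ 4 - t $ 5 - t $ 6) * cis (t $ 6)) * ?P"
    by (simp add: act_def vector_8 cis_cnj)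
  also have "\<dots> = ?P"
    by (simp add: cis_mult)
  finally show "Re (cnj (act t z $ 2) * cnj (act t z $ 3) * cnj (act t z $ 4) * act t z $ 6 * act t z $ 7 * act t z $ 8) = Re ?P"
    by simp
qed

end

theory Submission
  imports Defs
begin

text \<open>At \<open>t = 1/2\<close> the map is \<open>F = (J, \<gamma>/2 X)\<close>.  Everything is read off from one slice of the torus
  action.  On \<open>W\<close> the moduli of \<open>p = z\<^sub>7\<close> and \<open>q = z\<^sub>8\<close> determine the other six moduli, and where these six do
  not vanish the torus makes the corresponding coordinates positive, with no freedom left.  So \<open>(p, q)\<close>
  are coordinates on an open part of \<open>M\<close> containing \<open>A\<close>, which is the point \<open>p = q = 0\<close>.  In them
  \<open>\<omega>\<close> is standard at \<open>A\<close>, \<open>J = 1 + (\<bar>q\<bar>\<^sup>2 - \<bar>p\<bar>\<^sup>2)/2\<close>, and \<open>X\<close> is a positive function times \<open>Re (p q)\<close>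
  (lemmas \<open>fn_J_slice\<close> and \<open>fn_X_slice\<close>).

  The two quadratic forms \<open>\<bar>q\<bar>\<^sup>2 - \<bar>p\<bar>\<^sup>2\<close> and \<open>Re (p q)\<close> are the normal form of a focus-focus point: a combination
  of their linearised Hamiltonian vector fields has the eigenvalues \<open>\<plusminus> 1 \<plusminus> i\<close> (lemma
  \<open>focus_focus_criterion\<close>).  The points \<open>B\<close>, \<open>C\<close>, \<open>D\<close> need no new computation.  Two permutations of the
  coordinates of \<open>\<complex>\<^sup>8\<close> descend to symplectic symmetries of \<open>M\<close> that preserve \<open>X\<close>: \<open>flip_H\<close> preserves \<open>J\<close> and exchanges
  \<open>A\<close> with \<open>B\<close>, while \<open>flip_J\<close> replaces \<open>J\<close> by \<open>3 - J\<close> and sends \<open>A\<close> to \<open>C\<close> and \<open>B\<close> to \<open>D\<close>.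

  The equations \<open>J = 1\<close> and \<open>X = 0\<close> say \<open>\<bar>p\<bar> = \<bar>q\<bar>\<close> and \<open>Re (p q) = 0\<close>, that is \<open>p = \<plusminus> i cnj q\<close>, and the
  constraints give \<open>\<bar>q\<bar>\<^sup>2 \<le> 6\<close>.  For either sign this is a closed disc in the variable \<open>q\<close>, whose centre
  is \<open>A\<close> and whose boundary circle is collapsed to \<open>B\<close>, hence a sphere.  The two spheres meet only
  where \<open>q = 0\<close> or on the collapsed circle, and at \<open>A\<close> they are tangent to the complementary planes \<open>p = i cnj q\<close> and
  \<open>p = - i cnj q\<close>.  Smoothness and transversality at \<open>B\<close> follow because \<open>flip_H\<close> exchanges the two spheres up to
  a reflection of the parameter, and the fibre over \<open>(2, 0)\<close> is the image of the one over \<open>(1, 0)\<close> under \<open>flip_J\<close>.\<close>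

section \<open>Calculus of \<open>C\<^sup>k\<close> maps\<close>

lemma dir_deriv_eq: "(f has_derivative f') (at x) \<Longrightarrow> dir_deriv v f x = f' v"
  by (simp add: dir_deriv_def frechet_derivative_at[symmetric])

lemma has_derivative_cong_open:
  assumes "open U" "x \<in> U" "\<And>y. y \<in> U \<Longrightarrow> f y = g y"
  shows "(f has_derivative D) (at x) \<longleftrightarrow> (g has_derivative D) (at x)"
  using has_derivative_transform_within_open[of _ _ x UNIV U] assms by metis

lemma dir_deriv_cong_open:
  assumes "open U" "x \<in> U" "\<And>y. y \<in> U \<Longrightarrow> f y = g y"
  shows "dir_deriv v f x = dir_deriv v g x"
  unfolding dir_deriv_def frechet_derivative_def
  using has_derivative_cong_open[OF assms] by simp

lemma Ck_on_cong:
  assumes "open U" "\<And>y. y \<in> U \<Longrightarrow> f y = g y"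
  shows "Ck_on k f U \<longleftrightarrow> Ck_on k g U"
  using assms(2)
proof (induction k arbitrary: f g)
  case 0
  then show ?case by (simp cong: continuous_on_cong)
next
  case (Suc k)
  have "f differentiable (at x) \<longleftrightarrow> g differentiable (at x)" if "x \<in> U" for x
    unfolding differentiable_def using has_derivative_cong_open[OF assms(1) that Suc.prems] by simp
  moreover have "Ck_on k (dir_deriv v f) U \<longleftrightarrow> Ck_on k (dir_deriv v g) U" for v
    by (rule Suc.IH) (rule dir_deriv_cong_open[OF assms(1) _ Suc.prems])
  ultimately show ?case by simp
qed

text \<open>The form in which smoothness is proved below: any pointwise formula for the derivative may
  replace the chosen one \<open>frechet_derivative\<close>, because on an open set only germs matter.\<close>

lemma Ck_on_SucI:
  assumes "open U" "\<And>x. x \<in> U \<Longrightarrow> (f has_derivative f' x) (at x)" "\<And>v. Ck_on k (\<lambda>x. f' x v) U"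
  shows "Ck_on (Suc k) f U"
proof -
  have "Ck_on k (dir_deriv v f) U" for v
    using Ck_on_cong[OF assms(1), of "dir_deriv v f" "\<lambda>x. f' x v"] dir_deriv_eq[OF assms(2)] assms(3)
    by auto
  then show ?thesis using assms(2) by (auto simp: differentiable_def)
qed

lemma Ck_on_has_derivative:
  assumes "Ck_on (Suc k) f U" "x \<in> U"
  shows "(f has_derivative (\<lambda>v. dir_deriv v f x)) (at x)"
  using assms unfolding dir_deriv_def by (simp add: frechet_derivative_works)

lemma Ck_on_continuous_on: "Ck_on k f U \<Longrightarrow> continuous_on U f"
  by (cases k) (auto simp: differentiable_imp_continuous_within continuous_at_imp_continuous_on)

lemma Ck_on_Suc_imp: "Ck_on (Suc k) f U \<Longrightarrow> Ck_on k f U"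
proof (induction k arbitrary: f)
  case 0
  then show ?case using Ck_on_continuous_on[of "Suc 0" f U] by simp
next
  case (Suc k)
  show ?case
    unfolding Ck_on.simps(2)[of k]
  proof (intro conjI allI ballI)
    fix v
    have "Ck_on (Suc k) (dir_deriv v f) U" using Suc.prems by simp
    then show "Ck_on k (dir_deriv v f) U" by (rule Suc.IH)
  qed (use Suc.prems in simp)
qed

lemma Ck_on_const: "open U \<Longrightarrow> Ck_on k (\<lambda>x. c) U"
proof (induction k arbitrary: c)
  case (Suc k)
  show ?case
    by (rule Ck_on_SucI[OF Suc.prems, where f' = "\<lambda>_ _. 0"]) (use Suc in auto)
qed auto

lemma Ck_on_add:
  assumes "open U" "Ck_on k f U" "Ck_on k g U"
  shows "Ck_on k (\<lambda>x. f x + g x) U"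
  using assms(2-)
proof (induction k arbitrary: f g)
  case 0
  then show ?case by (simp add: continuous_on_add)
next
  case (Suc k)
  show ?case
  proof (rule Ck_on_SucI[OF assms(1)])
    show "((\<lambda>x. f x + g x) has_derivative (\<lambda>v. dir_deriv v f x + dir_deriv v g x)) (at x)" if "x \<in> U" for x
      using Suc.prems that by (intro has_derivative_add Ck_on_has_derivative)
    show "Ck_on k (\<lambda>x. dir_deriv v f x + dir_deriv v g x) U" for v
      using Suc by auto
  qed
qed

lemma Ck_on_bounded_linear:
  assumes "open U" "bounded_linear L" "Ck_on k f U"
  shows "Ck_on k (\<lambda>x. L (f x)) U"
  using assms(3)
proof (induction k arbitrary: f)
  case 0
  then show ?case by (simp add: bounded_linear.continuous_on[OF assms(2)])
next
  case (Suc k)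
  show ?case
  proof (rule Ck_on_SucI[OF assms(1)])
    show "((\<lambda>x. L (f x)) has_derivative (\<lambda>v. L (dir_deriv v f x))) (at x)" if "x \<in> U" for x
      using Suc.prems that by (intro bounded_linear.has_derivative[OF assms(2)] Ck_on_has_derivative)
    show "Ck_on k (\<lambda>x. L (dir_deriv v f x)) U" for v
      using Suc by auto
  qed
qed

lemma Ck_on_id: "open U \<Longrightarrow> Ck_on k (\<lambda>x. x) U"
proof (cases k)
  case (Suc l)
  assume "open U"
  then show ?thesis
    unfolding Suc by (intro Ck_on_SucI[where f' = "\<lambda>_ v. v"] Ck_on_const) auto
qed auto

lemma Ck_on_linear:
  assumes "open U" "bounded_linear L"
  shows "Ck_on k L U"
  using Ck_on_bounded_linear[OF assms Ck_on_id[OF assms(1)]] .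

lemma Ck_on_bilinear:
  assumes "open U" "bounded_bilinear B" "Ck_on k f U" "Ck_on k g U"
  shows "Ck_on k (\<lambda>x. B (f x) (g x)) U"
  using assms(3-)
proof (induction k arbitrary: f g)
  case 0
  then show ?case by (simp add: bounded_bilinear.continuous_on[OF assms(2)])
next
  case (Suc k)
  show ?case
  proof (rule Ck_on_SucI[OF assms(1)])
    show "((\<lambda>x. B (f x) (g x)) has_derivative
            (\<lambda>v. B (f x) (dir_deriv v g x) + B (dir_deriv v f x) (g x))) (at x)" if "x \<in> U" for x
      using Suc.prems that by (intro bounded_bilinear.FDERIV[OF assms(2)] Ck_on_has_derivative)
    show "Ck_on k (\<lambda>x. B (f x) (dir_deriv v g x) + B (dir_deriv v f x) (g x)) U" for v
      using Suc.prems Suc.prems[THEN Ck_on_Suc_imp] by (intro Ck_on_add[OF assms(1)] Suc.IH) auto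
  qed
qed

lemmas Ck_on_mult = Ck_on_bilinear[OF _ bounded_bilinear_mult]

text \<open>Since \<open>L\<close> is linear, the derivative of \<open>f \<circ> L\<close> along \<open>v\<close> is the derivative of \<open>f\<close> along the fixed
  vector \<open>L v\<close>, again precomposed with \<open>L\<close>, and the induction goes through.\<close>

lemma Ck_on_compose_linear:
  assumes "open U" "bounded_linear L" "Ck_on k f U"
  shows "Ck_on k (\<lambda>x. f (L x)) (L -` U)"
proof -
  have op: "open (L -` U)"
    using assms(1) linear_continuous_at[OF assms(2)] by (intro continuous_open_vimage)
  show ?thesis
    using assms(3)
  proof (induction k arbitrary: f)
    case 0
    have "L ` (L -` U) \<subseteq> U" by blast
    with 0 show ?case
      using continuous_on_compose2[OF _ linear_continuous_on[OF assms(2)] \<open>L ` (L -` U) \<subseteq> U\<close>] by auto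
  next
    case (Suc k)
    show ?case
    proof (rule Ck_on_SucI[OF op])
      show "((\<lambda>x. f (L x)) has_derivative (\<lambda>v. dir_deriv (L v) f (L x))) (at x)" if "x \<in> L -` U" for x
        using has_derivative_compose[OF bounded_linear_imp_has_derivative[OF assms(2)]
            Ck_on_has_derivative[OF Suc.prems]] that by auto
      show "Ck_on k (\<lambda>x. dir_deriv (L v) f (L x)) (L -` U)" for v
        using Suc by auto
    qed
  qed
qed

text \<open>The derivative of a power with any real exponent is again such a power times the
  derivative of the base, so all exponents have to be treated together in the induction.\<close>

lemma Ck_on_powr:
  fixes f :: "'a::euclidean_space \<Rightarrow> real"
  assumes "open U" "Ck_on k f U" "\<And>x. x \<in> U \<Longrightarrow> 0 < f x"
  shows "Ck_on k (\<lambda>x. f x powr a) U"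
  using assms(2)
proof (induction k arbitrary: a)
  case 0
  have "\<forall>x\<in>U. f x \<noteq> 0" using assms(3) by force
  then show ?case using 0 by (simp add: continuous_on_powr)
next
  case (Suc k)
  show ?case
  proof (rule Ck_on_SucI[OF assms(1)])
    show "((\<lambda>x. f x powr a) has_derivative (\<lambda>v. (a * (f x powr (a - 1))) * dir_deriv v f x)) (at x)"
      if "x \<in> U" for x
    proof -
      have "((\<lambda>y. y powr a) has_derivative (*) (a * (f x powr (a - 1)))) (at (f x))"
        using has_real_derivative_powr[OF assms(3)[OF that], of a]
        by (simp add: has_field_derivative_def)
      from has_derivative_compose[OF Ck_on_has_derivative[OF Suc.prems that] this]
      show ?thesis .
    qed
    show "Ck_on k (\<lambda>x. a * (f x powr (a - 1)) * dir_deriv v f x) U" for v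
      using Suc.prems Suc.IH[OF Ck_on_Suc_imp[OF Suc.prems]]
      by (intro Ck_on_mult assms(1) Ck_on_const) auto
  qed
qed

lemma Ck_on_sqrt:
  fixes f :: "'a::euclidean_space \<Rightarrow> real"
  assumes "open U" "Ck_on k f U" "\<And>x. x \<in> U \<Longrightarrow> 0 < f x"
  shows "Ck_on k (\<lambda>x. sqrt (f x)) U"
  using Ck_on_cong[OF assms(1), of "\<lambda>x. f x powr (1/2)" "\<lambda>x. sqrt (f x)"]
    Ck_on_powr[OF assms, of "1/2"] assms(3) by (simp add: powr_half_sqrt less_imp_le)

lemma Ck_on_inverse:
  fixes f :: "'a::euclidean_space \<Rightarrow> real"
  assumes "open U" "Ck_on k f U" "\<And>x. x \<in> U \<Longrightarrow> 0 < f x"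
  shows "Ck_on k (\<lambda>x. inverse (f x)) U"
  using Ck_on_cong[OF assms(1), of "\<lambda>x. f x powr (- 1)" "\<lambda>x. inverse (f x)"]
    Ck_on_powr[OF assms, of "- 1"] assms(3) by (simp add: powr_minus less_imp_le)

lemma Ck_on_sum:
  assumes "open U" "\<And>i. i \<in> I \<Longrightarrow> Ck_on k (f i) U"
  shows "Ck_on k (\<lambda>x. \<Sum>i\<in>I. f i x) U"
  using assms(2)
  by (induction I rule: infinite_finite_induct) (auto intro!: Ck_on_const Ck_on_add assms(1))

text \<open>Maps into \<open>'b ^ 'n\<close> are treated componentwise by writing them as sums of their components
  along the coordinate axes.\<close>

lemma bounded_linear_axis: "bounded_linear (axis i :: 'b::real_normed_vector \<Rightarrow> 'b ^ 'n::finite)"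
proof (rule bounded_linear_intro[where K = 1])
  fix x y :: 'b and r :: real
  show "axis i (x + y) = axis i x + (axis i y :: 'b ^ 'n)" by (simp add: axis_def vec_eq_iff)
  show "axis i (r *\<^sub>R x) = r *\<^sub>R (axis i x :: 'b ^ 'n)" by (simp add: axis_def vec_eq_iff)
  show "norm (axis i x :: 'b ^ 'n) \<le> norm x * 1" 
  proof -
    have "norm (axis i x :: 'b ^ 'n) \<le> (\<Sum>j\<in>UNIV. norm ((axis i x :: 'b ^ 'n) $ j))"
      unfolding norm_vec_def by (rule L2_set_le_sum) simp
    also have "\<dots> = (\<Sum>j\<in>UNIV. if j = i then norm x else 0)"
      by (rule sum.cong) (auto simp: axis_def)
    finally show ?thesis by simp
  qed
qed

lemma vec_sum_axis: "(z :: 'b::real_normed_vector ^ 'n::finite) = (\<Sum>i\<in>UNIV. axis i (z $ i))"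
  by (simp add: vec_eq_iff axis_def)

lemma Ck_on_vec:
  fixes f :: "'a::euclidean_space \<Rightarrow> 'b::real_normed_vector ^ 'n::finite"
  assumes "open U" "\<And>i. Ck_on k (\<lambda>x. f x $ i) U"
  shows "Ck_on k f U"
proof -
  have "Ck_on k (\<lambda>x. \<Sum>i\<in>UNIV. axis i (f x $ i)) U"
    by (intro Ck_on_sum Ck_on_bounded_linear[OF _ bounded_linear_axis] assms)
  then show ?thesis unfolding vec_sum_axis[symmetric] .
qed

lemma has_derivative_vec:
  fixes f :: "'a::real_normed_vector \<Rightarrow> 'b::real_normed_vector ^ 'n::finite"
  assumes "\<And>i. ((\<lambda>x. f x $ i) has_derivative (\<lambda>v. f' v $ i)) F"
  shows "(f has_derivative f') F"
proof -
  have "((\<lambda>x. \<Sum>i\<in>UNIV. axis i (f x $ i)) has_derivative (\<lambda>v. \<Sum>i\<in>UNIV. axis i (f' v $ i))) F"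
    by (intro has_derivative_sum bounded_linear.has_derivative[OF bounded_linear_axis] assms)
  then show ?thesis unfolding vec_sum_axis[symmetric] .
qed

lemma smooth_on_compose:
  assumes "smooth_on f U" "bounded_linear L" "bounded_linear R"
  shows "smooth_on (\<lambda>x. L (f (R x))) (R -` U)"
proof -
  have op: "open (R -` U)"
    using assms(1) linear_continuous_at[OF assms(3)]
    by (intro continuous_open_vimage) (auto simp: smooth_on_def)
  have "Ck_on k (\<lambda>x. L (f (R x))) (R -` U)" for k
    using Ck_on_bounded_linear[OF op assms(2) Ck_on_compose_linear[OF _ assms(3)]] assms(1)
    unfolding smooth_on_def by blast
  with op show ?thesis by (simp add: smooth_on_def)
qed

lemma smooth_on_has_derivative:
  assumes "smooth_on f U" "x \<in> U"
  shows "(f has_derivative frechet_derivative f (at x)) (at x)"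
  using Ck_on_has_derivative[of 0 f U x] assms unfolding smooth_on_def dir_deriv_def by blast

lemma frechet_derivative_compose_linear:
  assumes "(f has_derivative f') (at (R x))" "bounded_linear L" "bounded_linear R"
  shows "frechet_derivative (\<lambda>x. L (f (R x))) (at x) = (\<lambda>v. L (f' (R v)))"
  by (rule frechet_derivative_at[symmetric])
    (intro bounded_linear.has_derivative[OF assms(2)]
      has_derivative_compose[OF bounded_linear_imp_has_derivative[OF assms(3)] assms(1)])

section \<open>The torus action and its tangent directions\<close>

lemma exhaust_8: "(i::8) = 1 \<or> i = 2 \<or> i = 3 \<or> i = 4 \<or> i = 5 \<or> i = 6 \<or> i = 7 \<or> i = 8"
proof (induct i)
  case (of_int z)
  then have "z \<in> {0, 1, 2, 3, 4, 5, 6, 7}" by auto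
  then show ?case by auto
qed

lemma forall_8: "(\<forall>i::8. R i) \<longleftrightarrow> R 1 \<and> R 2 \<and> R 3 \<and> R 4 \<and> R 5 \<and> R 6 \<and> R 7 \<and> R 8"
  by (metis exhaust_8)

lemma exhaust_6: "(i::6) = 1 \<or> i = 2 \<or> i = 3 \<or> i = 4 \<or> i = 5 \<or> i = 6"
proof (induct i)
  case (of_int z)
  then have "z \<in> {0, 1, 2, 3, 4, 5}" by auto
  then show ?case by auto
qed

lemma forall_6: "(\<forall>i::6. R i) \<longleftrightarrow> R 1 \<and> R 2 \<and> R 3 \<and> R 4 \<and> R 5 \<and> R 6"
  by (metis exhaust_6)

lemma sum_8: "sum f (UNIV::8 set) = f 1 + f 2 + f 3 + f 4 + f 5 + f 6 + f 7 + f 8"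
proof -
  have UNIV_8: "(UNIV::8 set) = {1, 2, 3, 4, 5, 6, 7, 8}" using exhaust_8 by auto
  show ?thesis unfolding UNIV_8 by (simp add: add.assoc)
qed

lemma vector_6:
  "(vector [a, b, c, d, e, f] :: ('a::zero) ^ 6) $ 1 = a"
  "(vector [a, b, c, d, e, f] :: ('a::zero) ^ 6) $ 2 = b"
  "(vector [a, b, c, d, e, f] :: ('a::zero) ^ 6) $ 3 = c"
  "(vector [a, b, c, d, e, f] :: ('a::zero) ^ 6) $ 4 = d"
  "(vector [a, b, c, d, e, f] :: ('a::zero) ^ 6) $ 5 = e"
  "(vector [a, b, c, d, e, f] :: ('a::zero) ^ 6) $ 6 = f"
  unfolding vector_def by simp_all

definition phase :: "real ^ 6 \<Rightarrow> real ^ 8" where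
  "phase t = vector [t $ 1, t $ 2, t $ 3, t $ 4, t $ 1 + t $ 2 - t $ 4 - t $ 5 + t $ 6, t $ 5,
     t $ 2 + t $ 3 + t $ 4 - t $ 5 - t $ 6, t $ 6]"

text \<open>The vector field on \<open>\<complex>\<^sup>8\<close> generated by an element of the Lie algebra of \<open>N\<close>.\<close>

definition inf_act :: "real ^ 6 \<Rightarrow> complex ^ 8 \<Rightarrow> complex ^ 8" where
  "inf_act \<theta> z = (\<chi> k. \<i> * phase \<theta> $ k * z $ k)"

lemmas phase_nth = phase_def vector_8

lemma act_nth: "act t z $ k = cis (phase t $ k) * z $ k"
proof -
  have "\<forall>k. act t z $ k = cis (phase t $ k) * z $ k"
    unfolding forall_8 by (simp add: act_def phase_def vector_8)
  then show ?thesis ..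
qed

lemma phase_add: "phase (s + t) $ k = phase s $ k + phase t $ k"
proof -
  have "\<forall>k. phase (s + t) $ k = phase s $ k + phase t $ k"
    unfolding forall_8 by (simp add: phase_nth)
  then show ?thesis ..
qed

lemma phase_scaleR: "phase (r *\<^sub>R t) $ k = r * phase t $ k"
proof -
  have "\<forall>k. phase (r *\<^sub>R t) $ k = r * phase t $ k"
    unfolding forall_8 by (simp add: phase_nth algebra_simps)
  then show ?thesis ..
qed

lemma bounded_linear_phase: "bounded_linear (\<lambda>t. phase t $ k)"
  by (rule linear_conv_bounded_linear[THEN iffD1]) (auto intro!: linearI simp: phase_add phase_scaleR)

lemma act_add: "act (s + t) z = act s (act t z)"
  by (simp add: vec_eq_iff act_nth phase_add cis_mult[symmetric] ac_simps)

lemma act_inverse: "act (- t) (act t z) = z" "act t (act (- t) z) = z"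
  by (simp_all flip: act_add add: act_zero)

lemma orbit_act: "orbit (act t z) = orbit z"
proof -
  have 1: "act s z = act (s - t) (act t z)" for s by (simp flip: act_add)
  have 2: "act s (act t z) = act (s + t) z" for s by (simp add: act_add)
  have "w \<in> orbit (act t z) \<longleftrightarrow> w \<in> orbit z" for w
    unfolding orbit_def image_iff Bex_def using 1 2 by (metis UNIV_I)
  then show ?thesis by blast
qed

lemma orbit_self: "z \<in> orbit z"
  unfolding orbit_def using act_zero[of z] by (metis rangeI)

lemma orbit_eq_iff: "orbit z = orbit w \<longleftrightarrow> (\<exists>t. w = act t z)"
proof
  assume "orbit z = orbit w"
  then have "w \<in> orbit z" using orbit_self by simp
  then show "\<exists>t. w = act t z" by (auto simp: orbit_def)
qed (auto simp: orbit_act)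

lemma mem_orbit_iff: "w \<in> orbit z \<longleftrightarrow> (\<exists>t. w = act t z)"
  by (auto simp: orbit_def)

lemma tangent_orbit_eq: "tangent_orbit z = range (\<lambda>\<theta>. inf_act \<theta> z)"
proof -
  have "((\<lambda>t. act t z) has_derivative (\<lambda>\<theta>. inf_act \<theta> z)) (at 0)"
  proof (rule has_derivative_vec)
    fix k
    have "phase 0 $ k = 0" using phase_scaleR[of 0 0 k] by simp
    then have "((\<lambda>t. cis (phase t $ k) * z $ k) has_derivative
            (\<lambda>\<theta>. (phase \<theta> $ k *\<^sub>R (\<i> * 1)) * z $ k)) (at 0)"
      using has_derivative_mult_left[OF has_derivative_cis[OF
        bounded_linear_imp_has_derivative[OF bounded_linear_phase[of k], of "at 0"]], of "z $ k"]
      by simp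
    then show "((\<lambda>t. act t z $ k) has_derivative (\<lambda>\<theta>. inf_act \<theta> z $ k)) (at 0)"
      by (simp add: act_nth inf_act_def scaleR_conv_of_real ac_simps)
  qed
  from frechet_derivative_at[OF this] show ?thesis
    unfolding tangent_orbit_def by metis
qed

lemma level_W_iff:
  "z \<in> level_W \<longleftrightarrow>
     (cmod (z $ 1))\<^sup>2 + (cmod (z $ 5))\<^sup>2 = 6 \<and>
     (cmod (z $ 2))\<^sup>2 + (cmod (z $ 5))\<^sup>2 + (cmod (z $ 7))\<^sup>2 = 10 \<and>
     (cmod (z $ 3))\<^sup>2 + (cmod (z $ 7))\<^sup>2 = 6 \<and>
     (cmod (z $ 4))\<^sup>2 - (cmod (z $ 5))\<^sup>2 + (cmod (z $ 7))\<^sup>2 = 4 \<and>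
     (cmod (z $ 5))\<^sup>2 - (cmod (z $ 6))\<^sup>2 + (cmod (z $ 7))\<^sup>2 = 2 \<and>
     (cmod (z $ 5))\<^sup>2 - (cmod (z $ 7))\<^sup>2 + (cmod (z $ 8))\<^sup>2 = 4"
  by (simp add: level_W_def constraint_def vec_eq_iff forall_6 vector_6)

lemma constraint_has_derivative:
  "(constraint has_derivative (\<lambda>v. vector
     [2 * (z $ 1 \<bullet> v $ 1) + 2 * (z $ 5 \<bullet> v $ 5),
      2 * (z $ 2 \<bullet> v $ 2) + 2 * (z $ 5 \<bullet> v $ 5) + 2 * (z $ 7 \<bullet> v $ 7),
      2 * (z $ 3 \<bullet> v $ 3) + 2 * (z $ 7 \<bullet> v $ 7),
      2 * (z $ 4 \<bullet> v $ 4) - 2 * (z $ 5 \<bullet> v $ 5) + 2 * (z $ 7 \<bullet> v $ 7),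
      2 * (z $ 5 \<bullet> v $ 5) - 2 * (z $ 6 \<bullet> v $ 6) + 2 * (z $ 7 \<bullet> v $ 7),
      2 * (z $ 5 \<bullet> v $ 5) - 2 * (z $ 7 \<bullet> v $ 7) + 2 * (z $ 8 \<bullet> v $ 8)])) (at z)"
  (is "(_ has_derivative ?D) _")
proof (rule has_derivative_vec)
  have sq: "((\<lambda>z. (cmod (z $ k))\<^sup>2) has_derivative (\<lambda>v. 2 * (z $ k \<bullet> v $ k))) (at z)" for k :: 8
  proof -
    have "((\<lambda>z::complex^8. z $ k \<bullet> z $ k) has_derivative (\<lambda>v. z $ k \<bullet> v $ k + v $ k \<bullet> z $ k)) (at z)"
      by (intro has_derivative_inner bounded_linear_imp_has_derivative bounded_linear_vec_nth)
    then show ?thesis by (simp add: power2_norm_eq_inner inner_commute)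
  qed
  have "\<forall>i. ((\<lambda>z. constraint z $ i) has_derivative (\<lambda>v. ?D v $ i)) (at z)"
    unfolding forall_6 constraint_def vector_6
    by (intro conjI has_derivative_add has_derivative_diff sq)
  then show "((\<lambda>z. constraint z $ i) has_derivative (\<lambda>v. ?D v $ i)) (at z)" for i ..
qed

lemma tangent_W_iff:
  "v \<in> tangent_W z \<longleftrightarrow>
     z $ 1 \<bullet> v $ 1 + z $ 5 \<bullet> v $ 5 = 0 \<and>
     z $ 2 \<bullet> v $ 2 + z $ 5 \<bullet> v $ 5 + z $ 7 \<bullet> v $ 7 = 0 \<and>
     z $ 3 \<bullet> v $ 3 + z $ 7 \<bullet> v $ 7 = 0 \<and>
     z $ 4 \<bullet> v $ 4 - z $ 5 \<bullet> v $ 5 + z $ 7 \<bullet> v $ 7 = 0 \<and>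
     z $ 5 \<bullet> v $ 5 - z $ 6 \<bullet> v $ 6 + z $ 7 \<bullet> v $ 7 = 0 \<and>
     z $ 5 \<bullet> v $ 5 - z $ 7 \<bullet> v $ 7 + z $ 8 \<bullet> v $ 8 = 0"
  unfolding tangent_W_def frechet_derivative_at[OF constraint_has_derivative, symmetric]
  by (simp add: vec_eq_iff forall_6 vector_6) argo


section \<open>Symmetries of the quotient\<close>

text \<open>A linear map of \<open>\<complex>\<^sup>8\<close> that respects every ingredient of the reduction induces a
  symplectomorphism of \<open>M\<close>.  The torus elements themselves are instances; they induce the identity of \<open>M\<close> and
  serve to move representatives within an orbit.\<close>

locale torus_symmetry =
  fixes P :: "complex ^ 8 \<Rightarrow> complex ^ 8"
  assumes linear: "bounded_linear P"
    and inj: "inj P"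
    and level_W_preserved: "P z \<in> level_W \<longleftrightarrow> z \<in> level_W"
    and orbit_image: "orbit (P z) = P ` orbit z"
    and tangent_orbit_image: "tangent_orbit (P z) = P ` tangent_orbit z"
    and tangent_W_image: "tangent_W (P z) = P ` tangent_W z"
    and omega_st_eq: "omega_st (P u) (P v) = omega_st u v"

lemma torus_symmetry_act: "torus_symmetry (act s)"
proof (rule torus_symmetry.intro)
  show "bounded_linear (act s)"
    by (rule linear_conv_bounded_linear[THEN iffD1])
      (auto intro!: linearI simp: vec_eq_iff act_nth algebra_simps)
  show "inj (act s)" by (metis act_inverse(1) injI)
  show "act s z \<in> level_W \<longleftrightarrow> z \<in> level_W" for z
    using act_level_W[of z s] act_level_W[of "act s z" "- s"] by (auto simp: act_inverse)
  show "orbit (act s z) = act s ` orbit z" for z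
  proof -
    have "act t (act s z) = act s (act t z)" for t by (simp flip: act_add add: add.commute)
    then show ?thesis unfolding orbit_def by (auto simp: image_iff)
  qed
  show "tangent_orbit (act s z) = act s ` tangent_orbit z" for z
  proof -
    have "inf_act \<theta> (act s z) = act s (inf_act \<theta> z)" for \<theta>
      by (simp add: vec_eq_iff act_nth inf_act_def)
    then show ?thesis unfolding tangent_orbit_eq by (auto simp: image_iff)
  qed
  show "tangent_W (act s z) = act s ` tangent_W z" for z
  proof -
    have rot: "(cis a * x) \<bullet> (cis a * y) = x \<bullet> y" for a :: real and x y :: complex
    proof -
      have "(cis a * x) \<bullet> (cis a * y) = Re (cis a * cnj (cis a) * (x * cnj y))"
        unfolding inner_complex_def by (simp add: algebra_simps)
      also have "cis a * cnj (cis a) = 1" by (simp add: cis_cnj cis_mult)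
      finally show ?thesis by (simp add: inner_complex_def)
    qed
    have "act s v \<in> tangent_W (act s z) \<longleftrightarrow> v \<in> tangent_W z" for v
      unfolding tangent_W_iff act_nth rot ..
    then show ?thesis by (metis (no_types, opaque_lifting) act_inverse(2) image_iff subsetI set_eq_iff)
  qed
  show "omega_st (act s u) (act s v) = omega_st u v" for u v
  proof -
    have rot: "cis a * x * cnj (cis a * y) = x * cnj y" for a :: real and x y :: complex
    proof -
      have "cis a * x * cnj (cis a * y) = (cis a * cnj (cis a)) * (x * cnj y)"
        by (simp add: algebra_simps)
      also have "cis a * cnj (cis a) = 1" by (simp add: cis_cnj cis_mult)
      finally show ?thesis by simp
    qed
    show ?thesis unfolding omega_st_def act_nth rot ..
  qed
qed

definition permute :: "(8 \<Rightarrow> 8) \<Rightarrow> complex ^ 8 \<Rightarrow> complex ^ 8" where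
  "permute \<pi> z = (\<chi> k. z $ \<pi> k)"

text \<open>A permutation of the coordinates respects the \<open>N\<close>-orbits if it can be absorbed into a
  reparametrisation \<open>\<rho>\<close> of the torus.\<close>

lemma torus_symmetry_permute:
  assumes inv: "\<And>k. \<pi> (\<pi> k) = k"
    and phase: "\<And>t k. phase (\<rho> t) $ k = phase t $ \<pi> k"
    and level: "\<And>z. z \<in> level_W \<Longrightarrow> permute \<pi> z \<in> level_W"
    and tangent: "\<And>z v. v \<in> tangent_W z \<Longrightarrow> permute \<pi> v \<in> tangent_W (permute \<pi> z)"
  shows "torus_symmetry (permute \<pi>)"
proof (rule torus_symmetry.intro)
  have invol: "permute \<pi> (permute \<pi> z) = z" for z by (simp add: permute_def vec_eq_iff inv)
  have phase_eqD: "s = t" if "\<And>k. phase s $ k = phase t $ k" for s t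
    \<comment> \<open>these six coordinates carry the weights \<open>t\<^sub>1, \<dots>, t\<^sub>6\<close>\<close>
    using that[of 1] that[of 2] that[of 3] that[of 4] that[of 6] that[of 8]
    unfolding vec_eq_iff forall_6 by (simp add: phase_nth)
  have surj: "\<exists>s. t = \<rho> s" for t
    by (rule exI[of _ "\<rho> t"], rule phase_eqD) (simp add: phase inv)
  show "bounded_linear (permute \<pi>)"
    by (rule linear_conv_bounded_linear[THEN iffD1])
      (auto intro!: linearI simp: vec_eq_iff permute_def)
  show "inj (permute \<pi>)" by (metis invol injI)
  show "permute \<pi> z \<in> level_W \<longleftrightarrow> z \<in> level_W" for z
    using level[of z] level[of "permute \<pi> z"] by (auto simp: invol)
  show "orbit (permute \<pi> z) = permute \<pi> ` orbit z" for z
  proof -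
    have *: "permute \<pi> (act t z) = act (\<rho> t) (permute \<pi> z)" for t
      by (simp add: vec_eq_iff permute_def act_nth phase)
    have "w \<in> orbit (permute \<pi> z) \<longleftrightarrow> w \<in> permute \<pi> ` orbit z" for w
      unfolding mem_orbit_iff image_iff Bex_def by (metis * surj)
    then show ?thesis by blast
  qed
  show "tangent_orbit (permute \<pi> z) = permute \<pi> ` tangent_orbit z" for z
  proof -
    have *: "permute \<pi> (inf_act t z) = inf_act (\<rho> t) (permute \<pi> z)" for t
      by (simp add: vec_eq_iff permute_def inf_act_def phase)
    have "w \<in> tangent_orbit (permute \<pi> z) \<longleftrightarrow> w \<in> permute \<pi> ` tangent_orbit z" for w
      unfolding tangent_orbit_eq image_iff Bex_def by (metis * surj UNIV_I)
    then show ?thesis by blast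
  qed
  show "tangent_W (permute \<pi> z) = permute \<pi> ` tangent_W z" for z
  proof (intro subset_antisym subsetI)
    fix v assume "v \<in> tangent_W (permute \<pi> z)"
    then have "permute \<pi> v \<in> tangent_W z" using tangent[of v "permute \<pi> z"] by (simp add: invol)
    then show "v \<in> permute \<pi> ` tangent_W z" by (metis image_eqI invol)
  qed (use tangent in blast)
  show "omega_st (permute \<pi> u) (permute \<pi> v) = omega_st u v" for u v
  proof -
    have "bij \<pi>" by (rule o_bij[where g = \<pi>]) (auto simp: inv)
    from sum.reindex_bij_betw[OF this, of "\<lambda>k. u $ k * cnj (v $ k) - v $ k * cnj (u $ k)"]
    show ?thesis by (simp add: omega_st_def permute_def)
  qed
qed

text \<open>The momentum polygon of \<open>M\<close> is an octagon that is symmetric under reflections in the lines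
  \<open>H = 3/2\<close> and \<open>J = 3/2\<close>; the following permutations realise these two reflections.\<close>

definition flip_H :: "complex ^ 8 \<Rightarrow> complex ^ 8" where
  "flip_H = permute ((\<lambda>k. k)(2 := 8, 8 := 2, 3 := 7, 7 := 3, 4 := 6, 6 := 4))"

definition flip_J :: "complex ^ 8 \<Rightarrow> complex ^ 8" where
  "flip_J = permute ((\<lambda>k. k)(1 := 5, 5 := 1, 2 := 4, 4 := 2, 6 := 8, 8 := 6))"

lemma flip_H_nth:
  "flip_H z $ 1 = z $ 1" "flip_H z $ 2 = z $ 8" "flip_H z $ 3 = z $ 7" "flip_H z $ 4 = z $ 6"
  "flip_H z $ 5 = z $ 5" "flip_H z $ 6 = z $ 4" "flip_H z $ 7 = z $ 3" "flip_H z $ 8 = z $ 2"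
  by (simp_all add: flip_H_def permute_def)

lemma flip_J_nth:
  "flip_J z $ 1 = z $ 5" "flip_J z $ 2 = z $ 4" "flip_J z $ 3 = z $ 3" "flip_J z $ 4 = z $ 2"
  "flip_J z $ 5 = z $ 1" "flip_J z $ 6 = z $ 8" "flip_J z $ 7 = z $ 7" "flip_J z $ 8 = z $ 6"
  by (simp_all add: flip_J_def permute_def)

lemma flip_H_flip_H: "flip_H (flip_H z) = z"
  by (simp add: vec_eq_iff forall_8 flip_H_nth)

interpretation flip_H: torus_symmetry flip_H
  unfolding flip_H_def
proof (rule torus_symmetry_permute[where
      \<rho> = "\<lambda>t. vector [t $ 1, t $ 6, t $ 2 + t $ 3 + t $ 4 - t $ 5 - t $ 6, t $ 5, t $ 4, t $ 2]"];
    (unfold flip_H_def[symmetric])?)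
  fix k :: 8
  have "\<forall>k. ((\<lambda>k. k)(2 := 8, 8 := 2, 3 := 7, 7 := 3, 4 := 6, 6 := 4 :: 8))
          (((\<lambda>k. k)(2 := 8, 8 := 2, 3 := 7, 7 := 3, 4 := 6, 6 := 4)) k) = k"
    unfolding forall_8 by simp
  then show "((\<lambda>k. k)(2 := 8, 8 := 2, 3 := 7, 7 := 3, 4 := 6, 6 := 4 :: 8))
          (((\<lambda>k. k)(2 := 8, 8 := 2, 3 := 7, 7 := 3, 4 := 6, 6 := 4)) k) = k" ..
next
  fix t k
  have "\<forall>k. phase (vector [t $ 1, t $ 6, t $ 2 + t $ 3 + t $ 4 - t $ 5 - t $ 6, t $ 5, t $ 4, t $ 2]) $ k =
    phase t $ ((\<lambda>k. k)(2 := 8, 8 := 2, 3 := 7, 7 := 3, 4 := 6, 6 := 4)) k"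
    unfolding forall_8 by (simp add: phase_nth vector_6)
  then show "phase (vector [t $ 1, t $ 6, t $ 2 + t $ 3 + t $ 4 - t $ 5 - t $ 6, t $ 5, t $ 4, t $ 2]) $ k =
    phase t $ ((\<lambda>k. k)(2 := 8, 8 := 2, 3 := 7, 7 := 3, 4 := 6, 6 := 4)) k" ..
qed (simp_all add: level_W_iff tangent_W_iff flip_H_nth)

interpretation flip_J: torus_symmetry flip_J
  unfolding flip_J_def
proof (rule torus_symmetry_permute[where
      \<rho> = "\<lambda>t. vector [t $ 1 + t $ 2 - t $ 4 - t $ 5 + t $ 6, t $ 4, t $ 3, t $ 2, t $ 6, t $ 5]"];
    (unfold flip_J_def[symmetric])?)
  fix k :: 8
  have "\<forall>k. ((\<lambda>k. k)(1 := 5, 5 := 1, 2 := 4, 4 := 2, 6 := 8, 8 := 6 :: 8))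
          (((\<lambda>k. k)(1 := 5, 5 := 1, 2 := 4, 4 := 2, 6 := 8, 8 := 6)) k) = k"
    unfolding forall_8 by simp
  then show "((\<lambda>k. k)(1 := 5, 5 := 1, 2 := 4, 4 := 2, 6 := 8, 8 := 6 :: 8))
          (((\<lambda>k. k)(1 := 5, 5 := 1, 2 := 4, 4 := 2, 6 := 8, 8 := 6)) k) = k" ..
next
  fix t k
  have "\<forall>k. phase (vector [t $ 1 + t $ 2 - t $ 4 - t $ 5 + t $ 6, t $ 4, t $ 3, t $ 2, t $ 6, t $ 5]) $ k =
    phase t $ ((\<lambda>k. k)(1 := 5, 5 := 1, 2 := 4, 4 := 2, 6 := 8, 8 := 6)) k"
    unfolding forall_8 by (simp add: phase_nth vector_6)
  then show "phase (vector [t $ 1 + t $ 2 - t $ 4 - t $ 5 + t $ 6, t $ 4, t $ 3, t $ 2, t $ 6, t $ 5]) $ k =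
    phase t $ ((\<lambda>k. k)(1 := 5, 5 := 1, 2 := 4, 4 := 2, 6 := 8, 8 := 6)) k" ..
qed (simp_all add: level_W_iff tangent_W_iff flip_J_nth)

section \<open>A slice for the torus action near \<open>A\<close>\<close>

text \<open>On \<open>W\<close> the moduli of \<open>z\<^sub>7\<close> and \<open>z\<^sub>8\<close> determine those of the other six coordinates, and the
  six-dimensional torus can rotate these six to be positive as long as they do not vanish.\<close>

definition slice :: "complex \<Rightarrow> complex \<Rightarrow> complex ^ 8" where
  "slice p q = vector
     [complex_of_real (sqrt (2 - (cmod p)\<^sup>2 + (cmod q)\<^sup>2)),
      complex_of_real (sqrt (6 - 2 * (cmod p)\<^sup>2 + (cmod q)\<^sup>2)),
      complex_of_real (sqrt (6 - (cmod p)\<^sup>2)),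
      complex_of_real (sqrt (8 - (cmod q)\<^sup>2)),
      complex_of_real (sqrt (4 + (cmod p)\<^sup>2 - (cmod q)\<^sup>2)),
      complex_of_real (sqrt (2 + 2 * (cmod p)\<^sup>2 - (cmod q)\<^sup>2)), p, q]"

definition slice_dom :: "(complex \<times> complex) set" where
  "slice_dom = {(p, q). 0 < 2 - (cmod p)\<^sup>2 + (cmod q)\<^sup>2 \<and> 0 < 6 - 2 * (cmod p)\<^sup>2 + (cmod q)\<^sup>2 \<and>
     0 < 6 - (cmod p)\<^sup>2 \<and> 0 < 8 - (cmod q)\<^sup>2 \<and> 0 < 4 + (cmod p)\<^sup>2 - (cmod q)\<^sup>2 \<and>
     0 < 2 + 2 * (cmod p)\<^sup>2 - (cmod q)\<^sup>2}"

lemma slice_nth: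
  "slice p q $ 1 = complex_of_real (sqrt (2 - (cmod p)\<^sup>2 + (cmod q)\<^sup>2))"
  "slice p q $ 2 = complex_of_real (sqrt (6 - 2 * (cmod p)\<^sup>2 + (cmod q)\<^sup>2))"
  "slice p q $ 3 = complex_of_real (sqrt (6 - (cmod p)\<^sup>2))"
  "slice p q $ 4 = complex_of_real (sqrt (8 - (cmod q)\<^sup>2))"
  "slice p q $ 5 = complex_of_real (sqrt (4 + (cmod p)\<^sup>2 - (cmod q)\<^sup>2))"
  "slice p q $ 6 = complex_of_real (sqrt (2 + 2 * (cmod p)\<^sup>2 - (cmod q)\<^sup>2))"
  "slice p q $ 7 = p" "slice p q $ 8 = q"
  unfolding slice_def vector_8 by (rule refl)+

lemma open_slice_dom: "open slice_dom"
  unfolding slice_dom_def case_prod_unfold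
  by (intro open_Collect_conj open_Collect_less continuous_intros)

lemma open_slice_dom_preimage:
  assumes "open U" "continuous_on U p" "continuous_on U q"
  shows "open {x \<in> U. (p x, q x) \<in> slice_dom}"
proof -
  have "open (U \<inter> (\<lambda>x. (p x, q x)) -` slice_dom)"
    by (intro continuous_open_preimage open_slice_dom assms continuous_intros)
  then show ?thesis by (simp add: vimage_def Int_def)
qed

lemma slice_level_W: "(p, q) \<in> slice_dom \<Longrightarrow> slice p q \<in> level_W"
  by (simp add: level_W_iff slice_nth slice_dom_def)

lemma Ck_on_cmod_square:
  assumes "open U" "Ck_on k p U"
  shows "Ck_on k (\<lambda>x. (cmod (p x))\<^sup>2) U"
  using Ck_on_bilinear[OF assms(1) bounded_bilinear_inner assms(2,2)]
  by (simp add: power2_norm_eq_inner)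

lemma Ck_on_slice:
  fixes p q :: "'a::euclidean_space \<Rightarrow> complex"
  assumes "open U" "Ck_on k p U" "Ck_on k q U" "\<And>x. x \<in> U \<Longrightarrow> (p x, q x) \<in> slice_dom"
  shows "Ck_on k (\<lambda>x. slice (p x) (q x)) U"
proof -
  note sq = Ck_on_cmod_square[OF assms(1,2)] Ck_on_cmod_square[OF assms(1,3)]
  have affine: "Ck_on k (\<lambda>x. c + a * (cmod (p x))\<^sup>2 + b * (cmod (q x))\<^sup>2) U" for a b c :: real
    by (intro Ck_on_add Ck_on_mult Ck_on_const sq assms(1))
  have root: "Ck_on k (\<lambda>x. complex_of_real (sqrt (g x))) U"
    if "\<And>x. g x = c + a * (cmod (p x))\<^sup>2 + b * (cmod (q x))\<^sup>2" "\<And>x. x \<in> U \<Longrightarrow> 0 < g x"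
    for g and a b c :: real
    by (rule Ck_on_bounded_linear[OF assms(1) bounded_linear_of_real], rule Ck_on_sqrt)
      (use affine[of c a b] that assms(1) in auto)
  note dom = assms(4)[unfolded slice_dom_def]
  show ?thesis
  proof (rule Ck_on_vec[OF assms(1)])
    have "\<forall>i. Ck_on k (\<lambda>x. slice (p x) (q x) $ i) U"
      unfolding forall_8 slice_nth
      using root[where c = 2 and a = "- 1" and b = 1 and g = "\<lambda>x. 2 - (cmod (p x))\<^sup>2 + (cmod (q x))\<^sup>2"]
        root[where c = 6 and a = "- 2" and b = 1 and g = "\<lambda>x. 6 - 2 * (cmod (p x))\<^sup>2 + (cmod (q x))\<^sup>2"]
        root[where c = 6 and a = "- 1" and b = 0 and g = "\<lambda>x. 6 - (cmod (p x))\<^sup>2"]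
        root[where c = 8 and a = 0 and b = "- 1" and g = "\<lambda>x. 8 - (cmod (q x))\<^sup>2"]
        root[where c = 4 and a = 1 and b = "- 1" and g = "\<lambda>x. 4 + (cmod (p x))\<^sup>2 - (cmod (q x))\<^sup>2"]
        root[where c = 2 and a = 2 and b = "- 1" and g = "\<lambda>x. 2 + 2 * (cmod (p x))\<^sup>2 - (cmod (q x))\<^sup>2"]
        assms(2,3) dom
      by simp
    then show "Ck_on k (\<lambda>x. slice (p x) (q x) $ i) U" for i ..
  qed
qed

text \<open>The phases of the first six coordinates determine the element of the torus.  So the identity is the only
  group element that maps one point of the slice to another.\<close>

lemma slice_orbit_inj:
  assumes "(p, q) \<in> slice_dom" "(p', q') \<in> slice_dom" "orbit (slice p q) = orbit (slice p' q')"
  shows "p = p' \<and> q = q'"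
proof -
  obtain t where t: "slice p' q' = act t (slice p q)"
    using assms(3) orbit_eq_iff by blast
  have one: "cis a = 1" if "complex_of_real y = cis a * complex_of_real x" "0 < x" "0 < y" for a x y
  proof -
    have "cmod (complex_of_real y) = cmod (cis a * complex_of_real x)" using that(1) by simp
    then have "y = x" using that(2,3) by (simp add: norm_mult)
    then show ?thesis using that by simp
  qed
  have comp: "slice p' q' $ k = cis (phase t $ k) * slice p q $ k" for k
    unfolding t by (rule act_nth)
  have "cis (phase t $ 1) = 1" "cis (phase t $ 2) = 1" "cis (phase t $ 3) = 1"
    "cis (phase t $ 4) = 1" "cis (phase t $ 5) = 1" "cis (phase t $ 6) = 1"
    using comp[of 1, unfolded slice_nth, THEN one] comp[of 2, unfolded slice_nth, THEN one]
      comp[of 3, unfolded slice_nth, THEN one] comp[of 4, unfolded slice_nth, THEN one]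
      comp[of 5, unfolded slice_nth, THEN one] comp[of 6, unfolded slice_nth, THEN one]
      assms(1,2) by (simp_all add: slice_dom_def)
  note c = this[unfolded phase_nth]
  have "cis (t $ 1 + t $ 2 - t $ 4 - t $ 5 + t $ 6) =
      cis (t $ 1) * cis (t $ 2) / cis (t $ 4) / cis (t $ 5) * cis (t $ 6)"
    by (simp add: cis_mult cis_divide)
  then have c6: "cis (t $ 6) = 1" using c by simp
  have "cis (t $ 2 + t $ 3 + t $ 4 - t $ 5 - t $ 6) =
      cis (t $ 2) * cis (t $ 3) * cis (t $ 4) / cis (t $ 5) / cis (t $ 6)"
    by (simp add: cis_mult cis_divide)
  then have c7: "cis (t $ 2 + t $ 3 + t $ 4 - t $ 5 - t $ 6) = 1" using c c6 by simp
  show ?thesis using comp[of 7] comp[of 8] c6 c7 by (simp add: slice_nth phase_nth)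
qed

text \<open>Transversality of the slice to the orbits: its tangent vectors have six real components, whereas an
  infinitesimal rotation multiplies positive numbers by imaginary ones.\<close>

lemma slice_tangent_orbit:
  assumes "(p, q) \<in> slice_dom" "w \<in> tangent_orbit (slice p q)"
    and "\<And>k. k \<in> {1, 2, 3, 4, 5, 6} \<Longrightarrow> Im (w $ k) = 0"
  shows "w = 0"
proof -
  obtain \<theta> where w: "w = inf_act \<theta> (slice p q)"
    using assms(2) unfolding tangent_orbit_eq by blast
  have "phase \<theta> $ 1 = 0" "phase \<theta> $ 2 = 0" "phase \<theta> $ 3 = 0"
    "phase \<theta> $ 4 = 0" "phase \<theta> $ 5 = 0" "phase \<theta> $ 6 = 0"
    using assms(3)[of 1] assms(3)[of 2] assms(3)[of 3] assms(3)[of 4] assms(3)[of 5] assms(3)[of 6] assms(1)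
    by (simp_all add: w inf_act_def slice_nth slice_dom_def)
  then have "\<forall>k. phase \<theta> $ k = 0" unfolding forall_8 by (simp add: phase_nth)
  then show ?thesis by (simp add: w inf_act_def vec_eq_iff)
qed

lemma slice_immersive:
  assumes p: "(p has_derivative p') (at x)" and q: "(q has_derivative q') (at x)"
    and dom: "(p x, q x) \<in> slice_dom"
    and \<sigma>: "((\<lambda>x. slice (p x) (q x)) has_derivative \<sigma>') (at x)"
    and v: "\<sigma>' v \<in> tangent_orbit (slice (p x) (q x))"
  shows "p' v = 0 \<and> q' v = 0"
proof -
  have "\<sigma>' v = 0"
  proof (rule slice_tangent_orbit[OF dom v])
    fix k :: 8 assume "k \<in> {1, 2, 3, 4, 5, 6}"
    then have "Im (slice (p x) (q x) $ k) = 0" for x by (auto simp: slice_nth)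
    moreover have "((\<lambda>x. Im (slice (p x) (q x) $ k)) has_derivative (\<lambda>v. Im (\<sigma>' v $ k))) (at x)"
      by (intro bounded_linear.has_derivative[OF bounded_linear_Im]
          bounded_linear.has_derivative[OF bounded_linear_vec_nth] \<sigma>)
    ultimately have "(\<lambda>v. Im (\<sigma>' v $ k)) = (\<lambda>v. 0)"
      using has_derivative_unique[OF _ has_derivative_const[of 0]] by simp
    then show "Im (\<sigma>' v $ k) = 0" by metis
  qed
  moreover have "(p has_derivative (\<lambda>v. \<sigma>' v $ 7)) (at x)" "(q has_derivative (\<lambda>v. \<sigma>' v $ 8)) (at x)"
    using bounded_linear.has_derivative[OF bounded_linear_vec_nth \<sigma>, of 7]
      bounded_linear.has_derivative[OF bounded_linear_vec_nth \<sigma>, of 8] by (simp_all add: slice_nth)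
  ultimately show ?thesis
    using has_derivative_unique[OF p] has_derivative_unique[OF q] by fastforce
qed

text \<open>At the centre of the slice the radicands are stationary, so only the last two components
  contribute to the derivative.\<close>

lemma slice_has_derivative_centre:
  assumes p: "(p has_derivative p') (at x)" and q: "(q has_derivative q') (at x)"
    and zero: "p x = 0" "q x = 0"
  shows "((\<lambda>x. slice (p x) (q x)) has_derivative
    (\<lambda>v. vector [0, 0, 0, 0, 0, 0, p' v, q' v])) (at x)"
proof (rule has_derivative_vec)
  have sq: "((\<lambda>x. (cmod (f x))\<^sup>2) has_derivative (\<lambda>v. 0)) (at x)"
    if "(f has_derivative f') (at x)" "f x = 0" for f f'
    using has_derivative_inner[OF that(1,1)] that(2) by (simp add: power2_norm_eq_inner)
  have root: "((\<lambda>x. complex_of_real (sqrt (g x))) has_derivative (\<lambda>v. 0)) (at x)"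
    if "\<And>x. g x = c + a * (cmod (p x))\<^sup>2 + b * (cmod (q x))\<^sup>2" "0 < c" for g and a b c :: real
  proof -
    have g: "(g has_derivative (\<lambda>v. 0 + a * 0 + b * 0)) (at x)"
      unfolding that(1)[abs_def]
      by (intro has_derivative_add has_derivative_mult_right has_derivative_const sq[OF p] sq[OF q] zero)
    have "0 < g x" using that zero by simp
    from has_derivative_of_real[OF has_derivative_real_sqrt[OF this g]] show ?thesis by simp
  qed
  have "\<forall>i. ((\<lambda>x. slice (p x) (q x) $ i) has_derivative
      (\<lambda>v. vector [0, 0, 0, 0, 0, 0, p' v, q' v] $ i)) (at x)"
    unfolding forall_8 slice_nth vector_8
    using root[where c = 2 and a = "- 1" and b = 1 and g = "\<lambda>x. 2 - (cmod (p x))\<^sup>2 + (cmod (q x))\<^sup>2"]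
      root[where c = 6 and a = "- 2" and b = 1 and g = "\<lambda>x. 6 - 2 * (cmod (p x))\<^sup>2 + (cmod (q x))\<^sup>2"]
      root[where c = 6 and a = "- 1" and b = 0 and g = "\<lambda>x. 6 - (cmod (p x))\<^sup>2"]
      root[where c = 8 and a = 0 and b = "- 1" and g = "\<lambda>x. 8 - (cmod (q x))\<^sup>2"]
      root[where c = 4 and a = 1 and b = "- 1" and g = "\<lambda>x. 4 + (cmod (p x))\<^sup>2 - (cmod (q x))\<^sup>2"]
      root[where c = 2 and a = 2 and b = "- 1" and g = "\<lambda>x. 2 + 2 * (cmod (p x))\<^sup>2 - (cmod (q x))\<^sup>2"] p q
    by simp
  then show "((\<lambda>x. slice (p x) (q x) $ i) has_derivative
      (\<lambda>v. vector [0, 0, 0, 0, 0, 0, p' v, q' v] $ i)) (at x)" for i ..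
qed

text \<open>Five of the angles rotate \<open>z\<^sub>1\<close>, \<open>z\<^sub>2\<close>, \<open>z\<^sub>3\<close>, \<open>z\<^sub>4\<close>, \<open>z\<^sub>6\<close> to positive numbers; the sixth one enters the
  weight of \<open>z\<^sub>5\<close> and is adjusted last.\<close>

lemma slice_reaches:
  assumes z: "z \<in> level_W" and nz: "\<And>k. k \<in> {1, 2, 3, 4, 5, 6} \<Longrightarrow> z $ k \<noteq> 0"
  obtains p q where "(p, q) \<in> slice_dom" "orbit z = orbit (slice p q)"
    "cmod p = cmod (z $ 7)" "cmod q = cmod (z $ 8)"
proof -
  define t :: "real ^ 6" where "t = vector [- Arg (z $ 1), - Arg (z $ 2), - Arg (z $ 3), - Arg (z $ 4),
    - Arg (z $ 6), - Arg (z $ 5) + Arg (z $ 1) + Arg (z $ 2) - Arg (z $ 4) - Arg (z $ 6)]"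
  define w where "w = act t z"
  have ph: "phase t $ 1 = - Arg (z $ 1)" "phase t $ 2 = - Arg (z $ 2)" "phase t $ 3 = - Arg (z $ 3)"
    "phase t $ 4 = - Arg (z $ 4)" "phase t $ 5 = - Arg (z $ 5)" "phase t $ 6 = - Arg (z $ 6)"
    by (simp_all add: phase_nth t_def vector_6)
  have norm_w: "cmod (w $ k) = cmod (z $ k)" for k by (simp add: w_def act_nth norm_mult)
  have pos: "w $ k = complex_of_real (sqrt ((cmod (z $ k))\<^sup>2))" if "k \<in> {1, 2, 3, 4, 5, 6}" for k
  proof -
    have "z $ k = complex_of_real (cmod (z $ k)) * cis (Arg (z $ k))"
      using nz[OF that] by (simp add: cis_Arg complex_sgn_def scaleR_conv_of_real)
    moreover have "phase t $ k = - Arg (z $ k)" using that ph by auto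
    ultimately have "w $ k = cis (- Arg (z $ k)) * (complex_of_real (cmod (z $ k)) * cis (Arg (z $ k)))"
      unfolding w_def act_nth by simp
    also have "\<dots> = complex_of_real (cmod (z $ k)) * (cis (- Arg (z $ k)) * cis (Arg (z $ k)))"
      by (simp add: ac_simps)
    finally show ?thesis by (simp add: cis_mult)
  qed
  have sq: "(cmod (z $ 1))\<^sup>2 = 2 - (cmod (z $ 7))\<^sup>2 + (cmod (z $ 8))\<^sup>2"
    "(cmod (z $ 2))\<^sup>2 = 6 - 2 * (cmod (z $ 7))\<^sup>2 + (cmod (z $ 8))\<^sup>2"
    "(cmod (z $ 3))\<^sup>2 = 6 - (cmod (z $ 7))\<^sup>2"
    "(cmod (z $ 4))\<^sup>2 = 8 - (cmod (z $ 8))\<^sup>2"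
    "(cmod (z $ 5))\<^sup>2 = 4 + (cmod (z $ 7))\<^sup>2 - (cmod (z $ 8))\<^sup>2"
    "(cmod (z $ 6))\<^sup>2 = 2 + 2 * (cmod (z $ 7))\<^sup>2 - (cmod (z $ 8))\<^sup>2"
    using z unfolding level_W_iff by linarith+
  have "w = slice (w $ 7) (w $ 8)"
    unfolding vec_eq_iff forall_8 slice_nth norm_w sq[symmetric] using pos by simp
  moreover have "(w $ 7, w $ 8) \<in> slice_dom"
    unfolding slice_dom_def mem_Collect_eq case_prod_conv norm_w sq[symmetric] using nz by simp
  ultimately show ?thesis using that[of "w $ 7" "w $ 8"] norm_w orbit_act[of t z] by (simp add: w_def)
qed

section \<open>A criterion for focus-focus points\<close>

text \<open>The matrix of \<open>\<omega>\<^sub>s\<^sub>t\<close> on \<open>\<complex>\<^sup>2\<close> in the real coordinates of \<open>p = x\<^sub>1 + i x\<^sub>2\<close> and \<open>q = x\<^sub>3 + i x\<^sub>4\<close>.\<close>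

definition Omega4 :: "real ^ 4 ^ 4" where
  "Omega4 = vector [vector [0, - 1, 0, 0], vector [1, 0, 0, 0], vector [0, 0, 0, - 1], vector [0, 0, 1, 0]]"

text \<open>The symmetric matrices of the quadratic forms \<open>(\<bar>q\<bar>\<^sup>2 - \<bar>p\<bar>\<^sup>2) / 2\<close> and \<open>Re (p q)\<close>.\<close>

definition elliptic4 :: "real ^ 4 ^ 4" where
  "elliptic4 = vector [vector [- 1 / 2, 0, 0, 0], vector [0, - 1 / 2, 0, 0],
     vector [0, 0, 1 / 2, 0], vector [0, 0, 0, 1 / 2]]"

definition hyperbolic4 :: "real ^ 4 ^ 4" where
  "hyperbolic4 = vector [vector [0, 0, 1 / 2, 0], vector [0, 0, 0, - 1 / 2],
     vector [1 / 2, 0, 0, 0], vector [0, - 1 / 2, 0, 0]]"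

lemma vector_4:
  "(vector [a, b, c, d] :: ('a::zero) ^ 4) $ 1 = a"
  "(vector [a, b, c, d] :: ('a::zero) ^ 4) $ 2 = b"
  "(vector [a, b, c, d] :: ('a::zero) ^ 4) $ 3 = c"
  "(vector [a, b, c, d] :: ('a::zero) ^ 4) $ 4 = d"
  unfolding vector_def by simp_all

lemma matrix_inv_eqI:
  fixes A B :: "real ^ 'n ^ 'n"
  assumes "A ** B = mat 1"
  shows "matrix_inv A = B"
proof -
  have BA: "B ** A = mat 1" using assms matrix_left_right_inverse by blast
  have "A ** matrix_inv A = mat 1 \<and> matrix_inv A ** A = mat 1"
    unfolding matrix_inv_def by (rule someI[of _ B]) (simp add: assms BA)
  then have "matrix_inv A = (B ** A) ** matrix_inv A \<and> A ** matrix_inv A = mat 1"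
    by (simp add: BA)
  then show ?thesis by (metis matrix_mul_assoc matrix_mul_rid)
qed

lemma matrix_inv_Omega4: "matrix_inv Omega4 = - Omega4"
  by (rule matrix_inv_eqI)
    (simp add: Omega4_def matrix_matrix_mult_def mat_def vec_eq_iff forall_4 sum_4 vector_4)

text \<open>Up to factors \<open>\<plusminus> 2\<close>, the square of this matrix exchanges the first coordinate with the third and the second
  with the fourth, and its fourth power is \<open>- 4\<close>.  So every eigenvalue is a fourth root of
  \<open>- 4\<close>, and conversely each such root has an explicit eigenvector.\<close>

lemma eigenvalues_linearisation4:
  "eigenvalues_of (matrix_inv Omega4 ** (2 *\<^sub>R elliptic4) + matrix_inv Omega4 ** (2 *\<^sub>R hyperbolic4)) =
     {Complex 1 1, Complex 1 (- 1), Complex (- 1) 1, Complex (- 1) (- 1)}"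
  (is "eigenvalues_of ?L = ?R")
proof -
  have L: "(map_matrix complex_of_real ?L *v v = \<mu> *s v) \<longleftrightarrow>
      - v $ 2 - v $ 4 = \<mu> * v $ 1 \<and> v $ 1 - v $ 3 = \<mu> * v $ 2 \<and>
      - v $ 2 + v $ 4 = \<mu> * v $ 3 \<and> - v $ 1 - v $ 3 = \<mu> * v $ 4" for \<mu> v
    unfolding matrix_inv_Omega4
    by (simp add: vec_eq_iff forall_4 map_matrix_def matrix_vector_mult_def matrix_matrix_mult_def
        sum_4 Omega4_def elliptic4_def hyperbolic4_def vector_4)
  have R: "\<mu> \<in> ?R \<longleftrightarrow> \<mu> ^ 4 = - 4" for \<mu>
  proof -
    have "\<mu> ^ 4 + 4 = (\<mu> - Complex 1 1) * (\<mu> - Complex 1 (- 1)) *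
        ((\<mu> - Complex (- 1) 1) * (\<mu> - Complex (- 1) (- 1)))"
      by (simp add: complex_eq_iff power4_eq_xxxx algebra_simps)
    then have "\<mu> ^ 4 + 4 = 0 \<longleftrightarrow> \<mu> \<in> ?R" by auto
    then show ?thesis by (simp add: eq_neg_iff_add_eq_0)
  qed
  have "(\<exists>v. v \<noteq> 0 \<and> map_matrix complex_of_real ?L *v v = \<mu> *s v) \<longleftrightarrow> \<mu> ^ 4 = - 4" for \<mu>
  proof
    assume "\<exists>v. v \<noteq> 0 \<and> map_matrix complex_of_real ?L *v v = \<mu> *s v"
    then obtain v where v0: "v \<noteq> 0" and eq: "map_matrix complex_of_real ?L *v v = \<mu> *s v"
      by blast
    have v: "- v $ 2 - v $ 4 = \<mu> * v $ 1" "v $ 1 - v $ 3 = \<mu> * v $ 2"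
      "- v $ 2 + v $ 4 = \<mu> * v $ 3" "- v $ 1 - v $ 3 = \<mu> * v $ 4"
      using eq unfolding L by blast+
    have sq: "\<mu> * (\<mu> * v $ 1) = 2 * v $ 3" "\<mu> * (\<mu> * v $ 3) = - 2 * v $ 1"
      "\<mu> * (\<mu> * v $ 2) = - 2 * v $ 4" "\<mu> * (\<mu> * v $ 4) = 2 * v $ 2"
      using v by algebra+
    have "\<mu> ^ 4 * v $ 1 = - 4 * v $ 1" "\<mu> ^ 4 * v $ 2 = - 4 * v $ 2"
      "\<mu> ^ 4 * v $ 3 = - 4 * v $ 3" "\<mu> ^ 4 * v $ 4 = - 4 * v $ 4"
      using sq by algebra+
    moreover have "v $ 1 \<noteq> 0 \<or> v $ 2 \<noteq> 0 \<or> v $ 3 \<noteq> 0 \<or> v $ 4 \<noteq> 0"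
      using v0 by (auto simp: vec_eq_iff forall_4)
    ultimately show "\<mu> ^ 4 = - 4" by (metis mult_right_cancel)
  next
    assume mu: "\<mu> ^ 4 = - 4"
    then have nz: "\<mu> \<noteq> 0" by auto
    \<comment> \<open>the solution of the first, second and fourth equation, normalised by \<open>v\<^sub>1 = 2 \<mu>\<close>\<close>
    define v :: "complex ^ 4" where
      "v = vector [2 * \<mu>, 2 - \<mu>\<^sup>2, \<mu> ^ 3, - 2 - \<mu>\<^sup>2]"
    have "v \<noteq> 0" using nz by (auto simp: vec_eq_iff forall_4 v_def vector_4)
    moreover have "map_matrix complex_of_real ?L *v v = \<mu> *s v"
      unfolding L using mu by (simp add: v_def vector_4 algebra_simps power2_eq_square
          power3_eq_cube power4_eq_xxxx)
    ultimately show "\<exists>v. v \<noteq> 0 \<and> map_matrix complex_of_real ?L *v v = \<mu> *s v" by blast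
  qed
  then show ?thesis unfolding eigenvalues_of_def using R by blast
qed

text \<open>A quadratic form and its first derivatives vanish at the origin, so a smooth factor \<open>h\<close> enters the
  second derivatives of the product there only through its value \<open>h 0\<close>.\<close>

lemma hessian_quadratic:
  fixes M :: "real ^ 4 ^ 4"
  assumes U: "open U" "0 \<in> U" and h: "Ck_on 2 h U"
    and g: "\<And>x. x \<in> U \<Longrightarrow> g x = c + h x * (x \<bullet> (M *v x))"
    and sym: "\<And>i j. M $ i $ j = M $ j $ i"
  shows "hessian_matrix g = h 0 *\<^sub>R (2 *\<^sub>R M)"
    and "(g has_derivative (\<lambda>_. 0)) (at 0)"
proof -
  define D where "D v x = dir_deriv v h x * (x \<bullet> (M *v x)) + h x * (x \<bullet> (M *v v) + v \<bullet> (M *v x))" for v x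
  have h1: "Ck_on (Suc 0) (dir_deriv v h) U" for v using h by (simp add: numeral_2_eq_2)
  have dh: "(h has_derivative (\<lambda>v. dir_deriv v h x)) (at x)" if "x \<in> U" for x
    using Ck_on_has_derivative[of 1 h U x] h that by (simp add: numeral_2_eq_2)
  have M: "bounded_linear (\<lambda>x. M *v x)" by (rule matrix_vector_mul_bounded_linear)
  have dM: "((\<lambda>x. M *v x) has_derivative (\<lambda>v. M *v v)) (at x)" for x
    by (rule bounded_linear_imp_has_derivative[OF M])
  have dq: "((\<lambda>x. x \<bullet> (M *v x)) has_derivative (\<lambda>v. x \<bullet> (M *v v) + v \<bullet> (M *v x))) (at x)" for x
    by (intro has_derivative_inner has_derivative_ident dM)
  have dg: "(g has_derivative (\<lambda>v. D v x)) (at x)" if "x \<in> U" for x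
  proof -
    have "((\<lambda>x. c + h x * (x \<bullet> (M *v x))) has_derivative
        (\<lambda>v. 0 + (h x * (x \<bullet> (M *v v) + v \<bullet> (M *v x)) + dir_deriv v h x * (x \<bullet> (M *v x))))) (at x)"
      by (intro has_derivative_add has_derivative_const has_derivative_mult dh dq that)
    then show ?thesis
      using has_derivative_cong_open[OF U(1) that g] by (simp add: D_def add.commute)
  qed
  from dg[OF U(2)] show "(g has_derivative (\<lambda>_. 0)) (at 0)" by (simp add: D_def)
  have "dir_deriv w (dir_deriv v g) 0 = h 0 * (w \<bullet> (M *v v) + v \<bullet> (M *v w))" for v w
  proof -
    have "((\<lambda>x. D v x) has_derivative
       (\<lambda>w. (dir_deriv v h 0 * (0 \<bullet> (M *v w) + w \<bullet> (M *v 0)) + dir_deriv w (dir_deriv v h) 0 * (0 \<bullet> (M *v 0))) +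
         (h 0 * (w \<bullet> (M *v v) + v \<bullet> (M *v w)) + dir_deriv w h 0 * (0 \<bullet> (M *v v) + v \<bullet> (M *v 0))))) (at 0)"
      unfolding D_def
      by (intro has_derivative_add has_derivative_mult dh dq Ck_on_has_derivative[OF h1] U(2)
          has_derivative_inner_left has_derivative_inner_right has_derivative_ident dM)
    from dir_deriv_eq[OF this, of w]
    have "dir_deriv w (D v) 0 = h 0 * (w \<bullet> (M *v v) + v \<bullet> (M *v w))" by simp
    moreover have "dir_deriv w (dir_deriv v g) 0 = dir_deriv w (D v) 0"
      by (rule dir_deriv_cong_open[OF U]) (rule dir_deriv_eq[OF dg])
    ultimately show ?thesis by simp
  qed
  moreover have "axis i 1 \<bullet> (M *v axis j 1) = M $ i $ j" for i j
    by (simp add: inner_axis' matrix_vector_mul_component inner_axis)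
  ultimately show "hessian_matrix g = h 0 *\<^sub>R (2 *\<^sub>R M)"
    by (simp add: hessian_matrix_def vec_eq_iff sym)
qed

lemma elliptic4_form: "x \<bullet> (elliptic4 *v x) = (- (x $ 1)\<^sup>2 - (x $ 2)\<^sup>2 + (x $ 3)\<^sup>2 + (x $ 4)\<^sup>2) / 2"
  by (simp add: inner_vec_def sum_4 matrix_vector_mult_def elliptic4_def vector_4 power2_eq_square)

lemma hyperbolic4_form: "x \<bullet> (hyperbolic4 *v x) = x $ 1 * x $ 3 - x $ 2 * x $ 4"
  by (simp add: inner_vec_def sum_4 matrix_vector_mult_def hyperbolic4_def vector_4)

text \<open>The normal form of a focus-focus point.  The constants \<open>e\<close> and \<open>h 0\<close> are absorbed into the
  coefficients \<open>1 / e\<close> and \<open>1 / h 0\<close> of the linear combination, which leaves the matrix whose eigenvalues were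
  computed above.\<close>

lemma focus_focus_criterion:
  assumes chart: "chart_at p U \<sigma>" and omega: "omega_matrix \<sigma> = Omega4"
    and fst: "\<And>x. x \<in> U \<Longrightarrow> fst (f (orbit (\<sigma> x))) =
        c + e * ((- (x $ 1)\<^sup>2 - (x $ 2)\<^sup>2 + (x $ 3)\<^sup>2 + (x $ 4)\<^sup>2) / 2)"
    and snd: "\<And>x. x \<in> U \<Longrightarrow> snd (f (orbit (\<sigma> x))) = h x * (x $ 1 * x $ 3 - x $ 2 * x $ 4)"
    and h: "Ck_on 2 h U" and nz: "e \<noteq> 0" "h 0 \<noteq> 0"
  shows "focus_focus_point f p"
proof -
  have U: "open U" "0 \<in> U" using chart by (auto simp: chart_at_def)
  let ?f1 = "\<lambda>x. fst (f (orbit (\<sigma> x)))" and ?f2 = "\<lambda>x. snd (f (orbit (\<sigma> x)))"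
  have sym: "elliptic4 $ i $ j = elliptic4 $ j $ i" "hyperbolic4 $ i $ j = hyperbolic4 $ j $ i" for i j
    using exhaust_4[of i] exhaust_4[of j]
    by (auto simp: elliptic4_def hyperbolic4_def vector_4)
  have f1: "hessian_matrix ?f1 = e *\<^sub>R (2 *\<^sub>R elliptic4)" "(?f1 has_derivative (\<lambda>_. 0)) (at 0)"
    using hessian_quadratic[OF U Ck_on_const[OF U(1), of 2 e], of ?f1 c elliptic4]
    by (simp_all add: fst elliptic4_form sym)
  have f2: "hessian_matrix ?f2 = h 0 *\<^sub>R (2 *\<^sub>R hyperbolic4)" "(?f2 has_derivative (\<lambda>_. 0)) (at 0)"
    using hessian_quadratic[OF U h, of ?f2 0 hyperbolic4]
    by (simp_all add: snd hyperbolic4_form sym)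
  have "fixed_in_chart f \<sigma>"
    unfolding fixed_in_chart_def
    using has_derivative_Pair[OF f1(2) f2(2)] by (simp add: zero_prod_def)
  moreover have indep: "hessians_independent f \<sigma>"
    unfolding hessians_independent_def f1(1) f2(1)
  proof (intro allI impI)
    fix a b assume *: "a *\<^sub>R e *\<^sub>R 2 *\<^sub>R elliptic4 + b *\<^sub>R h 0 *\<^sub>R 2 *\<^sub>R hyperbolic4 = 0"
    have "(a *\<^sub>R e *\<^sub>R 2 *\<^sub>R elliptic4 + b *\<^sub>R h 0 *\<^sub>R 2 *\<^sub>R hyperbolic4) $ 1 $ 1 = - (a * e)"
      "(a *\<^sub>R e *\<^sub>R 2 *\<^sub>R elliptic4 + b *\<^sub>R h 0 *\<^sub>R 2 *\<^sub>R hyperbolic4) $ 1 $ 3 = b * h 0"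
      by (simp_all add: elliptic4_def hyperbolic4_def vector_4)
    then show "a = 0 \<and> b = 0" using nz unfolding * by simp
  qed
  have scale: "A ** (r *\<^sub>R B) = r *\<^sub>R (A ** B)" for A B :: "real ^ 4 ^ 4" and r :: real
    by (simp add: matrix_matrix_mult_def vec_eq_iff sum_distrib_left mult.left_commute)
  have "linearisation f \<sigma> (1 / e) (1 / h 0) =
      matrix_inv Omega4 ** (2 *\<^sub>R elliptic4) + matrix_inv Omega4 ** (2 *\<^sub>R hyperbolic4)"
    unfolding linearisation_def omega f1(1) f2(1) scale using nz by simp
  then have "eigenvalues_of (linearisation f \<sigma> (1 / e) (1 / h 0)) =
      {Complex 1 1, Complex 1 (- 1), Complex (- 1) 1, Complex (- 1) (- 1)}"
    by (simp only: eigenvalues_linearisation4)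
  ultimately show ?thesis
    unfolding focus_focus_point_def
    using chart indep zero_neq_one[where 'a = real, symmetric] by blast
qed

section \<open>The four focus-focus points\<close>

lemma torus_symmetry_id: "torus_symmetry (\<lambda>z. z)"
  using torus_symmetry_act[of 0] by (simp add: act_zero[abs_def])

lemma torus_symmetry_compose:
  assumes "torus_symmetry P" "torus_symmetry Q"
  shows "torus_symmetry (\<lambda>z. P (Q z))"
proof -
  interpret P: torus_symmetry P by fact
  interpret Q: torus_symmetry Q by fact
  show ?thesis
  proof (rule torus_symmetry.intro)
    show "bounded_linear (\<lambda>z. P (Q z))"
      using bounded_linear_compose[OF P.linear Q.linear] .
    show "inj (\<lambda>z. P (Q z))" using inj_compose[OF P.inj Q.inj] by (simp add: o_def)
  qed (simp_all add: P.level_W_preserved Q.level_W_preserved P.orbit_image Q.orbit_image image_image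
      P.tangent_orbit_image Q.tangent_orbit_image P.tangent_W_image Q.tangent_W_image
      P.omega_st_eq Q.omega_st_eq)
qed

context torus_symmetry
begin

lemma inj_image: "inj ((`) P)"
  by (rule injI) (simp add: inj_image_eq_iff[OF inj])

lemma smooth_on_image:
  assumes "smooth_on \<sigma> U"
  shows "smooth_on (\<lambda>x. P (\<sigma> x)) U"
  using smooth_on_compose[OF assms linear bounded_linear_ident] by simp

lemma frechet_derivative_image:
  assumes "smooth_on \<sigma> U" "x \<in> U"
  shows "frechet_derivative (\<lambda>x. P (\<sigma> x)) (at x) v = P (frechet_derivative \<sigma> (at x) v)"
  using frechet_derivative_compose_linear[OF smooth_on_has_derivative[OF assms] linear bounded_linear_ident]
  by simp

lemma mem_tangent_orbit: "P v \<in> tangent_orbit (P z) \<longleftrightarrow> v \<in> tangent_orbit z"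
  using inj_image_mem_iff[OF inj] tangent_orbit_image by simp

lemma chart_image:
  assumes "chart_at p U \<sigma>"
  shows "chart_at (P ` p) U (\<lambda>x. P (\<sigma> x))" "omega_matrix (\<lambda>x. P (\<sigma> x)) = omega_matrix \<sigma>"
proof -
  have \<sigma>: "smooth_on \<sigma> U" "0 \<in> U" using assms by (auto simp: chart_at_def)
  have "inj_on (\<lambda>x. orbit (P (\<sigma> x))) U \<longleftrightarrow> inj_on (\<lambda>x. orbit (\<sigma> x)) U"
    unfolding inj_on_def orbit_image inj_image_eq_iff[OF inj] ..
  then show "chart_at (P ` p) U (\<lambda>x. P (\<sigma> x))"
    using assms by (auto simp: chart_at_def smooth_on_image frechet_derivative_image[OF \<sigma>(1)]
        mem_tangent_orbit orbit_image level_W_preserved)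
  show "omega_matrix (\<lambda>x. P (\<sigma> x)) = omega_matrix \<sigma>"
    by (simp add: omega_matrix_def frechet_derivative_image[OF \<sigma>] omega_st_eq)
qed

end

definition chart_A :: "real ^ 4 \<Rightarrow> complex ^ 8" where
  "chart_A x = slice (Complex (x $ 1) (x $ 2)) (Complex (x $ 3) (x $ 4))"

definition dom_A :: "(real ^ 4) set" where
  "dom_A = {x. (Complex (x $ 1) (x $ 2), Complex (x $ 3) (x $ 4)) \<in> slice_dom}"

lemma bounded_linear_Complex_nth: "bounded_linear (\<lambda>x :: real ^ 'n. Complex (x $ i) (x $ j))"
  unfolding Complex_eq
  by (intro bounded_linear_add bounded_linear_const_mult
      bounded_linear_compose[OF bounded_linear_of_real bounded_linear_vec_nth])

lemma zero_in_dom_A: "0 \<in> dom_A"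
  by (simp add: dom_A_def slice_dom_def flip: zero_complex.code)

lemma open_dom_A: "open dom_A"
  using open_slice_dom_preimage[OF open_UNIV linear_continuous_on[OF bounded_linear_Complex_nth]
      linear_continuous_on[OF bounded_linear_Complex_nth], of 1 2 3 4]
  by (simp add: dom_A_def)

lemma chart_A_has_derivative:
  "(chart_A has_derivative (\<lambda>v. vector [0, 0, 0, 0, 0, 0,
     Complex (v $ 1) (v $ 2), Complex (v $ 3) (v $ 4)])) (at 0)"
  unfolding chart_A_def[abs_def]
  by (rule slice_has_derivative_centre)
    (auto intro!: bounded_linear_imp_has_derivative bounded_linear_Complex_nth simp: Complex_eq_0)

lemma smooth_on_chart_A: "smooth_on chart_A dom_A"
  unfolding smooth_on_def chart_A_def[abs_def]
  by (intro conjI allI open_dom_A Ck_on_slice Ck_on_linear bounded_linear_Complex_nth)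
    (simp add: dom_A_def)

lemma chart_at_A: "chart_at (orbit (slice 0 0)) dom_A chart_A"
  unfolding chart_at_def
proof (intro conjI ballI allI impI)
  show "chart_A ` dom_A \<subseteq> level_W" by (auto simp: chart_A_def dom_A_def slice_level_W)
  show "orbit (chart_A 0) = orbit (slice 0 0)"
    by (simp add: chart_A_def zero_complex.code[symmetric])
  show "inj_on (\<lambda>x. orbit (chart_A x)) dom_A"
  proof (rule inj_onI)
    fix x y assume "x \<in> dom_A" "y \<in> dom_A" "orbit (chart_A x) = orbit (chart_A y)"
    then show "x = y"
      unfolding chart_A_def dom_A_def mem_Collect_eq
      by (auto dest!: slice_orbit_inj[rotated 2] simp: vec_eq_iff forall_4)
  qed
  fix x v assume x: "x \<in> dom_A" and v: "frechet_derivative chart_A (at x) v \<in> tangent_orbit (chart_A x)"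
  have "Complex (v $ 1) (v $ 2) = 0 \<and> Complex (v $ 3) (v $ 4) = 0"
    by (rule slice_immersive[OF bounded_linear_imp_has_derivative[OF bounded_linear_Complex_nth]
          bounded_linear_imp_has_derivative[OF bounded_linear_Complex_nth]])
      (use smooth_on_has_derivative[OF smooth_on_chart_A x] x v in
        \<open>simp_all add: dom_A_def chart_A_def[abs_def]\<close>)
  then show "v = 0" by (simp add: vec_eq_iff forall_4 Complex_eq_0)
qed (use open_dom_A zero_in_dom_A smooth_on_chart_A in auto)

lemma omega_st_eq_Im: "omega_st u v = (\<Sum>k\<in>UNIV. Im (u $ k * cnj (v $ k)))"
proof -
  have "omega_st u v = Im (\<Sum>k\<in>UNIV. u $ k * cnj (v $ k) - v $ k * cnj (u $ k)) / 2"
    by (simp add: omega_st_def)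
  also have "\<dots> = (\<Sum>k\<in>UNIV. Im (u $ k * cnj (v $ k) - v $ k * cnj (u $ k)) / 2)"
    by (simp only: Im_sum sum_divide_distrib)
  also have "\<dots> = (\<Sum>k\<in>UNIV. Im (u $ k * cnj (v $ k)))"
    by (rule sum.cong) (auto simp: algebra_simps diff_divide_distrib)
  finally show ?thesis .
qed

lemma omega_matrix_chart_A: "omega_matrix chart_A = Omega4"
  unfolding omega_matrix_def frechet_derivative_at[OF chart_A_has_derivative, symmetric]
  by (simp add: vec_eq_iff forall_4 omega_st_eq_Im sum_8 vector_8 Omega4_def vector_4 axis_def)

lemma point_A_eq: "point_A = orbit (slice 0 0)"
proof -
  have "sqrt 8 = 2 * sqrt 2" using real_sqrt_mult[of 4 2] by simp
  then show ?thesis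
    unfolding point_A_def pt_def
    by (intro arg_cong[of _ _ orbit]) (simp add: vec_eq_iff forall_8 vector_8 slice_nth)
qed

lemma point_B_eq: "point_B = flip_H ` point_A"
  unfolding point_A_def point_B_def pt_def flip_H.orbit_image[symmetric]
  by (intro arg_cong[of _ _ orbit]) (simp add: vec_eq_iff forall_8 vector_8 flip_H_nth)

lemma point_C_eq: "point_C = flip_J ` point_A"
  unfolding point_A_def point_C_def pt_def flip_J.orbit_image[symmetric]
  by (intro arg_cong[of _ _ orbit]) (simp add: vec_eq_iff forall_8 vector_8 flip_J_nth)

lemma point_D_eq: "point_D = flip_J ` point_B"
  unfolding point_B_def point_D_def pt_def flip_J.orbit_image[symmetric]
  by (intro arg_cong[of _ _ orbit]) (simp add: vec_eq_iff forall_8 vector_8 flip_J_nth)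

lemma fn_F_half: "fn_F \<gamma> (1 / 2) p = (fn_J p, \<gamma> / 2 * fn_X p)"
  by (simp add: fn_F_def)

lemma fn_J_slice: "(p, q) \<in> slice_dom \<Longrightarrow> fn_J (orbit (slice p q)) = 1 + (- (cmod p)\<^sup>2 + (cmod q)\<^sup>2) / 2"
  by (simp add: fn_J_orbit slice_nth slice_dom_def field_simps)

lemma fn_X_slice:
  "fn_X (orbit (slice p q)) =
     sqrt (6 - 2 * (cmod p)\<^sup>2 + (cmod q)\<^sup>2) * sqrt (6 - (cmod p)\<^sup>2) * sqrt (8 - (cmod q)\<^sup>2) *
     sqrt (2 + 2 * (cmod p)\<^sup>2 - (cmod q)\<^sup>2) * Re (p * q)"
proof -
  have *: "Re (cnj (complex_of_real a) * cnj (complex_of_real b) * cnj (complex_of_real c) *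
      complex_of_real d * p * q) = a * b * c * d * Re (p * q)" for a b c d
  proof -
    have "cnj (complex_of_real a) * cnj (complex_of_real b) * cnj (complex_of_real c) *
      complex_of_real d * p * q = complex_of_real (a * b * c * d) * (p * q)" by simp
    then show ?thesis by (simp only:) simp
  qed
  show ?thesis unfolding fn_X_orbit slice_nth * ..
qed

lemma fn_J_flip: "fn_J (flip_H ` orbit z) = fn_J (orbit z)"
  "z \<in> level_W \<Longrightarrow> fn_J (flip_J ` orbit z) = 3 - fn_J (orbit z)"
  by (simp_all add: fn_J_orbit flip_H_nth flip_J_nth level_W_iff
      flip: flip_H.orbit_image flip_J.orbit_image)

lemma fn_X_flip: "fn_X (flip_H ` orbit z) = fn_X (orbit z)"
  "fn_X (flip_J ` orbit z) = fn_X (orbit z)"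
  by (simp_all add: fn_X_orbit flip_H_nth flip_J_nth algebra_simps
      flip: flip_H.orbit_image flip_J.orbit_image)

text \<open>The chart at \<open>A\<close> is transported by \<open>P\<close>.  In the transported chart \<open>J\<close> may change by an affine map,
  as it does for \<open>flip_J\<close>, but it keeps its normal form.\<close>

lemma focus_focus_image_A:
  assumes P: "torus_symmetry P" and \<gamma>: "0 < \<gamma>" and "e \<noteq> 0"
    and J: "\<And>z. z \<in> level_W \<Longrightarrow> fn_J (P ` orbit z) = c + e * fn_J (orbit z)"
    and X: "\<And>z. fn_X (P ` orbit z) = fn_X (orbit z)"
  shows "focus_focus_point (fn_F \<gamma> (1 / 2)) (P ` point_A)"
proof -
  interpret torus_symmetry P by fact
  define p q where "p x = Complex (x $ 1) (x $ 2)" and "q x = Complex (x $ 3) (x $ 4)" for x :: "real ^ 4"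
  define h where "h x = \<gamma> / 2 * (sqrt (6 - 2 * (cmod (p x))\<^sup>2 + (cmod (q x))\<^sup>2) * sqrt (6 - (cmod (p x))\<^sup>2) *
      sqrt (8 - (cmod (q x))\<^sup>2) * sqrt (2 + 2 * (cmod (p x))\<^sup>2 - (cmod (q x))\<^sup>2))" for x
  have dom: "(p x, q x) \<in> slice_dom" if "x \<in> dom_A" for x
    using that by (simp add: dom_A_def p_def q_def)
  have lin: "Ck_on 2 p dom_A" "Ck_on 2 q dom_A"
    unfolding p_def[abs_def] q_def[abs_def]
    by (intro Ck_on_linear open_dom_A bounded_linear_Complex_nth)+
  note slice_C2 = Ck_on_slice[OF open_dom_A lin dom]
  have Re_nth: "Ck_on 2 (\<lambda>x. Re (slice (p x) (q x) $ k)) dom_A" for k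
    by (intro Ck_on_bounded_linear[OF open_dom_A bounded_linear_Re]
        Ck_on_bounded_linear[OF open_dom_A bounded_linear_vec_nth] slice_C2)
  have "Ck_on 2 h dom_A"
    using Re_nth[of 2] Re_nth[of 3] Re_nth[of 4] Re_nth[of 6]
    unfolding h_def[abs_def]
    by (intro Ck_on_mult open_dom_A Ck_on_const) (simp_all add: slice_nth)
  moreover have "h 0 \<noteq> 0" using \<gamma> by (simp add: h_def p_def q_def zero_complex.code[symmetric])
  moreover have "fst (fn_F \<gamma> (1 / 2) (orbit (P (chart_A x)))) =
      (c + e) + e * ((- (x $ 1)\<^sup>2 - (x $ 2)\<^sup>2 + (x $ 3)\<^sup>2 + (x $ 4)\<^sup>2) / 2)" if "x \<in> dom_A" for x
    using J[OF slice_level_W[OF dom[OF that]]] fn_J_slice[OF dom[OF that]]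
    by (simp add: fn_F_half orbit_image chart_A_def p_def q_def cmod_power2 algebra_simps)
  moreover have "snd (fn_F \<gamma> (1 / 2) (orbit (P (chart_A x)))) = h x * (x $ 1 * x $ 3 - x $ 2 * x $ 4)"
    if "x \<in> dom_A" for x
    by (simp add: fn_F_half orbit_image X chart_A_def fn_X_slice h_def p_def q_def)
  moreover have "chart_at (P ` point_A) dom_A (\<lambda>x. P (chart_A x))"
    "omega_matrix (\<lambda>x. P (chart_A x)) = Omega4"
    using chart_image[OF chart_at_A] by (simp_all add: point_A_eq omega_matrix_chart_A)
  ultimately show ?thesis using \<open>e \<noteq> 0\<close> by (intro focus_focus_criterion)
qed

lemma focus_focus_points:
  assumes "0 < \<gamma>"
  shows "focus_focus_point (fn_F \<gamma> (1 / 2)) point_A" "focus_focus_point (fn_F \<gamma> (1 / 2)) point_B"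
    "focus_focus_point (fn_F \<gamma> (1 / 2)) point_C" "focus_focus_point (fn_F \<gamma> (1 / 2)) point_D"
proof -
  have flip_flip: "z \<in> level_W \<Longrightarrow> fn_J (flip_J ` flip_H ` orbit z) = 3 - fn_J (flip_H ` orbit z)"
    "fn_X (flip_J ` flip_H ` orbit z) = fn_X (flip_H ` orbit z)" for z
    using fn_J_flip(2)[of "flip_H z"] fn_X_flip(2)[of "flip_H z"]
    by (simp_all add: flip_H.level_W_preserved flip_H.orbit_image)
  note F = focus_focus_image_A[OF _ assms]
  show "focus_focus_point (fn_F \<gamma> (1 / 2)) point_A"
    using F[OF torus_symmetry_id, of 1 0] by simp
  show "focus_focus_point (fn_F \<gamma> (1 / 2)) point_B"
    unfolding point_B_eq
    by (rule F[OF flip_H.torus_symmetry_axioms, of 1 0]) (simp_all add: fn_J_flip fn_X_flip)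
  show "focus_focus_point (fn_F \<gamma> (1 / 2)) point_C"
    unfolding point_C_eq
    by (rule F[OF flip_J.torus_symmetry_axioms, of "- 1" 3]) (simp_all add: fn_J_flip fn_X_flip)
  have "(\<lambda>z. flip_J (flip_H z)) ` orbit z = flip_J ` orbit (flip_H z)" for z
    by (simp add: flip_H.orbit_image image_image)
  then have "focus_focus_point (fn_F \<gamma> (1 / 2)) ((\<lambda>z. flip_J (flip_H z)) ` point_A)"
    by (intro F[OF torus_symmetry_compose[OF flip_J.torus_symmetry_axioms flip_H.torus_symmetry_axioms],
          of "- 1" 3])
      (simp_all add: flip_flip fn_J_flip fn_X_flip flip_H.level_W_preserved flip_H.orbit_image)
  then show "focus_focus_point (fn_F \<gamma> (1 / 2)) point_D"
    unfolding point_D_eq point_B_eq by (simp add: image_image)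
qed

section \<open>Tangent spaces and symmetries of spheres\<close>

lemma tangent_W_add: "u \<in> tangent_W z \<Longrightarrow> v \<in> tangent_W z \<Longrightarrow> u + v \<in> tangent_W z"
  unfolding tangent_W_def
  using linear_add[OF has_derivative_linear[OF frechet_derivative_works[THEN iffD1,
          OF differentiableI[OF constraint_has_derivative]]]]
  by simp

lemma tangent_orbit_subset_tangent_W: "tangent_orbit z \<subseteq> tangent_W z"
proof -
  have "z $ k \<bullet> inf_act \<theta> z $ k = 0" for \<theta> k
    by (simp add: inf_act_def inner_complex_def algebra_simps)
  then show ?thesis unfolding tangent_orbit_eq by (auto simp: tangent_W_iff)
qed

text \<open>A lift only has to stay in \<open>W\<close> over the sphere itself, so its derivative is computed along
  great circles.\<close>

lemma local_lift_tangent_W: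
  assumes lift: "local_lift e x U \<sigma>" and x: "x \<in> S2" and v: "x \<bullet> v = 0"
  shows "frechet_derivative \<sigma> (at x) v \<in> tangent_W (\<sigma> x)"
proof (cases "v = 0")
  case True
  have "(\<sigma> has_derivative frechet_derivative \<sigma> (at x)) (at x)"
    using lift by (intro smooth_on_has_derivative) (auto simp: local_lift_def)
  then have "frechet_derivative \<sigma> (at x) 0 = 0"
    by (intro linear_0 has_derivative_linear)
  then show ?thesis using True by (simp add: tangent_W_iff)
next
  case False
  define a where "a = norm v"
  have a: "a \<noteq> 0" "v \<bullet> v = a\<^sup>2" using False by (auto simp: a_def power2_norm_eq_inner)
  define c where "c s = cos (a * s) *\<^sub>R x + (sin (a * s) / a) *\<^sub>R v" for s
  have c0: "c 0 = x" by (simp add: c_def)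
  have xx: "x \<bullet> x = 1" using x by (simp add: dot_square_norm)
  have c_S2: "c s \<in> S2" for s
  proof -
    have "c s \<bullet> c s = (cos (a * s))\<^sup>2 + (sin (a * s))\<^sup>2"
      using a v xx by (simp add: c_def inner_add_left inner_add_right inner_commute power2_eq_square)
    then show ?thesis by (simp add: norm_eq_1)
  qed
  have dc: "(c has_derivative (\<lambda>h. h *\<^sub>R v)) (at 0)"
    unfolding c_def[abs_def] using a by (auto intro!: derivative_eq_intros)
  have \<sigma>: "(\<sigma> has_derivative frechet_derivative \<sigma> (at x)) (at (c 0))" "open U" "x \<in> U"
    using lift unfolding c0 by (auto intro!: smooth_on_has_derivative simp: local_lift_def)
  obtain D where D: "(constraint has_derivative D) (at (\<sigma> (c 0)))"
    using constraint_has_derivative by blast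
  have "((\<lambda>s. constraint (\<sigma> (c s))) has_derivative (\<lambda>h. D (frechet_derivative \<sigma> (at x) (h *\<^sub>R v)))) (at 0)"
    using has_derivative_compose[OF has_derivative_compose[OF dc \<sigma>(1)] D] .
  moreover have "((\<lambda>s. constraint (\<sigma> (c s))) has_derivative (\<lambda>h. 0)) (at 0)"
  proof -
    have cont: "continuous_on UNIV c" unfolding c_def[abs_def] by (intro continuous_intros) (simp add: a)
    have "open (c -` U)" using continuous_open_preimage[OF cont open_UNIV \<sigma>(2)] by simp
    moreover have "constraint (\<sigma> (c s)) = constraint (\<sigma> x)" if "s \<in> c -` U" for s
      using lift that c_S2 \<sigma>(3) x by (auto simp: local_lift_def level_W_def)
    ultimately show ?thesis
      using has_derivative_cong_open[of "c -` U" 0 "\<lambda>s. constraint (\<sigma> (c s))" "\<lambda>_. constraint (\<sigma> x)"]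
        \<sigma>(3) c0 by simp
  qed
  ultimately have "(\<lambda>h. D (frechet_derivative \<sigma> (at x) (h *\<^sub>R v))) = (\<lambda>h. 0)"
    by (rule has_derivative_unique)
  from fun_cong[OF this, of 1] show ?thesis
    unfolding tangent_W_def using frechet_derivative_at[OF D] c0 by simp
qed

text \<open>This inclusion holds for arbitrary lifts, so transversality reduces to showing that \<open>tangent_W z\<close> is
  contained in the sum of the two tangent spaces.\<close>

lemma sphere_tangent_subset: "sphere_tangent e z \<subseteq> tangent_W z"
proof
  fix w assume "w \<in> sphere_tangent e z"
  then obtain U \<sigma> x v n where *: "w = frechet_derivative \<sigma> (at x) v + n" "x \<in> S2"
    "local_lift e x U \<sigma>" "\<sigma> x = z" "x \<bullet> v = 0" "n \<in> tangent_orbit z"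
    unfolding sphere_tangent_def by blast
  then show "w \<in> tangent_W z"
    using local_lift_tangent_W[OF *(3,2,5)] tangent_orbit_subset_tangent_W[of z]
    by (auto intro: tangent_W_add)
qed

lemma local_lift_cong:
  "(\<And>y. y \<in> S2 \<Longrightarrow> e y = e' y) \<Longrightarrow> local_lift e = local_lift e'"
  by (intro ext) (auto simp: local_lift_def)

lemma sphere_tangent_cong:
  "(\<And>y. y \<in> S2 \<Longrightarrow> e y = e' y) \<Longrightarrow> sphere_tangent e = sphere_tangent e'"
  using local_lift_cong[of e e'] unfolding sphere_tangent_def[abs_def] by presburger

text \<open>The local part of \<open>embedded_sphere\<close>, isolated so that it can be transported from one point of the
  sphere to another.\<close>

definition immersed_at :: "(real ^ 3 \<Rightarrow> (complex ^ 8) set) \<Rightarrow> real ^ 3 \<Rightarrow> bool" where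
  "immersed_at e x \<longleftrightarrow> (\<exists>U \<sigma>. local_lift e x U \<sigma> \<and>
     (\<forall>v. x \<bullet> v = 0 \<and> frechet_derivative \<sigma> (at x) v \<in> tangent_orbit (\<sigma> x) \<longrightarrow> v = 0))"

lemma embedded_sphere_iff: "embedded_sphere e \<longleftrightarrow> inj_on e S2 \<and> (\<forall>x\<in>S2. immersed_at e x)"
  by (simp add: embedded_sphere_def immersed_at_def)

lemma immersed_at_cong:
  "(\<And>y. y \<in> S2 \<Longrightarrow> e y = e' y) \<Longrightarrow> immersed_at e = immersed_at e'"
  using local_lift_cong[of e e'] unfolding immersed_at_def[abs_def] by presburger

text \<open>The nontrivial inclusion of \<open>transverse_at\<close>, at a single representative.\<close>

definition spans_tangent_W ::
    "(real ^ 3 \<Rightarrow> (complex ^ 8) set) \<Rightarrow> (real ^ 3 \<Rightarrow> (complex ^ 8) set) \<Rightarrow> complex ^ 8 \<Rightarrow> bool" where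
  "spans_tangent_W e1 e2 z \<longleftrightarrow>
     (\<forall>w\<in>tangent_W z. \<exists>u\<in>sphere_tangent e1 z. \<exists>v\<in>sphere_tangent e2 z. w = u + v)"

text \<open>A symmetry of the quotient may be combined with an orthogonal involution \<open>\<rho>\<close> of the
  parametrising sphere.  The involution is needed because \<open>flip_H\<close> exchanges \<open>A\<close> and \<open>B\<close>, which are the images
  of the two poles.\<close>

locale sphere_symmetry = torus_symmetry +
  fixes \<rho> :: "real ^ 3 \<Rightarrow> real ^ 3"
  assumes orthogonal: "orthogonal_transformation \<rho>" and involution: "\<rho> (\<rho> x) = x"
begin

lemma linear_\<rho>: "bounded_linear \<rho>"
  using orthogonal orthogonal_transformation_linear linear_conv_bounded_linear by blast

lemma \<rho>_S2: "\<rho> x \<in> S2 \<longleftrightarrow> x \<in> S2"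
  using orthogonal by (simp add: orthogonal_transformation)

lemma inner_\<rho>: "\<rho> x \<bullet> v = x \<bullet> \<rho> v"
  using orthogonal unfolding orthogonal_transformation_def by (metis involution)

lemma local_lift_image:
  assumes "local_lift e x U \<sigma>"
  shows "local_lift (\<lambda>y. P ` e (\<rho> y)) (\<rho> x) (\<rho> -` U) (\<lambda>y. P (\<sigma> (\<rho> y)))"
proof -
  have smooth: "smooth_on (\<lambda>y. P (\<sigma> (\<rho> y))) (\<rho> -` U)"
    using assms by (intro smooth_on_compose linear linear_\<rho>) (simp add: local_lift_def)
  moreover have "P (\<sigma> (\<rho> y)) \<in> level_W \<and> orbit (P (\<sigma> (\<rho> y))) = P ` e (\<rho> y)"
    if "y \<in> \<rho> -` U \<inter> S2" for y
  proof -
    have "\<rho> y \<in> U \<inter> S2" using that \<rho>_S2 by blast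
    then show ?thesis using assms unfolding local_lift_def level_W_preserved orbit_image by metis
  qed
  ultimately show ?thesis
    using assms by (simp add: local_lift_def involution smooth_on_def)
qed

lemma frechet_derivative_lift_image:
  assumes "local_lift e x U \<sigma>"
  shows "frechet_derivative (\<lambda>y. P (\<sigma> (\<rho> y))) (at (\<rho> x)) v = P (frechet_derivative \<sigma> (at x) (\<rho> v))"
proof -
  have "(\<sigma> has_derivative frechet_derivative \<sigma> (at x)) (at (\<rho> (\<rho> x)))"
    using assms unfolding involution by (auto intro: smooth_on_has_derivative simp: local_lift_def)
  from frechet_derivative_compose_linear[OF this linear linear_\<rho>] show ?thesis by simp
qed

lemma immersed_at_image:
  assumes "immersed_at e x"
  shows "immersed_at (\<lambda>y. P ` e (\<rho> y)) (\<rho> x)"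
proof -
  obtain U \<sigma> where lift: "local_lift e x U \<sigma>" and
    imm: "\<And>v. x \<bullet> v = 0 \<Longrightarrow> frechet_derivative \<sigma> (at x) v \<in> tangent_orbit (\<sigma> x) \<Longrightarrow> v = 0"
    using assms unfolding immersed_at_def by blast
  have "v = 0" if v: "\<rho> x \<bullet> v = 0"
    "frechet_derivative (\<lambda>y. P (\<sigma> (\<rho> y))) (at (\<rho> x)) v \<in> tangent_orbit (P (\<sigma> (\<rho> (\<rho> x))))" for v
  proof -
    have "\<rho> v = 0"
      using v unfolding frechet_derivative_lift_image[OF lift] involution mem_tangent_orbit inner_\<rho>
      by (rule imm)
    then have "\<rho> (\<rho> v) = \<rho> 0" by simp
    then show ?thesis using linear_0[OF bounded_linear.linear[OF linear_\<rho>]] by (simp add: involution)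
  qed
  then show ?thesis unfolding immersed_at_def using local_lift_image[OF lift] by blast
qed

lemma sphere_tangent_image:
  assumes "w \<in> sphere_tangent e z"
  shows "P w \<in> sphere_tangent (\<lambda>y. P ` e (\<rho> y)) (P z)"
proof -
  obtain U \<sigma> x v n where *: "w = frechet_derivative \<sigma> (at x) v + n" "x \<in> S2"
    "local_lift e x U \<sigma>" "\<sigma> x = z" "x \<bullet> v = 0" "n \<in> tangent_orbit z"
    using assms unfolding sphere_tangent_def by blast
  have "P w = frechet_derivative (\<lambda>y. P (\<sigma> (\<rho> y))) (at (\<rho> x)) (\<rho> v) + P n"
    unfolding frechet_derivative_lift_image[OF *(3)] involution *(1)
    by (rule linear_add[OF bounded_linear.linear[OF linear]])
  moreover have "\<rho> x \<in> S2" using *(2) \<rho>_S2 by blast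
  moreover have "P (\<sigma> (\<rho> (\<rho> x))) = P z" by (simp add: involution *(4))
  moreover have "\<rho> x \<bullet> \<rho> v = 0" by (simp add: inner_\<rho> involution *(5))
  moreover have "P n \<in> tangent_orbit (P z)" using *(6) by (simp add: mem_tangent_orbit)
  ultimately show ?thesis
    unfolding sphere_tangent_def using local_lift_image[OF *(3)] by blast
qed

lemma spans_tangent_W_image:
  assumes "spans_tangent_W e1 e2 z"
  shows "spans_tangent_W (\<lambda>y. P ` e1 (\<rho> y)) (\<lambda>y. P ` e2 (\<rho> y)) (P z)"
  unfolding spans_tangent_W_def tangent_W_image
proof clarify
  fix w assume "w \<in> tangent_W z"
  then obtain u v where "u \<in> sphere_tangent e1 z" "v \<in> sphere_tangent e2 z" "w = u + v"
    using assms unfolding spans_tangent_W_def by blast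
  then show "\<exists>u\<in>sphere_tangent (\<lambda>y. P ` e1 (\<rho> y)) (P z).
      \<exists>v\<in>sphere_tangent (\<lambda>y. P ` e2 (\<rho> y)) (P z). P w = u + v"
    using sphere_tangent_image linear_add[OF bounded_linear.linear[OF linear]] by blast
qed

end

lemma sphere_symmetry_id: "torus_symmetry P \<Longrightarrow> sphere_symmetry P (\<lambda>x. x)"
  by (simp add: sphere_symmetry_def sphere_symmetry_axioms_def orthogonal_transformation_id)

text \<open>By the torus action, transversality has to be checked at one representative only.\<close>

lemma transverse_atI:
  assumes span: "spans_tangent_W e1 e2 z"
    and e: "e1 ` S2 \<subseteq> quot_M" "e2 ` S2 \<subseteq> quot_M"
  shows "transverse_at (orbit z) e1 e2"
  unfolding transverse_at_def
proof
  fix z' assume "z' \<in> orbit z"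
  then obtain t where t: "z' = act t z" by (auto simp: orbit_def)
  interpret act: sphere_symmetry "act t" "\<lambda>x. x"
    by (intro sphere_symmetry_id torus_symmetry_act)
  have fixed: "act t ` e y = e y" if "y \<in> S2" "e ` S2 \<subseteq> quot_M" for e y
  proof -
    obtain w where "e y = orbit w" using \<open>e ` S2 \<subseteq> quot_M\<close> \<open>y \<in> S2\<close> unfolding quot_M_def by blast
    then show ?thesis using act.orbit_image[of w] by (simp add: orbit_act)
  qed
  have cong: "sphere_tangent (\<lambda>y. act t ` e1 y) = sphere_tangent e1"
    "sphere_tangent (\<lambda>y. act t ` e2 y) = sphere_tangent e2"
    by (rule sphere_tangent_cong, rule fixed, assumption, rule e)+
  have "spans_tangent_W e1 e2 z'"
    using act.spans_tangent_W_image[OF span] unfolding spans_tangent_W_def cong t .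
  moreover have "u + v \<in> tangent_W z'"
    if "u \<in> sphere_tangent e1 z'" "v \<in> sphere_tangent e2 z'" for u v
    using that sphere_tangent_subset tangent_W_add by blast
  ultimately show "{u + v |u v. u \<in> sphere_tangent e1 z' \<and> v \<in> sphere_tangent e2 z'} = tangent_W z'"
    unfolding spans_tangent_W_def by blast
qed

section \<open>The two spheres through \<open>A\<close> and \<open>B\<close>\<close>

text \<open>The value of \<open>z\<^sub>7\<close> that goes with \<open>z\<^sub>8 = q\<close> on one of the two spheres; the sign \<open>s = \<plusminus> 1\<close> tells which.\<close>

definition opposite :: "real \<Rightarrow> complex \<Rightarrow> complex" where
  "opposite s q = complex_of_real s * \<i> * cnj q"

text \<open>Lambert's equal-area projection, which maps the unit sphere without its south pole onto the open disc of radius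
  \<open>sqrt 6\<close>.  The squared radius is \<open>3 (1 - x\<^sub>3)\<close>; since \<open>\<bar>z\<^sub>2\<bar>\<^sup>2 = 6 - \<bar>z\<^sub>8\<bar>\<^sup>2\<close> on the spheres, the exchange of \<open>z\<^sub>2\<close>
  and \<open>z\<^sub>8\<close> by \<open>flip_H\<close> becomes the reflection \<open>x\<^sub>3 \<mapsto> - x\<^sub>3\<close>.\<close>

definition zeta :: "real ^ 3 \<Rightarrow> complex" where
  "zeta x = complex_of_real (sqrt 3 * inverse (sqrt (1 + x $ 3))) * Complex (x $ 1) (x $ 2)"

definition sphere_lift :: "real \<Rightarrow> real ^ 3 \<Rightarrow> complex ^ 8" where
  "sphere_lift s x = slice (opposite s (zeta x)) (zeta x)"

text \<open>The boundary circle of the disc is a single orbit, the point \<open>B\<close> (see \<open>slice_rim\<close> below), so \<open>B\<close> is the value at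
  the south pole.\<close>

definition sphere_map :: "real \<Rightarrow> real ^ 3 \<Rightarrow> (complex ^ 8) set" where
  "sphere_map s x = (if x $ 3 = - 1 then point_B else orbit (sphere_lift s x))"

definition reflect :: "real ^ 3 \<Rightarrow> real ^ 3" where
  "reflect x = vector [x $ 1, x $ 2, - x $ 3]"

abbreviation north :: "real ^ 3" where "north \<equiv> axis 3 1"

lemma opposite_simps: "cmod (opposite s q) = \<bar>s\<bar> * cmod q" "opposite s 0 = 0"
  "Re (opposite s q * q) = 0"
  by (simp_all add: opposite_def norm_mult)

lemma S2_iff: "x \<in> S2 \<longleftrightarrow> (x $ 1)\<^sup>2 + (x $ 2)\<^sup>2 + (x $ 3)\<^sup>2 = 1"
  by (simp add: norm_eq_1 inner_vec_def sum_3 power2_eq_square)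

lemma S2_bounds:
  assumes "x \<in> S2"
  shows "- 1 \<le> x $ 3" "x $ 3 \<le> 1"
proof -
  have "(x $ 3)\<^sup>2 \<le> 1\<^sup>2" using assms unfolding S2_iff by (simp add: add_increasing2 flip: le_diff_eq)
      (smt (verit) zero_le_power2)
  then show "- 1 \<le> x $ 3" "x $ 3 \<le> 1" using abs_le_square_iff[of "x $ 3" 1] by auto
qed

lemma reflect_nth: "reflect x $ 1 = x $ 1" "reflect x $ 2 = x $ 2" "reflect x $ 3 = - x $ 3"
  by (simp_all add: reflect_def vector_3)

lemma reflect_reflect: "reflect (reflect x) = x"
  by (simp add: vec_eq_iff forall_3 reflect_nth)

interpretation flip_H: sphere_symmetry flip_H reflect
proof
  show "orthogonal_transformation reflect"
    unfolding orthogonal_transformation_def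
    by (auto intro!: linearI simp: vec_eq_iff forall_3 reflect_nth inner_vec_def sum_3)
qed (rule reflect_reflect)

lemma cmod_zeta:
  assumes "x \<in> S2" "- 1 < x $ 3"
  shows "(cmod (zeta x))\<^sup>2 = 3 * (1 - x $ 3)"
proof -
  have "(x $ 1)\<^sup>2 + (x $ 2)\<^sup>2 = (1 - x $ 3) * (1 + x $ 3)"
    using assms(1) unfolding S2_iff by (simp add: algebra_simps power2_eq_square)
  moreover have "(cmod (zeta x))\<^sup>2 = (sqrt 3 * inverse (sqrt (1 + x $ 3)))\<^sup>2 * ((x $ 1)\<^sup>2 + (x $ 2)\<^sup>2)"
    unfolding zeta_def norm_mult norm_of_real
    by (simp only: power_mult_distrib power2_abs cmod_power2 complex.sel)
  moreover have "(sqrt 3 * inverse (sqrt (1 + x $ 3)))\<^sup>2 = 3 / (1 + x $ 3)"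
    using assms(2) by (simp add: power_mult_distrib power_inverse divide_inverse)
  ultimately show ?thesis using assms(2) by simp
qed

lemma slice_dom_opposite:
  assumes "\<bar>s\<bar> = 1" "(cmod q)\<^sup>2 < 6"
  shows "(opposite s q, q) \<in> slice_dom"
  using assms by (simp add: slice_dom_def opposite_simps add_nonneg_pos)

lemma sphere_dom:
  assumes "\<bar>s\<bar> = 1" "x \<in> S2" "- 1 < x $ 3"
  shows "(opposite s (zeta x), zeta x) \<in> slice_dom"
  using assms by (intro slice_dom_opposite) (simp_all add: cmod_zeta del: mem_sphere_0)

lemma sphere_map_north: "sphere_map s north = point_A"
  by (simp add: sphere_map_def point_A_eq sphere_lift_def zeta_def axis_def opposite_simps
      flip: zero_complex.code)

lemma S2_pole:
  assumes "x \<in> S2" "x $ 3 = 1 \<or> x $ 3 = - 1"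
  shows "x = (x $ 3) *\<^sub>R north"
proof -
  have "(x $ 1)\<^sup>2 + (x $ 2)\<^sup>2 = 0" using assms unfolding S2_iff by auto
  then have "x $ 1 = 0" "x $ 2 = 0" by (simp_all add: sum_power2_eq_zero_iff)
  then show ?thesis by (simp add: vec_eq_iff forall_3 axis_def)
qed

text \<open>Near \<open>A\<close> the coordinates \<open>z\<^sub>2\<close> and \<open>z\<^sub>3\<close> are positive and \<open>z\<^sub>7\<close>, \<open>z\<^sub>8\<close> carry the angle of \<open>zeta x\<close>; after
  applying \<open>flip_H\<close> it is the other way round, and away from the poles a torus element transfers the angle.
  The exchange of \<open>z\<^sub>3\<close> and \<open>z\<^sub>7\<close> turns \<open>\<plusminus> i\<close> into its conjugate, so the two spheres are
  swapped.\<close>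

lemma flip_H_sphere_map:
  assumes s: "\<bar>s\<bar> = 1" and x: "x \<in> S2"
  shows "flip_H ` sphere_map s (reflect x) = sphere_map (- s) x"
proof -
  consider "x $ 3 = 1" | "x $ 3 = - 1" | "- 1 < x $ 3" "x $ 3 < 1"
    using S2_bounds[OF x] by linarith
  then show ?thesis
  proof cases
    case 1
    then have "x = north" using S2_pole[OF x] by simp
    moreover have "sphere_map s (reflect x) = point_B" by (simp add: sphere_map_def reflect_nth 1)
    ultimately show ?thesis
      by (simp add: sphere_map_north point_B_eq image_image flip_H_flip_H)
  next
    case 2
    then have "reflect x = north" using S2_pole[OF x] 2 by (simp add: vec_eq_iff forall_3 reflect_nth axis_def)
    then show ?thesis using 2 by (simp add: sphere_map_north point_B_eq) (simp add: sphere_map_def point_B_eq)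
  next
    case 3
    define \<alpha> where "\<alpha> = Arg (Complex (x $ 1) (x $ 2))"
    define a b where "a = sqrt 3 * sqrt (1 - x $ 3)" and "b = sqrt 3 * sqrt (1 + x $ 3)"
    have ab: "a\<^sup>2 = 3 * (1 - x $ 3)" "b\<^sup>2 = 3 * (1 + x $ 3)" "0 < a" "0 < b"
      using 3 by (simp_all add: a_def b_def power_mult_distrib)
    have len: "cmod (Complex (x $ 1) (x $ 2)) = sqrt (1 - x $ 3) * sqrt (1 + x $ 3)"
    proof -
      have "(x $ 1)\<^sup>2 + (x $ 2)\<^sup>2 = (1 - x $ 3) * (1 + x $ 3)"
        using x unfolding S2_iff by (simp add: algebra_simps power2_eq_square)
      then show ?thesis by (simp add: complex_norm real_sqrt_mult)
    qed
    have "0 < cmod (Complex (x $ 1) (x $ 2))" unfolding len using 3 by simp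
    then have "Complex (x $ 1) (x $ 2) \<noteq> 0" by (simp only: zero_less_norm_iff not_False_eq_True)
    then have polar: "Complex (x $ 1) (x $ 2) = complex_of_real (sqrt (1 - x $ 3) * sqrt (1 + x $ 3)) * cis \<alpha>"
      unfolding len[symmetric] \<alpha>_def by (simp add: cis_Arg complex_sgn_def scaleR_conv_of_real)
    have zeta: "zeta x = complex_of_real a * cis \<alpha>" "zeta (reflect x) = complex_of_real b * cis \<alpha>"
      unfolding zeta_def reflect_nth polar using 3 by (simp_all add: a_def b_def)
    have norms: "cmod (zeta x) = a" "cmod (zeta (reflect x)) = b"
      using ab by (simp_all add: zeta norm_mult)
    have si: "cis (s * (pi / 2)) = complex_of_real s * \<i>" "cis (- (s * (pi / 2))) = - (complex_of_real s * \<i>)"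
      using s by (auto simp: complex_eq_iff abs_if split: if_splits)
    \<comment> \<open>makes the second and third coordinate positive and fixes the phases of the first, fourth, fifth and sixth\<close>
    define t :: "real ^ 6" where "t = vector [0, - \<alpha>, \<alpha> - s * (pi / 2), 0, 0, \<alpha>]"
    have ph: "phase t $ 1 = 0" "phase t $ 2 = - \<alpha>" "phase t $ 3 = \<alpha> - s * (pi / 2)" "phase t $ 4 = 0"
      "phase t $ 5 = 0" "phase t $ 6 = 0" "phase t $ 7 = - (s * (pi / 2)) - \<alpha>" "phase t $ 8 = \<alpha>"
      by (simp_all add: phase_nth t_def vector_6)
    have roots: "sqrt (2 - b\<^sup>2 + b\<^sup>2) = sqrt (2 - a\<^sup>2 + a\<^sup>2)" "sqrt (6 - b\<^sup>2) = a" "sqrt (6 - 2 * b\<^sup>2 + b\<^sup>2) = a"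
      "sqrt (6 - a\<^sup>2) = b" "sqrt (6 - 2 * a\<^sup>2 + a\<^sup>2) = b" "sqrt (2 + 2 * b\<^sup>2 - b\<^sup>2) = sqrt (8 - a\<^sup>2)"
      "sqrt (8 - b\<^sup>2) = sqrt (2 + 2 * a\<^sup>2 - a\<^sup>2)" "sqrt (4 + b\<^sup>2 - b\<^sup>2) = sqrt (4 + a\<^sup>2 - a\<^sup>2)"
      using ab by (auto intro!: real_sqrt_unique)
    have "s * s = 1" using s by (auto simp: abs_if split: if_splits)
    then have "complex_of_real s * complex_of_real s = 1"
      unfolding of_real_mult[symmetric] by (simp only: of_real_1)
    moreover have "cis \<alpha> * cis (- \<alpha>) = 1" by (simp add: cis_mult)
    ultimately have unit: "complex_of_real s * complex_of_real s = 1" "cis \<alpha> * cis (- \<alpha>) = 1" "\<i> * \<i> = - 1"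
      by (simp_all only: i_squared)
    have rotations: "cis (\<alpha> - s * (pi / 2)) = - (cis \<alpha> * (complex_of_real s * \<i>))"
      "cis (- (s * (pi / 2)) - \<alpha>) = - (cis (- \<alpha>) * (complex_of_real s * \<i>))"
    proof -
      show "cis (\<alpha> - s * (pi / 2)) = - (cis \<alpha> * (complex_of_real s * \<i>))"
        using cis_mult[of \<alpha> "- (s * (pi / 2))"] unfolding si(2) by simp
      show "cis (- (s * (pi / 2)) - \<alpha>) = - (cis (- \<alpha>) * (complex_of_real s * \<i>))"
        using cis_mult[of "- (s * (pi / 2))" "- \<alpha>"] unfolding si(2) by (simp add: mult.commute)
    qed
    have conj: "cnj (complex_of_real r * cis \<alpha>) = complex_of_real r * cis (- \<alpha>)" for r
      by (simp add: cis_cnj)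
    note nth = sphere_lift_def slice_nth opposite_simps norms s abs_minus_cancel mult_1 roots
    have "sphere_lift (- s) x = act t (flip_H (sphere_lift s (reflect x)))"
      unfolding vec_eq_iff forall_8 act_nth ph flip_H_nth
    proof (intro conjI)
      show "sphere_lift (- s) x $ 2 = cis (- \<alpha>) * sphere_lift s (reflect x) $ 8"
        unfolding nth unfolding zeta using unit by algebra
      show "sphere_lift (- s) x $ 3 = cis (\<alpha> - s * (pi / 2)) * sphere_lift s (reflect x) $ 7"
        unfolding nth rotations unfolding zeta opposite_def conj using unit by algebra
      show "sphere_lift (- s) x $ 7 = cis (- (s * (pi / 2)) - \<alpha>) * sphere_lift s (reflect x) $ 3"
        unfolding nth rotations unfolding zeta opposite_def conj of_real_minus by algebra
      show "sphere_lift (- s) x $ 8 = cis \<alpha> * sphere_lift s (reflect x) $ 2"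
        unfolding nth unfolding zeta by algebra
    qed (simp_all only: nth cis_zero)
    then show ?thesis
      using 3 flip_H.orbit_image[of "sphere_lift s (reflect x)"]
      by (simp add: sphere_map_def reflect_nth orbit_act)
  qed
qed

definition dom_sphere :: "real \<Rightarrow> (real ^ 3) set" where
  "dom_sphere s = {x \<in> {x. - 1 < x $ 3}. (opposite s (zeta x), zeta x) \<in> slice_dom}"

lemma open_upper: "open {x :: real ^ 3. - 1 < x $ 3}"
  by (intro open_Collect_less continuous_intros)

lemma Ck_on_zeta: "Ck_on k zeta {x. - 1 < x $ 3}"
proof -
  have "Ck_on k (\<lambda>x::real^3. 1 + x $ 3) {x. - 1 < x $ 3}"
    by (intro Ck_on_add Ck_on_const Ck_on_linear open_upper bounded_linear_vec_nth)
  then have "Ck_on k (\<lambda>x::real^3. sqrt 3 * inverse (sqrt (1 + x $ 3))) {x. - 1 < x $ 3}"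
    by (intro Ck_on_mult Ck_on_const Ck_on_inverse Ck_on_sqrt open_upper) auto
  from Ck_on_bounded_linear[OF open_upper bounded_linear_of_real this]
  show ?thesis
    unfolding zeta_def[abs_def]
    by (rule Ck_on_mult[OF open_upper _ Ck_on_linear[OF open_upper bounded_linear_Complex_nth]])
qed

lemma Ck_on_opposite: "open U \<Longrightarrow> Ck_on k q U \<Longrightarrow> Ck_on k (\<lambda>x. opposite s (q x)) U"
  unfolding opposite_def
  by (intro Ck_on_mult Ck_on_const Ck_on_bounded_linear[OF _ bounded_linear_cnj])

lemma Ck_on_subset: "Ck_on k f U \<Longrightarrow> V \<subseteq> U \<Longrightarrow> Ck_on k f V"
  by (induction k arbitrary: f) (auto intro: continuous_on_subset)

lemma smooth_on_sphere_lift: "smooth_on (sphere_lift s) (dom_sphere s)"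
proof -
  have op: "open (dom_sphere s)"
    unfolding dom_sphere_def using Ck_on_zeta
    by (intro open_slice_dom_preimage Ck_on_continuous_on[where k = 0] Ck_on_opposite open_upper)
  have z: "Ck_on k zeta (dom_sphere s)" for k
    by (rule Ck_on_subset[OF Ck_on_zeta]) (auto simp: dom_sphere_def)
  show ?thesis
    unfolding smooth_on_def sphere_lift_def[abs_def]
    by (intro conjI allI op Ck_on_slice Ck_on_opposite z) (simp add: dom_sphere_def)
qed

lemma local_lift_sphere:
  assumes "\<bar>s\<bar> = 1" "x \<in> S2" "- 1 < x $ 3"
  shows "local_lift (sphere_map s) x (dom_sphere s) (sphere_lift s)"
  unfolding local_lift_def
  using assms smooth_on_sphere_lift[of s] sphere_dom[OF assms]
  by (auto simp: smooth_on_def dom_sphere_def sphere_lift_def sphere_map_def slice_level_W)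

lemma sqrt_nth_has_derivative:
  assumes "- 1 < (x :: real ^ 3) $ 3"
  shows "((\<lambda>x. sqrt (1 + x $ 3)) has_derivative (\<lambda>v. v $ 3 / (2 * sqrt (1 + x $ 3)))) (at x)"
proof -
  have g: "((\<lambda>x::real^3. 1 + x $ 3) has_derivative (\<lambda>v. 0 + v $ 3)) (at x)"
    by (rule has_derivative_add[OF has_derivative_const
          bounded_linear_imp_has_derivative[OF bounded_linear_vec_nth]])
  have "(sqrt has_derivative (*) (inverse (sqrt (1 + x $ 3)) / 2)) (at (1 + x $ 3))"
  proof -
    have "0 < 1 + x $ 3" using assms by linarith
    from DERIV_real_sqrt[OF this] show ?thesis unfolding has_field_derivative_def .
  qed
  from has_derivative_compose[OF g this]
  have "((\<lambda>x. sqrt (1 + x $ 3)) has_derivative (\<lambda>v. inverse (sqrt (1 + x $ 3)) / 2 * (0 + v $ 3))) (at x)" .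
  moreover have "(\<lambda>v. inverse (sqrt (1 + x $ 3)) / 2 * (0 + v $ 3)) = (\<lambda>v :: real ^ 3. v $ 3 / (2 * sqrt (1 + x $ 3)))"
  proof
    fix v :: "real ^ 3"
    have "sqrt (1 + x $ 3) \<noteq> 0" using assms by simp
    then show "inverse (sqrt (1 + x $ 3)) / 2 * (0 + v $ 3) = v $ 3 / (2 * sqrt (1 + x $ 3))"
      by (simp only: add_0 inverse_eq_divide times_divide_eq_left divide_divide_eq_left mult_1
          mult.commute[of "sqrt (1 + x $ 3)" 2])
  qed
  ultimately show ?thesis by (simp only:)
qed

lemma zeta_has_derivative:
  assumes x: "- 1 < x $ 3" shows "(zeta has_derivative (\<lambda>v. dir_deriv v zeta x)) (at x)"
  by (rule Ck_on_has_derivative[OF Ck_on_zeta[of "Suc 0"]]) (simp add: x)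
lemma of_real_sqrt_nth_has_derivative:
  assumes x: "- 1 < (x::real^3) $ 3" shows  "((\<lambda>x. complex_of_real (sqrt (1 + x $ 3))) has_derivative
      (\<lambda>v. complex_of_real (v $ 3 / (2 * sqrt (1 + x $ 3))))) (at x)"
  by (rule bounded_linear.has_derivative[OF bounded_linear_of_real sqrt_nth_has_derivative[OF x]])
lemma zeta_root_has_derivative:
  assumes x: "- 1 < (x::real^3) $ 3" shows "((\<lambda>x. zeta x * complex_of_real (sqrt (1 + x $ 3))) has_derivative
    (\<lambda>v. complex_of_real (sqrt 3) * Complex (v $ 1) (v $ 2))) (at x)"
proof -
    have eq: "zeta y * complex_of_real (sqrt (1 + y $ 3)) = complex_of_real (sqrt 3) * Complex (y $ 1) (y $ 2)"
      if "y \<in> {y. - 1 < y $ 3}" for y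
    proof -
      have "complex_of_real (inverse (sqrt (1 + y $ 3))) * complex_of_real (sqrt (1 + y $ 3)) = 1"
        using that unfolding of_real_mult[symmetric] by simp
      then show ?thesis unfolding zeta_def of_real_mult by algebra
    qed
    have d: "((\<lambda>y::real^3. complex_of_real (sqrt 3) * Complex (y $ 1) (y $ 2)) has_derivative
          (\<lambda>v. complex_of_real (sqrt 3) * Complex (v $ 1) (v $ 2))) (at x)"
        by (rule has_derivative_mult_right)
          (rule bounded_linear_imp_has_derivative[OF bounded_linear_Complex_nth])
    have op: "open {y :: real ^ 3. - 1 < y $ 3}"
      by (intro open_Collect_less continuous_intros)
    have mem: "x \<in> {y. - 1 < y $ 3}" using x by simp
    show ?thesis
      by (rule has_derivative_transform_within_open[OF d op mem]) (rule eq[symmetric])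
qed
text \<open>The derivative of \<open>zeta\<close> in implicit form, from the identity
  \<open>zeta x * sqrt (1 + x\<^sub>3) = sqrt 3 * (x\<^sub>1 + i x\<^sub>2)\<close>.\<close>

lemma zeta_derivative_eq:
  assumes x: "- 1 < x $ 3"
  shows "dir_deriv v zeta x * complex_of_real (sqrt (1 + x $ 3)) + zeta x * complex_of_real (v $ 3 / (2 * sqrt (1 + x $ 3)))
      = complex_of_real (sqrt 3) * Complex (v $ 1) (v $ 2)"
proof -
  have "((\<lambda>x. zeta x * complex_of_real (sqrt (1 + x $ 3))) has_derivative
     (\<lambda>v. zeta x * complex_of_real (v $ 3 / (2 * sqrt (1 + x $ 3))) +
       dir_deriv v zeta x * complex_of_real (sqrt (1 + x $ 3)))) (at x)"
    by (rule has_derivative_mult[OF zeta_has_derivative[OF x] of_real_sqrt_nth_has_derivative[OF x]])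
  from has_derivative_unique[OF this zeta_root_has_derivative[OF x]]
  have "zeta x * complex_of_real (v $ 3 / (2 * sqrt (1 + x $ 3))) +
       dir_deriv v zeta x * complex_of_real (sqrt (1 + x $ 3)) = complex_of_real (sqrt 3) * Complex (v $ 1) (v $ 2)"
    by (rule fun_cong)
  then show ?thesis by (simp only: add.commute)
qed

lemma opposite_has_derivative:
  "(q has_derivative q') F \<Longrightarrow> ((\<lambda>x. opposite s (q x)) has_derivative (\<lambda>v. opposite s (q' v))) F"
  unfolding opposite_def
  by (intro has_derivative_mult_right bounded_linear.has_derivative[OF bounded_linear_cnj])

text \<open>By \<open>slice_immersive\<close> it is enough that \<open>zeta\<close> has no critical direction tangent to the sphere.  If its derivative along \<open>v\<close>
  vanishes, then \<open>(v\<^sub>1, v\<^sub>2)\<close> is the multiple \<open>k\<close> of \<open>(x\<^sub>1, x\<^sub>2)\<close> below, and orthogonality of \<open>v\<close> and \<open>x\<close>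
  leaves only \<open>v\<^sub>3 = 0\<close>.\<close>

lemma immersed_at_upper:
  assumes s: "\<bar>s\<bar> = 1" and x: "x \<in> S2" "- 1 < x $ 3"
  shows "immersed_at (sphere_map s) x"
  unfolding immersed_at_def
proof (intro exI conjI allI impI)
  show "local_lift (sphere_map s) x (dom_sphere s) (sphere_lift s)"
    by (rule local_lift_sphere[OF assms])
  fix v assume v: "x \<bullet> v = 0 \<and> frechet_derivative (sphere_lift s) (at x) v \<in> tangent_orbit (sphere_lift s x)"
  note z = zeta_has_derivative[OF x(2)] and eq = zeta_derivative_eq[OF x(2), of v]
  have "(sphere_lift s has_derivative frechet_derivative (sphere_lift s) (at x)) (at x)"
    using smooth_on_has_derivative[OF smooth_on_sphere_lift] sphere_dom[OF assms] x(2)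
    by (simp add: dom_sphere_def)
  then have "dir_deriv v zeta x = 0"
    using slice_immersive[OF opposite_has_derivative[OF z] z sphere_dom[OF assms]] v
    unfolding sphere_lift_def[abs_def] by blast
  define k where "k = v $ 3 / (2 * (1 + x $ 3))"
  have pos: "0 < 1 + x $ 3" using x(2) by simp
  have "zeta x * complex_of_real (v $ 3 / (2 * sqrt (1 + x $ 3))) =
      complex_of_real (sqrt 3) * (complex_of_real k * Complex (x $ 1) (x $ 2))"
  proof -
    have "sqrt 3 * inverse (sqrt (1 + x $ 3)) * (v $ 3 / (2 * sqrt (1 + x $ 3))) =
        sqrt 3 * (v $ 3 / (2 * (sqrt (1 + x $ 3) * sqrt (1 + x $ 3))))"
      by (simp only: inverse_eq_divide times_divide_eq_left times_divide_eq_right divide_divide_eq_left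
          mult_1 mult_1_right mult.assoc)
    also have "\<dots> = sqrt 3 * k" using pos by (simp add: k_def)
    finally have "complex_of_real (sqrt 3 * inverse (sqrt (1 + x $ 3))) * complex_of_real (v $ 3 / (2 * sqrt (1 + x $ 3)))
        = complex_of_real (sqrt 3) * complex_of_real k"
      unfolding of_real_mult[symmetric] by (simp only:)
    then show ?thesis unfolding zeta_def by algebra
  qed
  then have "Complex (v $ 1) (v $ 2) = complex_of_real k * Complex (x $ 1) (x $ 2)"
    using eq \<open>dir_deriv v zeta x = 0\<close> by simp
  then have v12: "v $ 1 = k * x $ 1" "v $ 2 = k * x $ 2" by (simp_all add: complex_eq_iff)
  have "x $ 1 * v $ 1 + x $ 2 * v $ 2 + x $ 3 * v $ 3 = 0"
    using v by (simp add: inner_vec_def sum_3)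
  moreover have "x $ 1 * v $ 1 + x $ 2 * v $ 2 = k * ((1 - x $ 3) * (1 + x $ 3))"
  proof -
    have "(x $ 1)\<^sup>2 + (x $ 2)\<^sup>2 = (1 - x $ 3) * (1 + x $ 3)"
      using x(1) unfolding S2_iff by (simp add: algebra_simps power2_eq_square)
    moreover have "x $ 1 * v $ 1 + x $ 2 * v $ 2 = k * ((x $ 1)\<^sup>2 + (x $ 2)\<^sup>2)"
      unfolding v12 by (simp add: algebra_simps power2_eq_square)
    ultimately show ?thesis by simp
  qed
  moreover have "k * ((1 - x $ 3) * (1 + x $ 3)) = v $ 3 * (1 - x $ 3) / 2"
  proof -
    have cancel: "a / (2 * u) * u = a / 2" if "0 < u" for a u :: real using that by simp
    have "k * (1 + x $ 3) = v $ 3 / 2" unfolding k_def by (rule cancel[OF pos])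
    then show ?thesis by (simp add: mult.assoc mult.left_commute[of k])
  qed
  ultimately have "v $ 3 * (1 + x $ 3) = 0" by (simp add: algebra_simps)
  then have "v $ 3 = 0" using pos by simp
  then show "v = 0" using v12 by (simp add: vec_eq_iff forall_3 k_def)
qed

lemma north: "north \<in> S2" "north $ 3 = 1" "(- north) \<in> S2" "(- north) $ 3 = - 1"
proof -
  show "north \<in> S2" "(- north) \<in> S2" by simp_all
  show "north $ 3 = 1" "(- north) $ 3 = - 1" by (simp_all add: axis_def)
qed

text \<open>Two points of the slice in the same orbit agree, so \<open>zeta\<close> and the value of \<open>opposite\<close> are
  determined by the image; the sign is lost only where \<open>zeta\<close> vanishes.\<close>

lemma sphere_map_eqD:
  assumes s: "\<bar>s\<bar> = 1" "\<bar>s'\<bar> = 1" and x: "x \<in> S2" "- 1 < x $ 3" and y: "y \<in> S2" "- 1 < y $ 3"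
    and eq: "sphere_map s x = sphere_map s' y"
  shows "x = y \<and> (s = s' \<or> x = north)"
proof -
  have "orbit (sphere_lift s x) = orbit (sphere_lift s' y)"
    using eq x y by (simp add: sphere_map_def)
  then have z: "opposite s (zeta x) = opposite s' (zeta y)" "zeta x = zeta y"
    unfolding sphere_lift_def
    using slice_orbit_inj[OF sphere_dom[OF s(1) x] sphere_dom[OF s(2) y]] by blast+
  have h: "x $ 3 = y $ 3" using cmod_zeta[OF x] cmod_zeta[OF y] z(2) by simp
  have "complex_of_real (sqrt 3 * inverse (sqrt (1 + y $ 3))) \<noteq> 0"
    using y(2) unfolding of_real_eq_0_iff by simp
  then have "Complex (x $ 1) (x $ 2) = Complex (y $ 1) (y $ 2)"
    using z(2) unfolding zeta_def h by (metis mult_left_cancel)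
  with h have "x = y" by (simp add: vec_eq_iff forall_3)
  moreover have "x = north" if "s \<noteq> s'"
  proof -
    have "(complex_of_real s - complex_of_real s') * (\<i> * cnj (zeta x)) = 0"
      using z unfolding opposite_def by (simp add: algebra_simps)
    then have "zeta x = 0" using that by simp
    then have "x $ 3 = 1" using cmod_zeta[OF x] by simp
    then show ?thesis using S2_pole[OF x(1)] by simp
  qed
  ultimately show ?thesis by blast
qed

lemma sphere_map_neq_B:
  assumes "\<bar>s\<bar> = 1" "x \<in> S2" "- 1 < x $ 3"
  shows "sphere_map s x \<noteq> point_B"
proof
  assume "sphere_map s x = point_B"
  then have "orbit (sphere_lift s x) = orbit (flip_H (slice 0 0))"
    using assms by (simp add: sphere_map_def point_B_eq point_A_eq flip_H.orbit_image)
  then obtain t where "flip_H (slice 0 0) = act t (sphere_lift s x)"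
    using orbit_eq_iff by blast
  then have "flip_H (slice 0 0) $ 3 = cis (phase t $ 3) * sphere_lift s x $ 3"
    by (simp add: act_nth)
  then have "(cmod (opposite s (zeta x)))\<^sup>2 = 6"
    by (simp add: flip_H_nth slice_nth sphere_lift_def)
  then show False using sphere_dom[OF assms] by (simp add: slice_dom_def)
qed

text \<open>At the south pole \<open>zeta\<close> takes the default value \<open>0\<close> and \<open>sphere_lift\<close> is no lift; there a lift is obtained
  from the other sphere at its north pole by \<open>flip_H\<close>.\<close>

lemma embedded_sphere_sphere_map:
  assumes s: "\<bar>s\<bar> = 1"
  shows "embedded_sphere (sphere_map s)"
  unfolding embedded_sphere_iff
proof (intro conjI ballI inj_onI)
  fix x y assume xy: "x \<in> S2" "y \<in> S2" and eq: "sphere_map s x = sphere_map s y"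
  have south: "sphere_map s z = point_B \<longleftrightarrow> z $ 3 = - 1" if "z \<in> S2" for z
    using sphere_map_neq_B[OF s that] S2_bounds(1)[OF that] by (auto simp: sphere_map_def)
  show "x = y"
  proof (cases "x $ 3 = - 1")
    case True
    then have "y $ 3 = - 1" using south[OF xy(1)] south[OF xy(2)] eq by simp
    then show ?thesis using True S2_pole[OF xy(1)] S2_pole[OF xy(2)] by simp
  next
    case False
    then have "y $ 3 \<noteq> - 1" using south[OF xy(1)] south[OF xy(2)] eq by simp
    then show ?thesis
      using False S2_bounds(1)[OF xy(1)] S2_bounds(1)[OF xy(2)]
        sphere_map_eqD[OF s s xy(1) _ xy(2) _ eq] by simp
  qed
next
  fix x assume x: "x \<in> S2"
  show "immersed_at (sphere_map s) x"
  proof (cases "x $ 3 = - 1")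
    case False
    then show ?thesis using immersed_at_upper[OF s x] S2_bounds(1)[OF x] by simp
  next
    case True
    have s': "\<bar>- s\<bar> = 1" using s by simp
    have x': "reflect x \<in> S2" "- 1 < reflect x $ 3"
      using flip_H.\<rho>_S2[of x] x True by (simp_all add: reflect_nth del: mem_sphere_0)
    have "immersed_at (\<lambda>y. flip_H ` sphere_map (- s) (reflect y)) x"
      using flip_H.immersed_at_image[OF immersed_at_upper[OF s' x']] by (simp add: reflect_reflect)
    moreover have "flip_H ` sphere_map (- s) (reflect y) = sphere_map s y" if "y \<in> S2" for y
      using flip_H_sphere_map[OF s' that] by simp
    ultimately show ?thesis using immersed_at_cong[of "\<lambda>y. flip_H ` sphere_map (- s) (reflect y)" "sphere_map s"]
      by simp
  qed
qed

lemma sphere_maps_meet: "sphere_map 1 ` S2 \<inter> sphere_map (- 1) ` S2 = {point_A, point_B}"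
proof (intro subset_antisym subsetI)
  fix p assume "p \<in> sphere_map 1 ` S2 \<inter> sphere_map (- 1) ` S2"
  then obtain x y where x: "x \<in> S2" "p = sphere_map 1 x" and y: "y \<in> S2" "p = sphere_map (- 1) y"
    by blast
  show "p \<in> {point_A, point_B}"
  proof (cases "x $ 3 = - 1 \<or> y $ 3 = - 1")
    case True
    then show ?thesis using x(2) y(2) by (auto simp: sphere_map_def)
  next
    case False
    then have "- 1 < x $ 3" "- 1 < y $ 3"
      using S2_bounds(1)[OF x(1)] S2_bounds(1)[OF y(1)] by linarith+
    then have "x = north"
      using sphere_map_eqD[of 1 "- 1" x y] x y by auto
    then show ?thesis using x(2) sphere_map_north by simp
  qed
next
  fix p assume p: "p \<in> {point_A, point_B}"
  have "sphere_map s north = point_A" "sphere_map s (- north) = point_B" for s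
    by (rule sphere_map_north) (simp add: sphere_map_def north(4))
  then show "p \<in> sphere_map 1 ` S2 \<inter> sphere_map (- 1) ` S2"
    using p north(1,3) by (metis IntI image_eqI insertE singletonD)
qed

text \<open>At \<open>A\<close> the tangent space of \<open>M\<close> is the space of the coordinates \<open>z\<^sub>7\<close> and \<open>z\<^sub>8\<close>, and the two
  spheres are tangent to the complementary totally real planes \<open>z\<^sub>7 = \<plusminus> i cnj z\<^sub>8\<close>.\<close>

lemma sphere_tangent_A:
  assumes s: "\<bar>s\<bar> = 1" and n: "n \<in> tangent_orbit (slice 0 0)"
  shows "vector [0, 0, 0, 0, 0, 0, opposite s w, w] + n \<in> sphere_tangent (sphere_map s) (slice 0 0)"
proof -
  \<comment> \<open>at the north pole the derivative of \<open>zeta\<close> is multiplication by \<open>sqrt 3 / sqrt 2\<close>\<close>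
  define v :: "real ^ 3" where "v = vector [sqrt 2 / sqrt 3 * Re w, sqrt 2 / sqrt 3 * Im w, 0]"
  have N: "north \<in> S2" "- 1 < north $ 3" using north by simp_all
  have zeta_N: "zeta north = 0" by (simp add: zeta_def axis_def flip: zero_complex.code)
  have "dir_deriv v zeta north * complex_of_real (sqrt 2) = complex_of_real (sqrt 3) * Complex (v $ 1) (v $ 2)"
    using zeta_derivative_eq[OF N(2), of v] unfolding zeta_N north(2) by simp
  also have "\<dots> = w * complex_of_real (sqrt 2)"
  proof -
    have "sqrt 3 * (sqrt 2 / sqrt 3 * a) = a * sqrt 2" for a by simp
    then show ?thesis by (simp only: complex_eq_iff v_def vector_3 times_complex.sel complex.sel
          Re_complex_of_real Im_complex_of_real mult_zero_left mult_zero_right diff_zero add_0 add_0_right)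
  qed
  finally have w: "dir_deriv v zeta north = w" by simp
  have centre: "opposite s (zeta north) = 0" by (simp only: zeta_N opposite_simps(2))
  note d = zeta_has_derivative[OF N(2)]
  note lift = slice_has_derivative_centre[OF opposite_has_derivative[OF d] d centre zeta_N]
  have "frechet_derivative (sphere_lift s) (at north) =
      (\<lambda>v. vector [0, 0, 0, 0, 0, 0, opposite s (dir_deriv v zeta north), dir_deriv v zeta north])"
    unfolding sphere_lift_def[abs_def] by (rule frechet_derivative_at[OF lift, symmetric])
  then have "frechet_derivative (sphere_lift s) (at north) v = vector [0, 0, 0, 0, 0, 0, opposite s w, w]"
    by (simp only: w)
  then have "vector [0, 0, 0, 0, 0, 0, opposite s w, w] + n = frechet_derivative (sphere_lift s) (at north) v + n"
    by (simp only:)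
  moreover have "sphere_lift s north = slice 0 0" by (simp only: sphere_lift_def zeta_N opposite_simps(2))
  moreover have "north \<bullet> v = 0" by (simp add: inner_axis' v_def vector_3)
  ultimately show ?thesis
    unfolding sphere_tangent_def
    using local_lift_sphere[OF s N] N(1) n
    by (intro CollectI exI[of _ "dom_sphere s"] exI[of _ "sphere_lift s"] exI[of _ north] exI[of _ v]
        exI[of _ n] conjI)
qed

lemma tangent_W_A:
  assumes w: "w \<in> tangent_W (slice 0 0)"
  shows "w - vector [0, 0, 0, 0, 0, 0, w $ 7, w $ 8] \<in> tangent_orbit (slice 0 0)"
proof -
  have re: "Re (w $ 1) = 0" "Re (w $ 2) = 0" "Re (w $ 3) = 0" "Re (w $ 4) = 0" "Re (w $ 5) = 0" "Re (w $ 6) = 0"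
    using w unfolding tangent_W_iff by (auto simp: slice_nth inner_complex_def)
  define f where "f k = Im (w $ k) / Re (slice 0 0 $ k)" for k
  define \<theta> :: "real ^ 6" where
    "\<theta> = vector [f 1, f 2, f 3, f 4, f 6, f 5 - f 1 - f 2 + f 4 + f 6]"
  have "w - vector [0, 0, 0, 0, 0, 0, w $ 7, w $ 8] = inf_act \<theta> (slice 0 0)"
    unfolding vec_eq_iff forall_8
    by (simp add: inf_act_def phase_nth \<theta>_def vector_6 f_def slice_nth complex_eq_iff re)
  then show ?thesis unfolding tangent_orbit_eq by blast
qed

lemma spans_tangent_W_A: "spans_tangent_W (sphere_map 1) (sphere_map (- 1)) (slice 0 0)"
  unfolding spans_tangent_W_def
proof
  fix w assume w: "w \<in> tangent_W (slice 0 0)"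
  define n where "n = w - vector [0, 0, 0, 0, 0, 0, w $ 7, w $ 8]"
  \<comment> \<open>the solution of \<open>a + b = w\<^sub>8\<close> and \<open>i cnj a - i cnj b = w\<^sub>7\<close>\<close>
  define a b where "a = (w $ 8 + \<i> * cnj (w $ 7)) / 2" and "b = (w $ 8 - \<i> * cnj (w $ 7)) / 2"
  have "w $ 7 = opposite 1 a + opposite (- 1) b" "w $ 8 = a + b"
    by (simp_all add: a_def b_def opposite_def complex_eq_iff field_simps)
  then have "w = (vector [0, 0, 0, 0, 0, 0, opposite 1 a, a] + n) + (vector [0, 0, 0, 0, 0, 0, opposite (- 1) b, b] + 0)"
    unfolding vec_eq_iff forall_8 by (simp add: n_def vector_8)
  moreover have "0 \<in> tangent_orbit (slice 0 0)"
    unfolding tangent_orbit_eq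
    by (intro range_eqI[of _ _ 0]) (simp add: inf_act_def vec_eq_iff forall_8 phase_nth)
  ultimately show "\<exists>u\<in>sphere_tangent (sphere_map 1) (slice 0 0).
      \<exists>v\<in>sphere_tangent (sphere_map (- 1)) (slice 0 0). w = u + v"
    using sphere_tangent_A[of 1 n a] sphere_tangent_A[of "- 1" 0 b] tangent_W_A[OF w, folded n_def]
    by (metis abs_1 abs_minus_cancel)
qed

text \<open>The symmetry \<open>flip_H\<close> exchanges the two spheres and the two points.\<close>

lemma spans_tangent_W_B: "spans_tangent_W (sphere_map 1) (sphere_map (- 1)) (flip_H (slice 0 0))"
proof -
  have *: "flip_H ` sphere_map s (reflect y) = sphere_map (- s) y" if "y \<in> S2" "\<bar>s\<bar> = 1" for y s
    using flip_H_sphere_map that by blast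
  have cong: "sphere_tangent (\<lambda>y. flip_H ` sphere_map 1 (reflect y)) = sphere_tangent (sphere_map (- 1))"
    "sphere_tangent (\<lambda>y. flip_H ` sphere_map (- 1) (reflect y)) = sphere_tangent (sphere_map 1)"
    by (rule sphere_tangent_cong, use * in force)+
  show ?thesis
    using flip_H.spans_tangent_W_image[OF spans_tangent_W_A]
    unfolding spans_tangent_W_def cong by (metis add.commute)
qed

lemma sphere_map_quot_M:
  assumes "\<bar>s\<bar> = 1"
  shows "sphere_map s ` S2 \<subseteq> quot_M"
proof
  have A: "slice 0 0 \<in> level_W" by (rule slice_level_W) (simp add: slice_dom_def)
  fix p assume "p \<in> sphere_map s ` S2"
  then obtain x where x: "x \<in> S2" "p = sphere_map s x" by blast
  show "p \<in> quot_M"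
  proof (cases "x $ 3 = - 1")
    case True
    then have "p = orbit (flip_H (slice 0 0))"
      using x by (simp add: sphere_map_def point_B_eq point_A_eq flip_H.orbit_image)
    then show ?thesis unfolding quot_M_def using A flip_H.level_W_preserved by blast
  next
    case False
    then have "(opposite s (zeta x), zeta x) \<in> slice_dom" "p = orbit (sphere_lift s x)"
      using sphere_dom[OF assms x(1)] S2_bounds(1)[OF x(1)] x(2) by (auto simp: sphere_map_def)
    then show ?thesis unfolding quot_M_def sphere_lift_def using slice_level_W by blast
  qed
qed

lemma double_pinched_torus_AB:
  "double_pinched_torus (sphere_map 1 ` S2 \<union> sphere_map (- 1) ` S2) point_A point_B"
  unfolding double_pinched_torus_def
proof (intro conjI exI)
  show "point_A \<noteq> point_B" using sphere_map_neq_B[of 1 north, OF _ north(1)] sphere_map_north[of 1] north(2) by simp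
  show "transverse_at point_A (sphere_map 1) (sphere_map (- 1))"
    unfolding point_A_eq by (intro transverse_atI spans_tangent_W_A sphere_map_quot_M) simp_all
  show "transverse_at point_B (sphere_map 1) (sphere_map (- 1))"
    unfolding point_B_eq point_A_eq flip_H.orbit_image[symmetric]
    by (intro transverse_atI spans_tangent_W_B sphere_map_quot_M) simp_all
qed (simp_all add: embedded_sphere_sphere_map sphere_maps_meet)

text \<open>Transport by \<open>flip_J\<close>, which sends \<open>A\<close> and \<open>B\<close> to \<open>C\<close> and \<open>D\<close>.\<close>

lemma double_pinched_torus_CD:
  "double_pinched_torus ((`) flip_J ` (sphere_map 1 ` S2 \<union> sphere_map (- 1) ` S2)) point_C point_D"
proof -
  interpret fJ: sphere_symmetry flip_J "\<lambda>x. x"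
    by (intro sphere_symmetry_id flip_J.torus_symmetry_axioms)
  define e where "e s x = flip_J ` sphere_map s x" for s x
  have e_fun: "e s = (\<lambda>x. flip_J ` sphere_map s x)" for s by (rule ext) (rule e_def)
  have e_image: "e s ` S2 = (`) flip_J ` sphere_map s ` S2" for s
    unfolding e_fun by (rule image_image[of "(`) flip_J" "sphere_map s" S2, symmetric])
  have emb: "embedded_sphere (e s)" if "\<bar>s\<bar> = 1" for s
  proof -
    have "inj_on (e s) S2"
    proof (rule inj_onI)
      fix x y assume xy: "x \<in> S2" "y \<in> S2" and eq: "e s x = e s y"
      have "sphere_map s x = sphere_map s y" using eq unfolding e_def by (rule injD[OF flip_J.inj_image])
      then show "x = y"
        using embedded_sphere_sphere_map[OF that] xy unfolding embedded_sphere_iff by (blast dest: inj_onD)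
    qed
    moreover have "immersed_at (e s) x" if "immersed_at (sphere_map s) x" for x
      using fJ.immersed_at_image[OF that] unfolding e_fun .
    ultimately show ?thesis
      using embedded_sphere_sphere_map[OF that] unfolding embedded_sphere_iff by blast
  qed
  have quot: "e s ` S2 \<subseteq> quot_M" if s: "\<bar>s\<bar> = 1" for s
  proof
    fix p assume "p \<in> e s ` S2"
    then obtain x where x: "x \<in> S2" "p = flip_J ` sphere_map s x" unfolding e_fun by (rule imageE)
    have "sphere_map s x \<in> quot_M" using sphere_map_quot_M[OF s] x(1) by (rule subsetD[OF _ imageI])
    then obtain z where z: "z \<in> level_W" "sphere_map s x = orbit z" unfolding quot_M_def by (rule imageE)
    have "p = orbit (flip_J z)" unfolding x(2) z(2) flip_J.orbit_image ..
    then show "p \<in> quot_M" unfolding quot_M_def using z(1) flip_J.level_W_preserved by (metis imageI)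
  qed
  have span: "spans_tangent_W (e 1) (e (- 1)) (flip_J z)"
    if "spans_tangent_W (sphere_map 1) (sphere_map (- 1)) z" for z
    using fJ.spans_tangent_W_image[OF that] unfolding e_fun .
  show ?thesis
    unfolding double_pinched_torus_def
  proof (intro conjI exI)
    show "point_C \<noteq> point_D"
      using double_pinched_torus_AB
      unfolding point_C_eq point_D_eq double_pinched_torus_def inj_eq[OF flip_J.inj_image] by (rule conjunct1)
    show "(`) flip_J ` (sphere_map 1 ` S2 \<union> sphere_map (- 1) ` S2) = e 1 ` S2 \<union> e (- 1) ` S2"
      by (simp only: e_image image_Un)
    have "e 1 ` S2 \<inter> e (- 1) ` S2 = (`) flip_J ` (sphere_map 1 ` S2 \<inter> sphere_map (- 1) ` S2)"
      by (simp only: e_image image_Int[OF flip_J.inj_image])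
    then show "e 1 ` S2 \<inter> e (- 1) ` S2 = {point_C, point_D}"
      by (simp only: sphere_maps_meet point_C_eq point_D_eq image_insert image_empty)
    show "transverse_at point_C (e 1) (e (- 1))"
      unfolding point_C_eq point_A_eq flip_J.orbit_image[symmetric]
      by (intro transverse_atI span spans_tangent_W_A quot) simp_all
    show "transverse_at point_D (e 1) (e (- 1))"
      unfolding point_D_eq point_B_eq point_A_eq flip_H.orbit_image[symmetric] flip_J.orbit_image[symmetric]
      by (intro transverse_atI span spans_tangent_W_B quot) simp_all
    show "embedded_sphere (e 1)" "embedded_sphere (e (- 1))" by (rule emb, simp)+
  qed
qed

section \<open>The fibres\<close>

text \<open>The coordinates \<open>z\<^sub>7 = z\<^sub>8 = 0\<close> leave no freedom for the other moduli, so they single out the point \<open>A\<close>;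
  by symmetry \<open>z\<^sub>2 = z\<^sub>3 = 0\<close> single out \<open>B\<close>.  In particular the circle \<open>\<bar>q\<bar> = sqrt 6\<close> collapses to \<open>B\<close>.\<close>

lemma level_W_A:
  assumes z: "z \<in> level_W" "z $ 7 = 0" "z $ 8 = 0"
  shows "orbit z = point_A"
proof -
  have "(cmod (z $ 5))\<^sup>2 = 4" "(cmod (z $ 1))\<^sup>2 = 2" "(cmod (z $ 2))\<^sup>2 = 6" "(cmod (z $ 3))\<^sup>2 = 6"
    "(cmod (z $ 4))\<^sup>2 = 8" "(cmod (z $ 6))\<^sup>2 = 2"
    using z by (auto simp: level_W_iff)
  then have "z $ k \<noteq> 0" if "k \<in> {1, 2, 3, 4, 5, 6}" for k
    using that by auto
  then obtain p q where "orbit z = orbit (slice p q)" "cmod p = cmod (z $ 7)" "cmod q = cmod (z $ 8)"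
    using slice_reaches[OF z(1)] by metis
  then show ?thesis using z by (simp add: point_A_eq)
qed

lemma level_W_B:
  assumes z: "z \<in> level_W" "z $ 2 = 0" "z $ 3 = 0"
  shows "orbit z = point_B"
proof -
  have "orbit (flip_H z) = point_A"
    using z by (intro level_W_A) (simp_all add: flip_H.level_W_preserved flip_H_nth)
  then have "point_B = flip_H ` flip_H ` orbit z"
    by (simp add: point_B_eq flip_H.orbit_image)
  then show ?thesis by (simp add: image_image flip_H_flip_H)
qed

lemma slice_rim:
  assumes "\<bar>s\<bar> = 1" "cmod q = sqrt 6"
  shows "orbit (slice (opposite s q) q) = point_B"
  by (rule level_W_B) (use assms in \<open>simp_all add: level_W_iff slice_nth opposite_simps\<close>)

text \<open>The number \<open>u = p q / \<bar>q\<bar>\<^sup>2\<close> is purely imaginary of modulus one, hence \<open>\<plusminus> i\<close>.\<close>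

lemma opposite_ex:
  assumes "cmod p = cmod q" "Re (p * q) = 0"
  obtains s where "\<bar>s\<bar> = 1" "p = opposite s q"
proof (cases "q = 0")
  case True
  then show ?thesis using that[of 1] assms(1) by (simp add: opposite_simps)
next
  case False
  define u where "u = p * q / complex_of_real ((cmod q)\<^sup>2)"
  have "cmod u = 1" using False assms(1) by (simp add: u_def norm_mult norm_divide power2_eq_square)
  moreover have "Re u = 0" using assms(2) by (simp add: u_def Re_divide_of_real del: of_real_power)
  ultimately have "\<bar>Im u\<bar> = 1" by (simp add: cmod_def)
  moreover have "u = complex_of_real (Im u) * \<i>" using \<open>Re u = 0\<close> by (simp add: complex_eq_iff)
  moreover have "p = u * cnj q"
  proof -
    have "u * cnj q = p * (q * cnj q) / complex_of_real ((cmod q)\<^sup>2)" by (simp add: u_def)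
    also have "q * cnj q = complex_of_real ((cmod q)\<^sup>2)" by (rule complex_norm_square[symmetric])
    finally show ?thesis using False by simp
  qed
  ultimately show ?thesis using that[of "Im u"] unfolding opposite_def by metis
qed

definition slice_fibre :: "(complex ^ 8) set set" where
  "slice_fibre = {orbit (slice (opposite s q) q) | s q. \<bar>s\<bar> = 1 \<and> cmod q \<le> sqrt 6}"

lemma cmod_square_less_6: "cmod q < sqrt 6 \<Longrightarrow> (cmod q)\<^sup>2 < 6"
  using power_strict_mono[of "cmod q" "sqrt 6" 2] by simp

text \<open>The value \<open>J = 1\<close> forces \<open>\<bar>z\<^sub>7\<bar> = \<bar>z\<^sub>8\<bar>\<close>, and \<open>X = 0\<close> makes the product of \<open>z\<^sub>7\<close> and \<open>z\<^sub>8\<close>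
  purely imaginary once the other coordinates are positive.  This fails only for \<open>z\<^sub>3 = 0\<close>, which is the point \<open>B\<close>.\<close>

lemma fibre_eq_slice_fibre:
  assumes "0 < \<gamma>"
  shows "fibre (fn_F \<gamma> (1 / 2)) (1, 0) = slice_fibre"
proof (intro subset_antisym subsetI)
  fix p assume "p \<in> fibre (fn_F \<gamma> (1 / 2)) (1, 0)"
  then obtain z where z: "z \<in> level_W" "p = orbit z" and J: "fn_J p = 1" and X: "fn_X p = 0"
    using assms by (auto simp: fibre_def quot_M_def fn_F_half)
  have "(cmod (z $ 1))\<^sup>2 = 2" using J z(2) by (simp add: fn_J_orbit)
  then have sq: "(cmod (z $ 1))\<^sup>2 = 2" "(cmod (z $ 5))\<^sup>2 = 4" "(cmod (z $ 2))\<^sup>2 = (cmod (z $ 3))\<^sup>2"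
    "(cmod (z $ 7))\<^sup>2 = (cmod (z $ 8))\<^sup>2" "(cmod (z $ 4))\<^sup>2 = 2 + (cmod (z $ 3))\<^sup>2"
    "(cmod (z $ 6))\<^sup>2 = 2 + (cmod (z $ 7))\<^sup>2" "(cmod (z $ 7))\<^sup>2 = 6 - (cmod (z $ 3))\<^sup>2"
    using z(1) unfolding level_W_iff by linarith+
  have pos: "0 < 2 + (cmod (z $ 3))\<^sup>2" "0 < 2 + (cmod (z $ 7))\<^sup>2" by (simp_all add: add_pos_nonneg)
  show "p \<in> slice_fibre"
  proof (cases "z $ 3 = 0")
    case True
    then have "z $ 2 = 0" using sq(3) by simp
    then have "p = point_B" using level_W_B[OF z(1) _ True] z(2) by simp
    then have "p = orbit (slice (opposite 1 (sqrt 6)) (sqrt 6))" by (simp add: slice_rim)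
    moreover have "cmod (complex_of_real (sqrt 6)) \<le> sqrt 6" "\<bar>1 :: real\<bar> = 1" by simp_all
    ultimately show ?thesis unfolding slice_fibre_def by blast
  next
    case False
    have "z $ 1 \<noteq> 0" "z $ 2 \<noteq> 0" "z $ 4 \<noteq> 0" "z $ 5 \<noteq> 0" "z $ 6 \<noteq> 0"
      using sq pos False by auto
    then have "z $ k \<noteq> 0" if "k \<in> {1, 2, 3, 4, 5, 6}" for k using that False by auto
    then obtain a q where dom: "(a, q) \<in> slice_dom" and eq: "p = orbit (slice a q)"
      and norms: "cmod a = cmod (z $ 7)" "cmod q = cmod (z $ 8)"
      using slice_reaches[OF z(1)] z(2) by metis
    have "cmod a = cmod q" using sq(4) norms by (simp add: power2_eq_iff_nonneg)
    moreover have "Re (a * q) = 0"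
      using X dom unfolding eq fn_X_slice by (simp add: slice_dom_def)
    ultimately obtain s where s: "\<bar>s\<bar> = 1" "a = opposite s q" by (rule opposite_ex)
    have "(cmod q)\<^sup>2 \<le> 6"
      unfolding norms using sq(4,7) zero_le_power2[of "cmod (z $ 3)"] by linarith
    then have "cmod q \<le> sqrt 6" by (rule real_le_rsqrt)
    then show ?thesis unfolding slice_fibre_def eq using s by blast
  qed
next
  fix p assume "p \<in> slice_fibre"
  then obtain s q where p: "p = orbit (slice (opposite s q) q)" and s: "\<bar>s\<bar> = 1" and q: "cmod q \<le> sqrt 6"
    unfolding slice_fibre_def by blast
  have "(cmod q)\<^sup>2 \<le> 6" using power_mono[OF q, of 2] by simp
  then have "slice (opposite s q) q \<in> level_W"
    using s by (simp add: level_W_iff slice_nth opposite_simps)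
  moreover have "fn_J p = 1" by (simp add: p fn_J_orbit slice_nth opposite_simps s)
  moreover have "fn_X p = 0" by (simp add: p fn_X_slice opposite_simps del: times_complex.sel)
  ultimately show "p \<in> fibre (fn_F \<gamma> (1 / 2)) (1, 0)"
    by (auto simp: fibre_def quot_M_def fn_F_half p)
qed

lemma zeta_surj:
  assumes "cmod q < sqrt 6"
  obtains x where "x \<in> S2" "- 1 < x $ 3" "zeta x = q"
proof -
  define h where "h = 1 - (cmod q)\<^sup>2 / 3"
  define c where "c = inverse (sqrt 3 * inverse (sqrt (1 + h)))"
  define x :: "real ^ 3" where "x = vector [c * Re q, c * Im q, h]"
  have h: "- 1 < h" using cmod_square_less_6[OF assms] by (simp add: h_def)
  have x: "x $ 1 = c * Re q" "x $ 2 = c * Im q" "x $ 3 = h" by (simp_all add: x_def vector_3)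
  have c_square: "c\<^sup>2 = (1 + h) / 3" using h by (simp add: c_def power_mult_distrib power_inverse)
  have "(x $ 1)\<^sup>2 + (x $ 2)\<^sup>2 + (x $ 3)\<^sup>2 = (1 + h) / 3 * (cmod q)\<^sup>2 + h\<^sup>2"
    unfolding x power_mult_distrib cmod_power2 c_square by (simp only: distrib_left)
  also have "(cmod q)\<^sup>2 = 3 * (1 - h)" by (simp add: h_def)
  also have "(1 + h) / 3 * (3 * (1 - h)) + h\<^sup>2 = 1" by (simp add: power2_eq_square field_simps)
  finally have "x \<in> S2" unfolding S2_iff .
  moreover have "- 1 < x $ 3" using h x by simp
  moreover have "zeta x = q"
  proof -
    have c: "(sqrt 3 * inverse (sqrt (1 + h))) * c = 1"
      unfolding c_def using h by (intro right_inverse) simp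
    have "Complex (c * Re q) (c * Im q) = complex_of_real c * q" by (simp add: complex_eq_iff)
    then have "zeta x = complex_of_real ((sqrt 3 * inverse (sqrt (1 + h))) * c) * q"
      unfolding zeta_def x by (simp only: of_real_mult mult.assoc)
    then show ?thesis unfolding c by simp
  qed
  ultimately show ?thesis by (rule that)
qed

lemma slice_fibre_eq_spheres: "slice_fibre = sphere_map 1 ` S2 \<union> sphere_map (- 1) ` S2"
proof (intro subset_antisym subsetI)
  fix p assume "p \<in> slice_fibre"
  then obtain s q where p: "p = orbit (slice (opposite s q) q)" and s: "\<bar>s\<bar> = 1" and q: "cmod q \<le> sqrt 6"
    unfolding slice_fibre_def by blast
  have "p \<in> sphere_map s ` S2"
  proof (cases "cmod q = sqrt 6")
    case True
    then have "p = sphere_map s (- north)" using slice_rim[OF s] p by (simp add: sphere_map_def north(4))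
    then show ?thesis using north(3) by blast
  next
    case False
    then obtain x where x: "x \<in> S2" "- 1 < x $ 3" "zeta x = q" using q zeta_surj[of q] by (metis less_eq_real_def)
    then have "p = sphere_map s x" by (simp add: sphere_map_def sphere_lift_def p)
    then show ?thesis using x(1) by blast
  qed
  moreover have "s = 1 \<or> s = - 1" using s by (auto simp: abs_if split: if_splits)
  ultimately show "p \<in> sphere_map 1 ` S2 \<union> sphere_map (- 1) ` S2" by blast
next
  fix p assume "p \<in> sphere_map 1 ` S2 \<union> sphere_map (- 1) ` S2"
  then obtain s x where s: "\<bar>s\<bar> = 1" and x: "x \<in> S2" "p = sphere_map s x"
    by (metis UnE abs_1 abs_minus_cancel imageE)
  obtain q where "p = orbit (slice (opposite s q) q)" "cmod q \<le> sqrt 6"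
  proof (cases "x $ 3 = - 1")
    case True
    then show ?thesis
      using that[of "complex_of_real (sqrt 6)"] slice_rim[OF s] x(2) by (simp add: sphere_map_def)
  next
    case False
    then have "(cmod (zeta x))\<^sup>2 \<le> 6"
      using cmod_zeta[OF x(1)] S2_bounds[OF x(1)] by simp
    then have "cmod (zeta x) \<le> sqrt 6" by (rule real_le_rsqrt)
    then show ?thesis using that[of "zeta x"] False x(2) by (simp add: sphere_map_def sphere_lift_def)
  qed
  then show "p \<in> slice_fibre" unfolding slice_fibre_def using s by blast
qed

text \<open>The involution \<open>flip_J\<close> replaces \<open>J\<close> by \<open>3 - J\<close> and preserves \<open>X\<close>.\<close>

lemma fibre_flip_J: "fibre (fn_F \<gamma> (1 / 2)) (2, 0) = (`) flip_J ` fibre (fn_F \<gamma> (1 / 2)) (1, 0)"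
proof -
  have step: "flip_J ` p \<in> fibre (fn_F \<gamma> (1 / 2)) (3 - c, 0)" if "p \<in> fibre (fn_F \<gamma> (1 / 2)) (c, 0)" for p c
  proof -
    have "p \<in> quot_M" and F: "fn_F \<gamma> (1 / 2) p = (c, 0)" using that by (simp_all add: fibre_def)
    then obtain z where z: "z \<in> level_W" "p = orbit z" unfolding quot_M_def by (auto elim: imageE)
    have "flip_J ` p \<in> quot_M"
      unfolding quot_M_def z(2) flip_J.orbit_image[symmetric] using z(1) flip_J.level_W_preserved by blast
    then show ?thesis using F z by (simp add: fibre_def fn_F_half fn_J_flip fn_X_flip)
  qed
  have "flip_J (flip_J z) = z" for z by (simp add: vec_eq_iff forall_8 flip_J_nth)
  then have inv: "flip_J ` flip_J ` p = p" for p by (simp add: image_image)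
  show ?thesis
  proof (intro subset_antisym subsetI)
    fix p assume "p \<in> fibre (fn_F \<gamma> (1 / 2)) (2, 0)"
    then have "flip_J ` p \<in> fibre (fn_F \<gamma> (1 / 2)) (1, 0)" using step[of p 2] by simp
    then show "p \<in> (`) flip_J ` fibre (fn_F \<gamma> (1 / 2)) (1, 0)" using inv[of p] by blast
  qed (use step[of _ 1] in auto)
qed

lemma pt_eq_slice:
  assumes "s \<in> {1, - 1 :: complex}" "cmod q = r"
  shows "pt [sqrt 2, sqrt (6 - r\<^sup>2), sqrt (6 - r\<^sup>2), sqrt (8 - r\<^sup>2), 2, sqrt (2 + r\<^sup>2), s * \<i> * cnj q, q] =
    orbit (slice (opposite (Re s) q) q)"
  unfolding pt_def
  by (rule arg_cong[of _ _ orbit])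
    (use assms in \<open>auto simp: vec_eq_iff forall_8 vector_8 slice_nth opposite_def norm_mult\<close>)

lemma slice_fibre_subset_quot_M: "slice_fibre \<subseteq> quot_M"
  using fibre_eq_slice_fibre[of 1] by (auto simp: fibre_def)

lemma slice_fibre_eq_pt:
  "slice_fibre = {p \<in> quot_M. \<exists>z8 :: complex. \<exists>s \<in> {1, - 1 :: complex}. cmod z8 \<in> {0..sqrt 6} \<and>
          p = pt [sqrt 2, sqrt (6 - (cmod z8)\<^sup>2), sqrt (6 - (cmod z8)\<^sup>2), sqrt (8 - (cmod z8)\<^sup>2),
                  2, sqrt (2 + (cmod z8)\<^sup>2), s * \<i> * cnj z8, z8]}"
proof (intro subset_antisym subsetI)
  fix p assume p: "p \<in> slice_fibre"
  then obtain s q where eq: "p = orbit (slice (opposite s q) q)" and s: "\<bar>s\<bar> = 1" and q: "cmod q \<le> sqrt 6"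
    unfolding slice_fibre_def by blast
  have "complex_of_real s \<in> {1, - 1}" using s by (auto simp: abs_if split: if_splits)
  then show "p \<in> {p \<in> quot_M. \<exists>z8 :: complex. \<exists>s \<in> {1, - 1 :: complex}. cmod z8 \<in> {0..sqrt 6} \<and>
          p = pt [sqrt 2, sqrt (6 - (cmod z8)\<^sup>2), sqrt (6 - (cmod z8)\<^sup>2), sqrt (8 - (cmod z8)\<^sup>2),
                  2, sqrt (2 + (cmod z8)\<^sup>2), s * \<i> * cnj z8, z8]}"
    using p slice_fibre_subset_quot_M pt_eq_slice[of "complex_of_real s" q "cmod q"] eq q
    by (intro CollectI conjI exI[of _ q] bexI[of _ "complex_of_real s"]) auto
next
  fix p assume "p \<in> {p \<in> quot_M. \<exists>z8 :: complex. \<exists>s \<in> {1, - 1 :: complex}. cmod z8 \<in> {0..sqrt 6} \<and>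
          p = pt [sqrt 2, sqrt (6 - (cmod z8)\<^sup>2), sqrt (6 - (cmod z8)\<^sup>2), sqrt (8 - (cmod z8)\<^sup>2),
                  2, sqrt (2 + (cmod z8)\<^sup>2), s * \<i> * cnj z8, z8]}"
  then obtain q s where s: "s \<in> {1, - 1 :: complex}" and q: "cmod q \<in> {0..sqrt 6}" and
    p: "p = pt [sqrt 2, sqrt (6 - (cmod q)\<^sup>2), sqrt (6 - (cmod q)\<^sup>2), sqrt (8 - (cmod q)\<^sup>2),
                  2, sqrt (2 + (cmod q)\<^sup>2), s * \<i> * cnj q, q]"
    by blast
  have "\<bar>Re s\<bar> = 1" "cmod q \<le> sqrt 6" using s q by auto
  then show "p \<in> slice_fibre" unfolding slice_fibre_def p pt_eq_slice[OF s refl] by blast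
qed

lemma slice_fibre_eq_polar:
  "slice_fibre = {p \<in> quot_M. \<exists>\<theta> \<in> {0..<2 * pi}. \<exists>r \<in> {0..sqrt 6}. \<exists>s \<in> {1, - 1 :: complex}.
          p = pt [sqrt 2, sqrt (6 - r\<^sup>2), sqrt (6 - r\<^sup>2), sqrt (8 - r\<^sup>2),
                  2, sqrt (2 + r\<^sup>2), s * r * \<i> * exp (- \<i> * \<theta>), r * exp (\<i> * \<theta>)]}"
  (is "_ = {p \<in> quot_M. \<exists>\<theta> \<in> {0..<2 * pi}. \<exists>r \<in> {0..sqrt 6}. \<exists>s \<in> {1, - 1}. p = ?pt \<theta> r s}")
proof -
  have polar: "?pt \<theta> r s = orbit (slice (opposite (Re s) (r * exp (\<i> * \<theta>))) (r * exp (\<i> * \<theta>)))"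
    if "0 \<le> r" "s \<in> {1, - 1}" for \<theta> r :: real and s :: complex
  proof -
    have eq: "s * complex_of_real r * \<i> * exp (- \<i> * complex_of_real \<theta>) = s * \<i> * cnj (complex_of_real r * exp (\<i> * complex_of_real \<theta>))"
      by (simp add: exp_cnj)
    have "cmod (r * exp (\<i> * \<theta>)) = r" using that(1) by (simp add: norm_mult)
    then show ?thesis unfolding eq by (rule pt_eq_slice[OF that(2)])
  qed
  show ?thesis
  proof (intro subset_antisym subsetI)
    fix p assume p: "p \<in> slice_fibre"
    then obtain s q where eq: "p = orbit (slice (opposite s q) q)" and s: "\<bar>s\<bar> = 1" and q: "cmod q \<le> sqrt 6"
      unfolding slice_fibre_def by blast
    have s': "complex_of_real s \<in> {1, - 1}" using s by (auto simp: abs_if split: if_splits)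
    have "q = complex_of_real (cmod q) * exp (\<i> * complex_of_real (Arg2pi q))" by (rule Arg2pi_eq)
    then have "p = ?pt (Arg2pi q) (cmod q) (complex_of_real s)"
      using polar[OF norm_ge_zero s', of q "Arg2pi q"] eq by simp
    moreover have "Arg2pi q \<in> {0..<2 * pi}" "cmod q \<in> {0..sqrt 6}"
      using Arg2pi_ge_0 Arg2pi_lt_2pi q by auto
    ultimately show "p \<in> {p \<in> quot_M. \<exists>\<theta> \<in> {0..<2 * pi}. \<exists>r \<in> {0..sqrt 6}. \<exists>s \<in> {1, - 1}. p = ?pt \<theta> r s}"
      using p slice_fibre_subset_quot_M s' by blast
  next
    fix p assume "p \<in> {p \<in> quot_M. \<exists>\<theta> \<in> {0..<2 * pi}. \<exists>r \<in> {0..sqrt 6}. \<exists>s \<in> {1, - 1}. p = ?pt \<theta> r s}"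
    then obtain \<theta> r s where r: "r \<in> {0..sqrt 6}" and s: "s \<in> {1, - 1 :: complex}" and "p = ?pt \<theta> r s"
      by blast
    then have "p = orbit (slice (opposite (Re s) (r * exp (\<i> * \<theta>))) (r * exp (\<i> * \<theta>)))"
      using polar[of r s \<theta>] by simp
    moreover have "\<bar>Re s\<bar> = 1" "cmod (r * exp (\<i> * \<theta>)) \<le> sqrt 6" using r s by (auto simp: norm_mult)
    ultimately show "p \<in> slice_fibre" unfolding slice_fibre_def by blast
  qed
qed

theorem proposition4p9:
  fixes \<gamma> :: real
  assumes "0 < \<gamma>" and "\<gamma> < 1 / 48"
  shows
    "focus_focus_point (fn_F \<gamma> (1 / 2)) point_A \<and>
     focus_focus_point (fn_F \<gamma> (1 / 2)) point_B \<and>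
     focus_focus_point (fn_F \<gamma> (1 / 2)) point_C \<and>
     focus_focus_point (fn_F \<gamma> (1 / 2)) point_D \<and>
     point_A \<in> fibre (fn_F \<gamma> (1 / 2)) (1, 0) \<and>
     point_B \<in> fibre (fn_F \<gamma> (1 / 2)) (1, 0) \<and>
     point_C \<in> fibre (fn_F \<gamma> (1 / 2)) (2, 0) \<and>
     point_D \<in> fibre (fn_F \<gamma> (1 / 2)) (2, 0) \<and>
     double_pinched_torus (fibre (fn_F \<gamma> (1 / 2)) (1, 0)) point_A point_B \<and>
     double_pinched_torus (fibre (fn_F \<gamma> (1 / 2)) (2, 0)) point_C point_D \<and>
     fibre (fn_F \<gamma> (1 / 2)) (1, 0) =
       {p \<in> quot_M. \<exists>z8 :: complex. \<exists>s \<in> {1, - 1 :: complex}. cmod z8 \<in> {0..sqrt 6} \<and>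
          p = pt [sqrt 2, sqrt (6 - (cmod z8)\<^sup>2), sqrt (6 - (cmod z8)\<^sup>2), sqrt (8 - (cmod z8)\<^sup>2),
                  2, sqrt (2 + (cmod z8)\<^sup>2), s * \<i> * cnj z8, z8]} \<and>
     fibre (fn_F \<gamma> (1 / 2)) (1, 0) =
       {p \<in> quot_M. \<exists>\<theta> \<in> {0..<2 * pi}. \<exists>r \<in> {0..sqrt 6}. \<exists>s \<in> {1, - 1 :: complex}.
          p = pt [sqrt 2, sqrt (6 - r\<^sup>2), sqrt (6 - r\<^sup>2), sqrt (8 - r\<^sup>2),
                  2, sqrt (2 + r\<^sup>2), s * r * \<i> * exp (- \<i> * \<theta>), r * exp (\<i> * \<theta>)]}"
proof -
  note F1 = fibre_eq_slice_fibre[OF assms(1)]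
  have F2: "fibre (fn_F \<gamma> (1 / 2)) (2, 0) = (`) flip_J ` slice_fibre"
    unfolding fibre_flip_J F1 ..
  have AB: "point_A \<in> slice_fibre" "point_B \<in> slice_fibre"
    using sphere_maps_meet unfolding slice_fibre_eq_spheres by blast+
  then have CD: "point_C \<in> (`) flip_J ` slice_fibre" "point_D \<in> (`) flip_J ` slice_fibre"
    unfolding point_C_eq point_D_eq by blast+
  have DAB: "double_pinched_torus slice_fibre point_A point_B"
    using double_pinched_torus_AB unfolding slice_fibre_eq_spheres .
  have DCD: "double_pinched_torus ((`) flip_J ` slice_fibre) point_C point_D"
    using double_pinched_torus_CD unfolding slice_fibre_eq_spheres .
  show ?thesis
    unfolding F1 F2
    by (intro conjI focus_focus_points assms(1) AB CD DAB DCD slice_fibre_eq_pt slice_fibre_eq_polar)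
qed

end
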